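(* Let $m,\ell\in\mathbb{N}$ and let $\mathcal{F}=\{f_1,\dots,f_m\}\subset L^2(\mathbb{R}^d)$. Then for each $N\in\mathbb{N}$ with $N\ge\ell$ there exists a Paley-Wiener space $V^*\in\mathcal{T}^{\ell}_N$ such that $$\sum_{j=1}^{m}\|f_j-P_{V^*}f_j\|^2\le\sum_{j=1}^{m}\|f_j-P_Vf_j\|^2\qquad\text{for all }V\in\mathcal{T}^{\ell}_N .$$
   Context: Fourier transform: $\widehat f(\omega)=\int_{\mathbb{R}^d}e^{-2\pi i\omega\cdot x}f(x)\,dx$, extended to $L^2(\mathbb{R}^d)$. Translation: $T_xf=f(\cdot-x)$. $P_V$ is the orthogonal projection onto the closed subspace $V$. For $\varphi_1,\dots,\varphi_\ell\in L^2(\mathbb{R}^d)$, $S(\varphi_1,\dots,\varphi_\ell)=\overline{\mathrm{span}}\{T_k\varphi_j:k\in\mathbb{Z}^d,\ j=1,\dots,\ell\}$. $\mathcal{T}^\ell$ is the set of all spaces $V=S(\varphi_1,\dots,\varphi_\ell)$, for some $\varphi_1,\dots,\varphi_\ell\in L^2(\mathbb{R}^d)$, such that $V$ is translation invariant (i.e. $T_xf\in V$ for all $x\in\mathbb{R}^d$ and $f\in V$) and the integer translates $\{T_k\varphi_j:k\in\mathbb{Z}^d,\ j=1,\dots,\ell\}$ form a Riesz basis of $V$. For measurable $\Omega\subset\mathbb{R}^d$, the (generalized) Paley-Wiener space is $V_\Omega=\{f\in L^2(\mathbb{R}^d):\widehat f(\omega)=0\text{ for a.e. }\omega\in\mathbb{R}^d\setminus\Omega\}$.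 A measurable set $\Omega$ is said to $\ell$ multi-tile $\mathbb{R}^d$ if $\sum_{k\in\mathbb{Z}^d}\chi_\Omega(\omega-k)=\ell$ for a.e. $\omega\in\mathbb{R}^d$. For $N\in\mathbb{N}$: $C_N=[-(N+1/2),N+1/2]^d$; $M_N^\ell=\{\Omega\subset C_N:\Omega\text{ is measurable and }\ell\text{ multi-tiles }\mathbb{R}^d\}$; $\mathcal{T}_N^\ell=\{V\in\mathcal{T}^\ell:V=V_\Omega\text{ with }\Omega\in M_N^\ell\}$. *)

theory Defs
  imports "HOL-Analysis.Analysis"
begin

text \<open>
  Elements of \<open>L\<^sup>2\<close> are represented by Lebesgue measurable, square-integrable functions.  All
  subspaces defined below are closed under equality almost everywhere, and all scalar quantities
  are invariant under it, so that they correspond to the usual notions on equivalence classes.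
\<close>

definition L2_space :: "(real^'d \<Rightarrow> complex) set" where
  "L2_space = {f \<in> borel_measurable lebesgue. integrable lebesgue (\<lambda>x. (norm (f x))\<^sup>2)}"

definition L2_inner :: "(real^'d \<Rightarrow> complex) \<Rightarrow> (real^'d \<Rightarrow> complex) \<Rightarrow> complex" where
  "L2_inner f g = (LINT x|lebesgue. f x * cnj (g x))"

text \<open>This is the \<open>L\<^sup>2\<close> norm only on \<^const>\<open>L2_space\<close>; elsewhere the integral has a default value.\<close>

definition L2_norm :: "(real^'d \<Rightarrow> complex) \<Rightarrow> real" where
  "L2_norm f = sqrt (LINT x|lebesgue. (norm (f x))\<^sup>2)"

definition fourier :: "(real^'d \<Rightarrow> complex) \<Rightarrow> real^'d \<Rightarrow> complex" where
  "fourier f \<omega> = (LINT x|lebesgue. exp (- (2 * pi * \<i> * of_real (\<omega> \<bullet> x))) * f x)"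

text \<open>
  The extension of the Fourier transform to \<open>L\<^sup>2\<close> by continuity from the dense subspace
  \<open>L\<^sup>1 \<inter> L\<^sup>2\<close>: \<open>g\<close> is the \<open>L\<^sup>2\<close> limit of the transforms of functions in \<open>L\<^sup>1 \<inter> L\<^sup>2\<close> that approximate
  \<open>f\<close> in \<open>L\<^sup>2\<close>.  By Plancherel's theorem such a \<open>g\<close> exists for every \<open>f\<close> in \<open>L\<^sup>2\<close> and is unique up
  to equality almost everywhere.
\<close>

definition is_fourier_L2 :: "(real^'d \<Rightarrow> complex) \<Rightarrow> (real^'d \<Rightarrow> complex) \<Rightarrow> bool" where
  "is_fourier_L2 f g \<longleftrightarrow> f \<in> L2_space \<and> g \<in> L2_space \<and>
    (\<exists>h. (\<forall>n. integrable lebesgue (h n) \<and> h n \<in> L2_space \<and> fourier (h n) \<in> L2_space) \<and>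
         (\<lambda>n. L2_norm (\<lambda>x. h n x - f x)) \<longlonglongrightarrow> 0 \<and>
         (\<lambda>n. L2_norm (\<lambda>\<omega>. fourier (h n) \<omega> - g \<omega>)) \<longlonglongrightarrow> 0)"

definition fourier_L2 :: "(real^'d \<Rightarrow> complex) \<Rightarrow> real^'d \<Rightarrow> complex" where
  "fourier_L2 f = (SOME g. is_fourier_L2 f g)"

definition translate :: "real^'d \<Rightarrow> (real^'d \<Rightarrow> complex) \<Rightarrow> real^'d \<Rightarrow> complex" where
  "translate x f = (\<lambda>y. f (y - x))"

definition int_lattice :: "(real^'d) set" where
  "int_lattice = {k. \<forall>i. k $ i \<in> \<int>}"

text \<open>
  The closure in \<open>L\<^sup>2\<close> of the set of finite complex linear combinations of members of \<open>X\<close>.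
\<close>

definition closed_span :: "(real^'d \<Rightarrow> complex) set \<Rightarrow> (real^'d \<Rightarrow> complex) set" where
  "closed_span X = {f \<in> L2_space. \<forall>\<epsilon>>0. \<exists>F c. finite F \<and> F \<subseteq> X \<and>
     L2_norm (\<lambda>x. f x - (\<Sum>g\<in>F. c g * g x)) < \<epsilon>}"

text \<open>
  A Riesz basis of a closed subspace \<open>V\<close>: a complete family in \<open>V\<close> satisfying two-sided
  \<open>\<ell>\<^sup>2\<close>-bounds on all finite linear combinations.
\<close>

definition riesz_basis ::
    "(real^'d \<Rightarrow> complex) set \<Rightarrow> 'i set \<Rightarrow> ('i \<Rightarrow> real^'d \<Rightarrow> complex) \<Rightarrow> bool" where
  "riesz_basis V I u \<longleftrightarrow> u ` I \<subseteq> L2_space \<and> closed_span (u ` I) = V \<and>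
    (\<exists>A>0. \<exists>B>0. \<forall>F c. finite F \<and> F \<subseteq> I \<longrightarrow>
       A * (\<Sum>i\<in>F. (norm (c i :: complex))\<^sup>2) \<le> (L2_norm (\<lambda>x. \<Sum>i\<in>F. c i * u i x))\<^sup>2 \<and>
       (L2_norm (\<lambda>x. \<Sum>i\<in>F. c i * u i x))\<^sup>2 \<le> B * (\<Sum>i\<in>F. (norm (c i))\<^sup>2))"

text \<open>
  For a closed subspace \<open>V\<close> of \<open>L\<^sup>2\<close> and \<open>f\<close> in \<open>L\<^sup>2\<close>, the projection is determined up to
  equality almost everywhere.
\<close>

definition orth_proj ::
    "(real^'d \<Rightarrow> complex) set \<Rightarrow> (real^'d \<Rightarrow> complex) \<Rightarrow> real^'d \<Rightarrow> complex" where
  "orth_proj V f = (SOME p. p \<in> V \<and> (\<forall>g\<in>V. L2_inner (\<lambda>x. f x - p x) g = 0))"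

definition shift_space :: "nat \<Rightarrow> (nat \<Rightarrow> real^'d \<Rightarrow> complex) \<Rightarrow> (real^'d \<Rightarrow> complex) set" where
  "shift_space l \<phi> = closed_span {translate k (\<phi> j) | k j. k \<in> int_lattice \<and> j \<in> {1..l}}"

definition translation_invariant :: "(real^'d \<Rightarrow> complex) set \<Rightarrow> bool" where
  "translation_invariant V \<longleftrightarrow> (\<forall>x. \<forall>f\<in>V. translate x f \<in> V)"

definition TI_spaces :: "nat \<Rightarrow> (real^'d \<Rightarrow> complex) set set" where
  "TI_spaces l = {V. \<exists>\<phi>. (\<forall>j\<in>{1..l}. \<phi> j \<in> L2_space) \<and> V = shift_space l \<phi> \<and>
     translation_invariant V \<and>
     riesz_basis V (int_lattice \<times> {1..l}) (\<lambda>(k, j). translate k (\<phi> j))}"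

definition paley_wiener :: "(real^'d) set \<Rightarrow> (real^'d \<Rightarrow> complex) set" where
  "paley_wiener \<Omega> = {f \<in> L2_space. AE \<omega> in lebesgue. \<omega> \<notin> \<Omega> \<longrightarrow> fourier_L2 f \<omega> = 0}"

definition multi_tiles :: "nat \<Rightarrow> (real^'d) set \<Rightarrow> bool" where
  "multi_tiles l \<Omega> \<longleftrightarrow>
    (AE \<omega> in lebesgue. ((\<lambda>k. indicator \<Omega> (\<omega> - k) :: real) has_sum real l) int_lattice)"

definition cube :: "nat \<Rightarrow> (real^'d) set" where
  "cube N = cbox (\<chi> i. - (real N + 1/2)) (\<chi> i. real N + 1/2)"

definition multi_tile_sets :: "nat \<Rightarrow> nat \<Rightarrow> (real^'d) set set" where
  "multi_tile_sets l N = {\<Omega>. \<Omega> \<subseteq> cube N \<and> \<Omega> \<in> sets lebesgue \<and> multi_tiles l \<Omega>}"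

definition TI_PW_spaces :: "nat \<Rightarrow> nat \<Rightarrow> (real^'d \<Rightarrow> complex) set set" where
  "TI_PW_spaces l N = {V \<in> TI_spaces l. \<exists>\<Omega>\<in>multi_tile_sets l N. V = paley_wiener \<Omega>}"

end

theory Submission
  imports Defs "HOL-Probability.Characteristic_Functions"
begin

text \<open>
  The Fourier transform is a unitary map of \<open>L\<^sup>2\<close> under which the Paley-Wiener space of \<open>\<Omega>\<close> becomes
  the space of functions vanishing off \<open>\<Omega>\<close>. The squared distance of \<open>f\<close> from that space is the mass
  of its transform outside \<open>\<Omega>\<close> (\<open>paley_wiener_projection_error\<close>). Hence the total error of the data is
  a constant minus \<open>\<integral>\<^sub>\<Omega> H\<close>, where \<open>H\<close> is the sum of the squared moduli of the transforms, and the
  problem is to maximise \<open>\<integral>\<^sub>\<Omega> H\<close> over the subsets \<open>\<Omega>\<close> of the cube that meet almost every coset of the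
  integer lattice in exactly \<open>l\<close> points. This can be done coset by coset: every coset has more than
  \<open>N \<ge> l\<close> but only finitely many points in the cube (\<open>card_fibre_cube\<close>), and the best choice consists of
  the \<open>l\<close> points with the largest values of \<open>H\<close>. With ties broken in a measurable way, these points
  form a measurable multi-tile (\<open>top_tiles_multi_tile\<close>, \<open>top_tiles_optimal\<close>).

  It remains to see that the Paley-Wiener space of a bounded multi-tile has a Riesz basis of integer
  translates (\<open>paley_wiener_in_TI_spaces\<close>). Ranking the points of each coset cuts the multi-tile into
  \<open>l\<close> tiles, which meet almost every coset once. On a tile the exponentials with integer frequencies
  are a complete orthogonal family of vectors of equal norm, and they are the transforms of the integer
  translates of a single function.

  Two density statements carry the analysis, and both come from one application of the
  Stone-Weierstrass theorem on the torus (\<open>periodized_compact_indicator\<close>), combined with the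
  regularity of Lebesgue measure (\<open>weighted_density\<close>). One is the completeness of the exponentials on a
  tile. The other is the density of the modulated Gaussians (\<open>gabor_total\<close>), from which Plancherel's
  theorem follows: the transforms of shifted and modulated Gaussians are again such Gaussians, the
  multiplication formula gives Parseval's identity for an integrable function and a Gaussian, and
  density extends it to all of \<open>L\<^sup>2\<close>. The relation \<open>fourier_pair\<close> expresses the transform by this
  identity alone, which makes its linearity, its behaviour under translations and its invertibility
  short computations with Gaussians.
\<close>

section \<open>The Hilbert space of square-integrable functions\<close>

lemma borel_measurable_cnj [measurable (raw)]:
  "f \<in> borel_measurable M \<Longrightarrow> (\<lambda>x. cnj (f x)) \<in> borel_measurable M"
  by (rule borel_measurable_continuous_on[OF continuous_on_cnj[OF continuous_on_id]])

lemma L2_measurable: "f \<in> L2_space \<Longrightarrow> f \<in> borel_measurable lebesgue"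
  by (simp add: L2_space_def)

lemma L2_integrable: "f \<in> L2_space \<Longrightarrow> integrable lebesgue (\<lambda>x. (norm (f x))\<^sup>2)"
  by (simp add: L2_space_def)

lemma L2I:
  "f \<in> borel_measurable lebesgue \<Longrightarrow> integrable lebesgue (\<lambda>x. (norm (f x))\<^sup>2) \<Longrightarrow> f \<in> L2_space"
  by (simp add: L2_space_def)

lemma L2_dominated:
  assumes g: "g \<in> L2_space" and f: "f \<in> borel_measurable lebesgue"
    and le: "AE x in lebesgue. norm (f x) \<le> c * norm (g x)"
  shows "f \<in> L2_space"
proof (rule L2I[OF f])
  show "integrable lebesgue (\<lambda>x. (norm (f x))\<^sup>2)"
  proof (rule Bochner_Integration.integrable_bound)
    show "integrable lebesgue (\<lambda>x. c\<^sup>2 * (norm (g x))\<^sup>2)"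
      using L2_integrable[OF g] by simp
    show "(\<lambda>x. (norm (f x))\<^sup>2) \<in> borel_measurable lebesgue"
      using f by measurable
    show "AE x in lebesgue. norm ((norm (f x))\<^sup>2) \<le> norm (c\<^sup>2 * (norm (g x))\<^sup>2)"
      using le by eventually_elim (auto simp: power_mult_distrib[symmetric] intro: power_mono)
  qed
qed

lemma L2_cong_AE:
  assumes "g \<in> L2_space" "f \<in> borel_measurable lebesgue" "AE x in lebesgue. f x = g x"
  shows "f \<in> L2_space"
proof (rule L2_dominated[OF assms(1,2)])
  show "AE x in lebesgue. norm (f x) \<le> 1 * norm (g x)"
    using assms(3) by eventually_elim simp
qed

lemma L2_scale:
  assumes "f \<in> L2_space" shows "(\<lambda>x. c * f x) \<in> L2_space"
proof (rule L2_dominated[OF assms, where c="norm c"])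
  show "(\<lambda>x. c * f x) \<in> borel_measurable lebesgue"
    using L2_measurable[OF assms] by measurable
qed (simp add: norm_mult)

lemma norm_add_sq_le: "(norm (a + b))\<^sup>2 \<le> 2 * (norm a)\<^sup>2 + 2 * (norm (b::complex))\<^sup>2"
proof -
  have "(norm (a + b))\<^sup>2 \<le> (norm a + norm b)\<^sup>2"
    by (intro power_mono norm_triangle_ineq) auto
  also have "\<dots> \<le> 2 * (norm a)\<^sup>2 + 2 * (norm b)\<^sup>2"
    using sum_squares_bound[of "norm a" "norm b"] by (simp add: power2_sum)
  finally show ?thesis .
qed

lemma L2_add:
  assumes f: "f \<in> L2_space" and g: "g \<in> L2_space" shows "(\<lambda>x. f x + g x) \<in> L2_space"
proof (rule L2I)
  have [measurable]: "f \<in> borel_measurable lebesgue" "g \<in> borel_measurable lebesgue"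
    using assms L2_measurable by auto
  show m: "(\<lambda>x. f x + g x) \<in> borel_measurable lebesgue" by measurable
  show "integrable lebesgue (\<lambda>x. (norm (f x + g x))\<^sup>2)"
  proof (rule Bochner_Integration.integrable_bound)
    show "integrable lebesgue (\<lambda>x. 2 * (norm (f x))\<^sup>2 + 2 * (norm (g x))\<^sup>2)"
      using L2_integrable[OF f] L2_integrable[OF g] by simp
  qed (use norm_add_sq_le in \<open>auto simp: abs_of_nonneg\<close>)
qed

lemma L2_zero: "(\<lambda>x. 0) \<in> L2_space"
  by (rule L2I) auto

lemma L2_uminus: "f \<in> L2_space \<Longrightarrow> (\<lambda>x. - f x) \<in> L2_space"
  using L2_scale[of f "-1"] by simp

lemma L2_diff: "f \<in> L2_space \<Longrightarrow> g \<in> L2_space \<Longrightarrow> (\<lambda>x. f x - g x) \<in> L2_space"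
  using L2_add[of f "\<lambda>x. - g x"] L2_uminus[of g] by simp

lemma L2_sum: "(\<And>i. i \<in> I \<Longrightarrow> f i \<in> L2_space) \<Longrightarrow> (\<lambda>x. \<Sum>i\<in>I. f i x) \<in> L2_space"
  by (induction I rule: infinite_finite_induct) (auto intro: L2_zero L2_add)

lemma L2_mult_bounded:
  assumes "f \<in> L2_space" "g \<in> borel_measurable lebesgue" "\<And>x. norm (g x) \<le> c"
  shows "(\<lambda>x. g x * f x) \<in> L2_space"
proof (rule L2_dominated[OF assms(1), where c=c])
  show "(\<lambda>x. g x * f x) \<in> borel_measurable lebesgue"
    using L2_measurable[OF assms(1)] assms(2) by measurable
qed (simp add: norm_mult mult_right_mono assms)

lemma L2_indicator:
  assumes "f \<in> L2_space" "A \<in> sets lebesgue"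
  shows "(\<lambda>x. indicator A x * f x) \<in> L2_space"
proof (rule L2_mult_bounded[OF assms(1), where c=1])
  show "indicator A \<in> borel_measurable lebesgue"
    using assms(2) by measurable
qed (auto simp: indicator_def)

lemma L2_norm_nonneg [simp]: "L2_norm f \<ge> 0"
  by (simp add: L2_norm_def)

lemma L2_norm_power2: "(L2_norm f)\<^sup>2 = (LINT x|lebesgue. (norm (f x))\<^sup>2)"
  by (simp add: L2_norm_def)

lemma L2_norm_zero [simp]: "L2_norm (\<lambda>x. 0) = 0"
  by (simp add: L2_norm_def)

lemma L2_norm_cong: "(\<And>x. norm (f x) = norm (g x)) \<Longrightarrow> L2_norm f = L2_norm g"
  by (simp add: L2_norm_def)

lemma L2_norm_cong_AE:
  assumes "f \<in> borel_measurable lebesgue" "g \<in> borel_measurable lebesgue"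
    "AE x in lebesgue. norm (f x) = norm (g x)"
  shows "L2_norm f = L2_norm g"
proof -
  have "(LINT x|lebesgue. (norm (f x))\<^sup>2) = (LINT x|lebesgue. (norm (g x))\<^sup>2)"
  proof (rule integral_cong_AE)
    show "AE x in lebesgue. (norm (f x))\<^sup>2 = (norm (g x))\<^sup>2"
      using assms(3) by eventually_elim simp
  qed (use assms(1,2) in measurable)
  then show ?thesis by (simp add: L2_norm_def)
qed

lemma L2_norm_mono_AE:
  assumes "g \<in> L2_space" "f \<in> L2_space"
    "AE x in lebesgue. norm (f x) \<le> norm (g x)"
  shows "L2_norm f \<le> L2_norm g"
  unfolding L2_norm_def
  using assms(3) by (auto intro!: integral_mono_AE L2_integrable assms simp: power_mono elim!: eventually_mono)

lemma L2_norm_eq_0: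
  assumes "f \<in> L2_space"
  shows "L2_norm f = 0 \<longleftrightarrow> (AE x in lebesgue. f x = 0)"
  using integral_nonneg_eq_0_iff_AE[OF L2_integrable[OF assms]] by (simp add: L2_norm_def)

lemma L2_norm_scale: "L2_norm (\<lambda>x. c * f x) = norm c * L2_norm f"
  by (simp add: L2_norm_def norm_mult power_mult_distrib real_sqrt_mult)

lemma L2_norm_minus_commute: "L2_norm (\<lambda>x. f x - g x) = L2_norm (\<lambda>x. g x - f x)"
  by (rule L2_norm_cong) (rule norm_minus_commute)

lemma L2_inner_integrable:
  assumes f: "f \<in> L2_space" and g: "g \<in> L2_space"
  shows "integrable lebesgue (\<lambda>x. f x * cnj (g x))"
proof (rule Bochner_Integration.integrable_bound)
  have [measurable]: "f \<in> borel_measurable lebesgue" "g \<in> borel_measurable lebesgue"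
    using assms L2_measurable by auto
  show "(\<lambda>x. f x * cnj (g x)) \<in> borel_measurable lebesgue"
    by measurable
  show "integrable lebesgue (\<lambda>x. (norm (f x))\<^sup>2 + (norm (g x))\<^sup>2)"
    using L2_integrable[OF f] L2_integrable[OF g] by simp
  have "norm (f x) * norm (g x) \<le> (norm (f x))\<^sup>2 + (norm (g x))\<^sup>2" for x
    using sum_squares_bound[of "norm (f x)" "norm (g x)"]
      mult_nonneg_nonneg[OF norm_ge_zero norm_ge_zero, of "f x" "g x"] by linarith
  then show "AE x in lebesgue. norm (f x * cnj (g x)) \<le> norm ((norm (f x))\<^sup>2 + (norm (g x))\<^sup>2)"
    by (auto simp: norm_mult abs_of_nonneg)
qed

lemma L2_inner_add_left:
  "f \<in> L2_space \<Longrightarrow> g \<in> L2_space \<Longrightarrow> h \<in> L2_space \<Longrightarrow>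
    L2_inner (\<lambda>x. f x + g x) h = L2_inner f h + L2_inner g h"
  unfolding L2_inner_def
  by (subst Bochner_Integration.integral_add[symmetric])
    (auto intro: L2_inner_integrable simp: algebra_simps)

lemma L2_inner_scale_left: "L2_inner (\<lambda>x. c * f x) h = c * L2_inner f h"
  unfolding L2_inner_def by (simp add: mult.assoc)

lemma L2_inner_cnj: "cnj (L2_inner f g) = L2_inner g f"
  unfolding L2_inner_def by (subst Bochner_Integration.integral_cnj[symmetric]) (simp add: mult.commute)

lemma L2_inner_add_right:
  "f \<in> L2_space \<Longrightarrow> g \<in> L2_space \<Longrightarrow> h \<in> L2_space \<Longrightarrow>
    L2_inner h (\<lambda>x. f x + g x) = L2_inner h f + L2_inner h g"
  using L2_inner_add_left[of f g h] by (metis L2_inner_cnj complex_cnj_add)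

lemma L2_inner_scale_right: "L2_inner h (\<lambda>x. c * f x) = cnj c * L2_inner h f"
  using L2_inner_scale_left[of c f h] by (metis L2_inner_cnj complex_cnj_mult)

lemma L2_inner_diff_left:
  "f \<in> L2_space \<Longrightarrow> g \<in> L2_space \<Longrightarrow> h \<in> L2_space \<Longrightarrow>
    L2_inner (\<lambda>x. f x - g x) h = L2_inner f h - L2_inner g h"
  using L2_inner_add_left[of f "\<lambda>x. (-1) * g x" h] L2_inner_scale_left[of "-1" g h] L2_uminus[of g]
  by simp

lemma L2_inner_diff_right:
  "f \<in> L2_space \<Longrightarrow> g \<in> L2_space \<Longrightarrow> h \<in> L2_space \<Longrightarrow>
    L2_inner h (\<lambda>x. f x - g x) = L2_inner h f - L2_inner h g"
  using L2_inner_diff_left[of f g h] by (metis L2_inner_cnj complex_cnj_diff)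

lemma L2_inner_sum_right:
  assumes v: "v \<in> L2_space" and u: "\<And>i. i \<in> I \<Longrightarrow> u i \<in> L2_space"
  shows "L2_inner v (\<lambda>x. \<Sum>i\<in>I. c i * u i x) = (\<Sum>i\<in>I. cnj (c i) * L2_inner v (u i))"
  using u
proof (induction I rule: infinite_finite_induct)
  case (insert i I)
  then show ?case
    by (simp add: L2_inner_add_right L2_scale L2_sum v L2_inner_scale_right)
qed (simp_all add: L2_inner_def)

lemma L2_inner_self: "L2_inner f f = of_real ((L2_norm f)\<^sup>2)"
  unfolding L2_inner_def L2_norm_power2
  by (simp add: complex_norm_square[symmetric] del: of_real_power)

lemma L2_Cauchy_Schwarz:
  assumes f: "f \<in> L2_space" and g: "g \<in> L2_space"
  shows "norm (L2_inner f g) \<le> L2_norm f * L2_norm g"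
proof (cases "L2_norm g = 0")
  case True
  then have "AE x in lebesgue. g x = 0" using L2_norm_eq_0[OF g] by simp
  then have "AE x in lebesgue. f x * cnj (g x) = 0" by eventually_elim simp
  then have "L2_inner f g = 0" unfolding L2_inner_def
    by (rule integral_eq_zero_AE)
  then show ?thesis by simp
next
  case False
  \<comment> \<open>The multiple of \<open>g\<close> closest to \<open>f\<close>, so that the remainder is orthogonal to \<open>g\<close>.\<close>
  define c where "c = L2_inner f g / of_real ((L2_norm g)\<^sup>2)"
  let ?h = "\<lambda>x. f x - c * g x"
  have cg: "(\<lambda>x. c * g x) \<in> L2_space" by (rule L2_scale[OF g])
  have h: "?h \<in> L2_space" by (rule L2_diff[OF f cg])
  have "L2_inner ?h g = 0"
    using False by (simp add: L2_inner_diff_left[OF f cg g] L2_inner_scale_left, simp add: L2_inner_self c_def)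
  then have "L2_inner ?h ?h = L2_inner ?h f"
    by (simp add: L2_inner_diff_right[OF f cg h] L2_inner_scale_right)
  also have "\<dots> = L2_inner f f - c * L2_inner g f"
    by (simp add: L2_inner_diff_left[OF f cg f] L2_inner_scale_left)
  also have "c * L2_inner g f = of_real ((norm (L2_inner f g))\<^sup>2 / (L2_norm g)\<^sup>2)"
    unfolding c_def L2_inner_cnj[of f g, symmetric]
    using complex_norm_square[of "L2_inner f g"] by simp
  finally have "complex_of_real ((L2_norm ?h)\<^sup>2)
      = of_real ((L2_norm f)\<^sup>2 - (norm (L2_inner f g))\<^sup>2 / (L2_norm g)\<^sup>2)"
    by (simp add: L2_inner_self)
  then have "(norm (L2_inner f g))\<^sup>2 / (L2_norm g)\<^sup>2 \<le> (L2_norm f)\<^sup>2"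
    unfolding of_real_eq_iff using zero_le_power2[of "L2_norm ?h"] by linarith
  then have "(norm (L2_inner f g))\<^sup>2 \<le> (L2_norm f * L2_norm g)\<^sup>2"
    using False by (simp add: field_simps power_mult_distrib)
  then show ?thesis by (rule power2_le_imp_le) simp
qed

lemma L2_norm_add_power2:
  assumes f: "f \<in> L2_space" and g: "g \<in> L2_space"
  shows "(L2_norm (\<lambda>x. f x + g x))\<^sup>2 = (L2_norm f)\<^sup>2 + (L2_norm g)\<^sup>2 + 2 * Re (L2_inner f g)"
proof -
  have "complex_of_real ((L2_norm (\<lambda>x. f x + g x))\<^sup>2)
      = of_real ((L2_norm f)\<^sup>2) + of_real ((L2_norm g)\<^sup>2) + (L2_inner f g + cnj (L2_inner f g))"
    unfolding L2_inner_self[symmetric] L2_inner_cnj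
    by (simp add: L2_inner_add_left[OF f g L2_add[OF f g]] L2_inner_add_right f g)
  also have "\<dots> = of_real ((L2_norm f)\<^sup>2 + (L2_norm g)\<^sup>2 + 2 * Re (L2_inner f g))"
    by (simp add: complex_add_cnj)
  finally show ?thesis unfolding of_real_eq_iff .
qed

lemma L2_norm_triangle:
  assumes f: "f \<in> L2_space" and g: "g \<in> L2_space"
  shows "L2_norm (\<lambda>x. f x + g x) \<le> L2_norm f + L2_norm g"
proof (rule power2_le_imp_le)
  have "(L2_norm (\<lambda>x. f x + g x))\<^sup>2 = (L2_norm f)\<^sup>2 + (L2_norm g)\<^sup>2 + 2 * Re (L2_inner f g)"
    by (rule L2_norm_add_power2[OF assms])
  also have "Re (L2_inner f g) \<le> L2_norm f * L2_norm g"
    using complex_Re_le_cmod L2_Cauchy_Schwarz[OF assms] by (rule order_trans)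
  finally show "(L2_norm (\<lambda>x. f x + g x))\<^sup>2 \<le> (L2_norm f + L2_norm g)\<^sup>2"
    by (simp add: power2_sum)
qed simp

lemma L2_norm_triangle_diff:
  assumes "f \<in> L2_space" "g \<in> L2_space" "h \<in> L2_space"
  shows "L2_norm (\<lambda>x. f x - h x) \<le> L2_norm (\<lambda>x. f x - g x) + L2_norm (\<lambda>x. g x - h x)"
  using L2_norm_triangle[of "\<lambda>x. f x - g x" "\<lambda>x. g x - h x"] assms by (simp add: L2_diff)

lemma L2_norm_diff_abs:
  assumes "f \<in> L2_space" "g \<in> L2_space"
  shows "\<bar>L2_norm f - L2_norm g\<bar> \<le> L2_norm (\<lambda>x. f x - g x)"
  using L2_norm_triangle_diff[OF assms L2_zero] L2_norm_triangle_diff[OF assms(2,1) L2_zero]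
    L2_norm_minus_commute[of f g] by simp

lemma L2_norm_tendsto:
  assumes "\<And>n. h n \<in> L2_space" "f \<in> L2_space" "(\<lambda>n. L2_norm (\<lambda>x. h n x - f x)) \<longlonglongrightarrow> 0"
  shows "(\<lambda>n. L2_norm (h n)) \<longlonglongrightarrow> L2_norm f"
proof (rule LIM_zero_cancel, rule Lim_null_comparison[OF _ assms(3)])
  show "\<forall>\<^sub>F n in sequentially. norm (L2_norm (h n) - L2_norm f) \<le> L2_norm (\<lambda>x. h n x - f x)"
    using L2_norm_diff_abs[OF assms(1,2)] by simp
qed

lemma L2_inner_tendsto:
  assumes "\<And>n. h n \<in> L2_space" "f \<in> L2_space" "(\<lambda>n. L2_norm (\<lambda>x. h n x - f x)) \<longlonglongrightarrow> 0"
    and g: "g \<in> L2_space"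
  shows "(\<lambda>n. L2_inner (h n) g) \<longlonglongrightarrow> L2_inner f g"
proof (rule LIM_zero_cancel, rule Lim_null_comparison)
  show "\<forall>\<^sub>F n in sequentially. norm (L2_inner (h n) g - L2_inner f g)
      \<le> L2_norm (\<lambda>x. h n x - f x) * L2_norm g"
    using L2_Cauchy_Schwarz[OF L2_diff[OF assms(1,2)] g] by (simp add: L2_inner_diff_left assms)
  show "(\<lambda>n. L2_norm (\<lambda>x. h n x - f x) * L2_norm g) \<longlonglongrightarrow> 0"
    using tendsto_mult_right[OF assms(3), of "L2_norm g"] by simp
qed

text \<open>
  The squared differences are dominated by a multiple of the square of the majorant, so the
  usual convergence theorem applies to their integrals.
\<close>

lemma L2_dominated_convergence:
  fixes f :: "real^'a \<Rightarrow> complex"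
  assumes w: "w \<in> L2_space" and h: "\<And>n. h n \<in> borel_measurable lebesgue"
    and f: "f \<in> borel_measurable lebesgue"
    and le: "\<And>n. AE x in lebesgue. norm (h n x) \<le> c * norm (w x)"
    and lim: "AE x in lebesgue. (\<lambda>n. h n x) \<longlonglongrightarrow> f x"
  shows "f \<in> L2_space" "\<And>n. h n \<in> L2_space" "(\<lambda>n. L2_norm (\<lambda>x. h n x - f x)) \<longlonglongrightarrow> 0"
proof -
  note [measurable] = h f
  have AEall: "AE x in lebesgue. \<forall>n. norm (h n x) \<le> c * norm (w x)"
    using le by (simp add: AE_all_countable)
  have fle: "AE x in lebesgue. norm (f x) \<le> c * norm (w x)"
    using AEall lim
  proof eventually_elim
    case (elim x)
    then show ?case by (intro Lim_norm_ubound[of sequentially "\<lambda>n. h n x"]) auto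
  qed
  show fL: "f \<in> L2_space" by (rule L2_dominated[OF w f fle])
  show hL: "\<And>n. h n \<in> L2_space" by (rule L2_dominated[OF w h le])
  have "(\<lambda>n. LINT x|lebesgue. (norm (h n x - f x))\<^sup>2) \<longlonglongrightarrow> (LINT x|(lebesgue :: (real^'a) measure). (0::real))"
  proof (rule integral_dominated_convergence[where w="\<lambda>x. (2 * c)\<^sup>2 * (norm (w x))\<^sup>2"])
    show "integrable lebesgue (\<lambda>x. (2 * c)\<^sup>2 * (norm (w x))\<^sup>2)"
      using L2_integrable[OF w] by simp
    show "AE x in lebesgue. (\<lambda>n. (norm (h n x - f x))\<^sup>2) \<longlonglongrightarrow> 0"
      using lim
    proof eventually_elim
      case (elim x)
      then have "(\<lambda>n. h n x - f x) \<longlonglongrightarrow> 0" by (rule LIM_zero)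
      then have "(\<lambda>n. (norm (h n x - f x))\<^sup>2) \<longlonglongrightarrow> 0\<^sup>2" by (intro tendsto_power tendsto_norm_zero)
      then show ?case by simp
    qed
    fix n
    show "AE x in lebesgue. norm ((norm (h n x - f x))\<^sup>2) \<le> (2 * c)\<^sup>2 * (norm (w x))\<^sup>2"
      using AEall fle
    proof eventually_elim
      case (elim x)
      have "norm (h n x - f x) \<le> 2 * c * norm (w x)"
        using norm_triangle_ineq4[of "h n x" "f x"] elim(2) spec[OF elim(1), of n] by linarith
      then have "(norm (h n x - f x))\<^sup>2 \<le> (2 * c * norm (w x))\<^sup>2"
        by (rule power_mono) simp
      then show ?case by (simp add: power_mult_distrib)
    qed
  qed measurable
  then have "(\<lambda>n. sqrt (LINT x|lebesgue. (norm (h n x - f x))\<^sup>2)) \<longlonglongrightarrow> sqrt 0"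
    by (intro tendsto_real_sqrt) simp
  then show "(\<lambda>n. L2_norm (\<lambda>x. h n x - f x)) \<longlonglongrightarrow> 0" by (simp add: L2_norm_def)
qed

text \<open>
  The Riesz-Fischer theorem for sequences with geometrically decreasing steps: such a sequence
  converges pointwise almost everywhere, and Fatou's lemma turns the pointwise limit into a limit
  in the norm.
\<close>

lemma L2_complete_fast:
  assumes h: "\<And>n. h n \<in> L2_space"
    and fast: "\<And>n. L2_norm (\<lambda>x. h (Suc n) x - h n x) \<le> (1/2) ^ n"
  shows "\<exists>f\<in>L2_space. (\<lambda>n. L2_norm (\<lambda>x. h n x - f x)) \<longlonglongrightarrow> 0"
proof -
  note [measurable] = L2_measurable[OF h]
  \<comment> \<open>The factor \<open>2 ^ n\<close> leaves the integrals of \<open>g n\<close> summable and makes the steps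
    themselves summable wherever the sum of the \<open>g n\<close> is finite.\<close>
  define g where "g n x = 2 ^ n * (norm (h (Suc n) x - h n x))\<^sup>2" for n x
  have gi: "integrable lebesgue (g n)" for n
    unfolding g_def using L2_integrable[OF L2_diff[OF h h]] by simp
  have gI: "(LINT x|lebesgue. g n x) \<le> (1/2) ^ n" for n
  proof -
    have "(LINT x|lebesgue. g n x) = 2 ^ n * (L2_norm (\<lambda>x. h (Suc n) x - h n x))\<^sup>2"
      unfolding g_def L2_norm_power2 by simp
    also have "\<dots> \<le> 2 ^ n * ((1/2) ^ n)\<^sup>2"
      by (intro mult_left_mono power_mono fast) auto
    also have "\<dots> = (1/2) ^ n" by (simp add: power2_eq_square power_divide)
    finally show ?thesis .
  qed
  have nng: "(\<integral>\<^sup>+x. ennreal (g n x) \<partial>lebesgue) \<le> ennreal ((1/2) ^ n)" for n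
    using gI[of n] by (subst nn_integral_eq_integral[OF gi[of n]]) (auto simp: g_def[abs_def] intro!: ennreal_leI)
  have "(\<integral>\<^sup>+x. (\<Sum>n. ennreal (g n x)) \<partial>lebesgue) = (\<Sum>n. \<integral>\<^sup>+x. ennreal (g n x) \<partial>lebesgue)"
    by (rule nn_integral_suminf) (simp add: g_def)
  also have "\<dots> \<le> (\<Sum>n. ennreal ((1/2) ^ n))"
    by (intro suminf_le nng) auto
  also have "\<dots> = ennreal (\<Sum>n. (1/2) ^ n)"
    by (rule suminf_ennreal2) (auto intro: summable_geometric)
  also have "\<dots> < \<infinity>" by simp
  finally have "(\<integral>\<^sup>+x. (\<Sum>n. ennreal (g n x)) \<partial>lebesgue) \<noteq> \<infinity>" by simp
  then have "AE x in lebesgue. (\<Sum>n. ennreal (g n x)) \<noteq> \<infinity>"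
    by (rule nn_integral_noteq_infinite[rotated]) (simp add: g_def)
  then have conv: "AE x in lebesgue. convergent (\<lambda>n. h n x)"
  proof eventually_elim
    case (elim x)
    have sg: "summable (\<lambda>n. g n x)"
      by (rule summable_suminf_not_top) (use elim in \<open>auto simp: g_def top_ennreal.abs_eq infinity_ennreal_def\<close>)
    have "summable (\<lambda>n. h (Suc n) x - h n x)"
    proof (rule summable_comparison_test')
      show "summable (\<lambda>n. (1/2) ^ n + g n x)" by (intro summable_add sg summable_geometric) simp
      fix n
      let ?t = "norm (h (Suc n) x - h n x)"
      \<comment> \<open>With \<open>a = (1/2) ^ n\<close> this is \<open>2 t \<le> a + t\<^sup>2 / a\<close>.\<close>
      have "0 \<le> (1 - 2 ^ n * ?t)\<^sup>2" by simp
      then have "2 * (2 ^ n * ?t) \<le> 1 + (2 ^ n * ?t)\<^sup>2" by (simp add: power2_diff)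
      moreover have "(2 ^ n * ?t)\<^sup>2 = 2 ^ n * g n x" by (simp add: g_def power_mult_distrib power2_eq_square)
      moreover have "0 \<le> 2 ^ n * ?t" by simp
      ultimately have "2 ^ n * ?t \<le> 1 + 2 ^ n * g n x" by linarith
      then show "?t \<le> (1/2) ^ n + g n x" by (simp add: field_simps power_divide)
    qed
    then have "convergent (\<lambda>n. \<Sum>i<n. h (Suc i) x - h i x)" by (simp add: summable_iff_convergent)
    moreover have "(\<Sum>i<n. h (Suc i) x - h i x) = h n x - h 0 x" for n
      by (rule sum_lessThan_telescope)
    ultimately have "convergent (\<lambda>n. h n x - h 0 x)" by simp
    then have "convergent (\<lambda>n. (h n x - h 0 x) + h 0 x)" by (intro convergent_add convergent_const)
    then show ?case by simp
  qed
  define f where "f x = lim (\<lambda>n. h n x)" for x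
  have [measurable]: "f \<in> borel_measurable lebesgue" unfolding f_def by measurable
  have lim: "AE x in lebesgue. (\<lambda>n. h n x) \<longlonglongrightarrow> f x"
    using conv by eventually_elim (simp add: f_def convergent_LIMSEQ_iff)
  have cauchy: "L2_norm (\<lambda>x. h (n + m) x - h n x) \<le> 2 * (1/2) ^ n - 2 * (1/2) ^ (n + m)" for n m
  proof (induction m)
    case (Suc m)
    have "L2_norm (\<lambda>x. h (n + Suc m) x - h n x)
        \<le> L2_norm (\<lambda>x. h (Suc (n + m)) x - h (n + m) x) + L2_norm (\<lambda>x. h (n + m) x - h n x)"
      using L2_norm_triangle_diff[OF h[of "n + Suc m"] h[of "n + m"] h[of n]] by simp
    also have "\<dots> \<le> (1/2) ^ (n + m) + (2 * (1/2) ^ n - 2 * (1/2) ^ (n + m))"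
      using Suc.IH fast[of "n + m"] by (intro add_mono)
    finally show ?case by simp
  qed simp
  have fatou: "(\<integral>\<^sup>+x. ennreal ((norm (h n x - f x))\<^sup>2) \<partial>lebesgue) \<le> ennreal ((2 * (1/2) ^ n)\<^sup>2)" for n
  proof -
    have "(\<integral>\<^sup>+x. ennreal ((norm (h n x - f x))\<^sup>2) \<partial>lebesgue)
        = (\<integral>\<^sup>+x. liminf (\<lambda>m. ennreal ((norm (h (n + m) x - h n x))\<^sup>2)) \<partial>lebesgue)"
    proof (rule nn_integral_cong_AE, use lim in eventually_elim)
      case (elim x)
      have "(\<lambda>m. h (n + m) x) \<longlonglongrightarrow> f x"
        using LIMSEQ_ignore_initial_segment[OF elim, of n] by (simp add: add.commute)
      then have "(\<lambda>m. ennreal ((norm (h (n + m) x - h n x))\<^sup>2)) \<longlonglongrightarrow> ennreal ((norm (f x - h n x))\<^sup>2)"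
        by (intro tendsto_ennrealI tendsto_intros)
      then show ?case by (subst norm_minus_commute) (simp only: lim_imp_Liminf[OF sequentially_bot])
    qed
    also have "\<dots> \<le> liminf (\<lambda>m. \<integral>\<^sup>+x. ennreal ((norm (h (n + m) x - h n x))\<^sup>2) \<partial>lebesgue)"
      by (rule nn_integral_liminf) measurable
    also have "\<dots> \<le> liminf (\<lambda>m. ennreal ((2 * (1/2) ^ n)\<^sup>2))"
    proof (intro Liminf_mono always_eventually allI)
      fix m
      have "(\<integral>\<^sup>+x. ennreal ((norm (h (n + m) x - h n x))\<^sup>2) \<partial>lebesgue)
          = ennreal ((L2_norm (\<lambda>x. h (n + m) x - h n x))\<^sup>2)"
        unfolding L2_norm_power2 by (rule nn_integral_eq_integral[OF L2_integrable[OF L2_diff[OF h h]]]) simp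
      also have "\<dots> \<le> ennreal ((2 * (1/2) ^ n)\<^sup>2)"
        by (intro ennreal_leI power_mono order_trans[OF cauchy]) auto
      finally show "(\<integral>\<^sup>+x. ennreal ((norm (h (n + m) x - h n x))\<^sup>2) \<partial>lebesgue)
          \<le> ennreal ((2 * (1/2) ^ n)\<^sup>2)" .
    qed
    finally show ?thesis by (simp add: Liminf_const)
  qed
  have dL: "(\<lambda>x. h n x - f x) \<in> L2_space" for n
  proof (rule L2I)
    show "integrable lebesgue (\<lambda>x. (norm (h n x - f x))\<^sup>2)"
      using fatou[of n] by (intro integrableI_bounded) (auto intro: order_le_less_trans)
  qed measurable
  have "L2_norm (\<lambda>x. h n x - f x) \<le> 2 * (1/2) ^ n" for n
  proof (rule power2_le_imp_le)
    have "ennreal ((L2_norm (\<lambda>x. h n x - f x))\<^sup>2) \<le> ennreal ((2 * (1/2) ^ n)\<^sup>2)"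
      using fatou[of n] nn_integral_eq_integral[OF L2_integrable[OF dL[of n]]]
      by (simp add: L2_norm_power2)
    then show "(L2_norm (\<lambda>x. h n x - f x))\<^sup>2 \<le> (2 * (1/2) ^ n)\<^sup>2"
      by (subst (asm) ennreal_le_iff) auto
  qed simp
  moreover have "(\<lambda>n. 2 * (1/2) ^ n :: real) \<longlonglongrightarrow> 0"
    using tendsto_mult_right_zero[OF LIMSEQ_power_zero[of "1/2::real"], of 2] by simp
  ultimately have "(\<lambda>n. L2_norm (\<lambda>x. h n x - f x)) \<longlonglongrightarrow> 0"
    by (intro Lim_null_comparison[of "\<lambda>n. L2_norm (\<lambda>x. h n x - f x)" "\<lambda>n. 2 * (1/2) ^ n"]) simp_all
  moreover have "f \<in> L2_space" using L2_diff[OF h dL, of 0 0] by simp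
  ultimately show ?thesis by blast
qed

section \<open>Closed subspaces and density\<close>

text \<open>
  Closedness is expressed by approximation in norm, in the form that also makes such a set stable
  under equality almost everywhere.
\<close>

definition closed_subspace :: "(real^'d \<Rightarrow> complex) set \<Rightarrow> bool" where
  "closed_subspace W \<longleftrightarrow> W \<subseteq> L2_space \<and> (\<lambda>x. 0) \<in> W \<and>
    (\<forall>f\<in>W. \<forall>g\<in>W. (\<lambda>x. f x + g x) \<in> W) \<and> (\<forall>f\<in>W. \<forall>c. (\<lambda>x. c * f x) \<in> W) \<and>
    (\<forall>f\<in>L2_space. (\<forall>\<epsilon>>0. \<exists>g\<in>W. L2_norm (\<lambda>x. f x - g x) < \<epsilon>) \<longrightarrow> f \<in> W)"

lemma closed_subspace_L2: "closed_subspace W \<Longrightarrow> f \<in> W \<Longrightarrow> f \<in> L2_space"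
  by (auto simp: closed_subspace_def)

lemma closed_subspace_zero: "closed_subspace W \<Longrightarrow> (\<lambda>x. 0) \<in> W"
  by (auto simp: closed_subspace_def)

lemma closed_subspace_add: "closed_subspace W \<Longrightarrow> f \<in> W \<Longrightarrow> g \<in> W \<Longrightarrow> (\<lambda>x. f x + g x) \<in> W"
  by (auto simp: closed_subspace_def)

lemma closed_subspace_scale: "closed_subspace W \<Longrightarrow> f \<in> W \<Longrightarrow> (\<lambda>x. c * f x) \<in> W"
  by (auto simp: closed_subspace_def)

lemma closed_subspace_sum:
  "closed_subspace W \<Longrightarrow> (\<And>i. i \<in> I \<Longrightarrow> f i \<in> W) \<Longrightarrow> (\<lambda>x. \<Sum>i\<in>I. f i x) \<in> W"
  by (induction I rule: infinite_finite_induct)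
    (auto intro: closed_subspace_zero closed_subspace_add)

lemma closed_subspace_closed:
  "closed_subspace W \<Longrightarrow> f \<in> L2_space \<Longrightarrow> (\<And>\<epsilon>. \<epsilon> > 0 \<Longrightarrow> \<exists>g\<in>W. L2_norm (\<lambda>x. f x - g x) < \<epsilon>) \<Longrightarrow> f \<in> W"
  unfolding closed_subspace_def by blast

lemma closed_subspace_tendsto:
  assumes W: "closed_subspace W" and f: "f \<in> L2_space" and h: "\<And>n. h n \<in> W"
    and lim: "(\<lambda>n. L2_norm (\<lambda>x. h n x - f x)) \<longlonglongrightarrow> 0"
  shows "f \<in> W"
proof (rule closed_subspace_closed[OF W f])
  fix \<epsilon> :: real assume "\<epsilon> > 0"
  from order_tendstoD(2)[OF lim this] obtain n where "L2_norm (\<lambda>x. h n x - f x) < \<epsilon>"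
    by (auto simp: eventually_sequentially)
  then show "\<exists>g\<in>W. L2_norm (\<lambda>x. f x - g x) < \<epsilon>"
    using h[of n] L2_norm_minus_commute[of "h n" f] by auto
qed

lemma closed_subspace_AE:
  assumes W: "closed_subspace W" and g: "g \<in> W" and f: "f \<in> borel_measurable lebesgue"
    and eq: "AE x in lebesgue. f x = g x"
  shows "f \<in> W"
proof (rule closed_subspace_closed[OF W])
  have gL: "g \<in> L2_space" by (rule closed_subspace_L2[OF W g])
  show fL: "f \<in> L2_space" by (rule L2_cong_AE[OF gL f eq])
  have "AE x in lebesgue. f x - g x = 0" using eq by eventually_elim simp
  then have "L2_norm (\<lambda>x. f x - g x) = 0" using L2_norm_eq_0[OF L2_diff[OF fL gL]] by simp
  then show "\<exists>g\<in>W. L2_norm (\<lambda>x. f x - g x) < \<epsilon>" if "\<epsilon> > 0" for \<epsilon>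
    by (intro bexI[of _ g] g) (simp add: that)
qed

text \<open>
  The form in which closedness is used below: approximants are always multiples of a fixed
  square-integrable weight by uniformly bounded functions.
\<close>

lemma closed_subspace_dominated_limit:
  assumes W: "closed_subspace W" and w: "w \<in> L2_space" and h: "\<And>n. h n \<in> W"
    and f: "f \<in> borel_measurable lebesgue"
    and le: "\<And>n. AE x in lebesgue. norm (h n x) \<le> c * norm (w x)"
    and lim: "AE x in lebesgue. (\<lambda>n. h n x) \<longlonglongrightarrow> f x"
  shows "f \<in> W"
proof -
  have m: "h n \<in> borel_measurable lebesgue" for n
    by (rule L2_measurable[OF closed_subspace_L2[OF W h]])
  note L = L2_dominated_convergence[OF w m f le lim]
  show ?thesis by (rule closed_subspace_tendsto[OF W L(1) h L(3)])
qed

lemma closed_span_superset: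
  assumes "X \<subseteq> L2_space" "f \<in> X" shows "f \<in> closed_span X"
  unfolding closed_span_def
proof (intro CollectI conjI allI impI)
  fix \<epsilon> :: real assume "\<epsilon> > 0"
  then have "finite {f} \<and> {f} \<subseteq> X \<and> L2_norm (\<lambda>x. f x - (\<Sum>g\<in>{f}. 1 * g x)) < \<epsilon>"
    using assms by simp
  then show "\<exists>F c. finite F \<and> F \<subseteq> X \<and> L2_norm (\<lambda>x. f x - (\<Sum>g\<in>F. c g * g x)) < \<epsilon>"
    by (intro exI[of _ "{f}"] exI[of _ "\<lambda>_. 1"])
qed (use assms in auto)

lemma span_sum_L2:
  "X \<subseteq> L2_space \<Longrightarrow> F \<subseteq> X \<Longrightarrow> (\<lambda>x. \<Sum>g\<in>F. c g * g x) \<in> L2_space"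
  by (auto intro!: L2_sum L2_scale)

lemma closed_subspace_closed_span:
  assumes X: "X \<subseteq> L2_space" shows "closed_subspace (closed_span X)"
  unfolding closed_subspace_def
proof (intro conjI ballI allI impI)
  show "closed_span X \<subseteq> L2_space" by (auto simp: closed_span_def)
  show "(\<lambda>x. 0) \<in> closed_span X"
    unfolding closed_span_def using L2_zero by (auto intro!: exI[of _ "{}"])
next
  fix f g assume f: "f \<in> closed_span X" and g: "g \<in> closed_span X"
  then have fL: "f \<in> L2_space" and gL: "g \<in> L2_space" by (auto simp: closed_span_def)
  show "(\<lambda>x. f x + g x) \<in> closed_span X"
    unfolding closed_span_def
  proof (intro CollectI conjI allI impI L2_add fL gL)
    fix \<epsilon> :: real assume "\<epsilon> > 0"
    then have e: "\<epsilon> / 2 > 0" by simp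
    obtain F c where F: "finite F" "F \<subseteq> X" "L2_norm (\<lambda>x. f x - (\<Sum>g\<in>F. c g * g x)) < \<epsilon> / 2"
      using f e unfolding closed_span_def by blast
    obtain G d where G: "finite G" "G \<subseteq> X" "L2_norm (\<lambda>x. g x - (\<Sum>g\<in>G. d g * g x)) < \<epsilon> / 2"
      using g e unfolding closed_span_def by blast
    define b where "b h = (if h \<in> F then c h else 0) + (if h \<in> G then d h else 0)" for h
    have "(\<Sum>h\<in>F \<union> G. b h * h x) = (\<Sum>h\<in>F. c h * h x) + (\<Sum>h\<in>G. d h * h x)" for x
    proof -
      have "(\<Sum>h\<in>F \<union> G. b h * h x) = (\<Sum>h\<in>F \<union> G. (if h \<in> F then c h * h x else 0))
          + (\<Sum>h\<in>F \<union> G. (if h \<in> G then d h * h x else 0))"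
        unfolding sum.distrib[symmetric] by (intro sum.cong) (auto simp: b_def algebra_simps)
      also have "\<dots> = (\<Sum>h\<in>F. c h * h x) + (\<Sum>h\<in>G. d h * h x)"
        using F(1) G(1)
        by (auto simp: sum.inter_restrict[symmetric] Int_absorb1 Int_commute intro!: arg_cong2[where f="(+)"] sum.cong)
      finally show ?thesis .
    qed
    then have "(\<lambda>x. f x + g x - (\<Sum>h\<in>F \<union> G. b h * h x))
        = (\<lambda>x. (f x - (\<Sum>h\<in>F. c h * h x)) + (g x - (\<Sum>h\<in>G. d h * h x)))"
      by (auto simp: algebra_simps)
    moreover have "L2_norm (\<lambda>x. (f x - (\<Sum>h\<in>F. c h * h x)) + (g x - (\<Sum>h\<in>G. d h * h x))) < \<epsilon>"
      using L2_norm_triangle[OF L2_diff[OF fL span_sum_L2[OF X F(2), of c]] L2_diff[OF gL span_sum_L2[OF X G(2), of d]]]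
        F(3) G(3) by linarith
    ultimately show "\<exists>F c. finite F \<and> F \<subseteq> X \<and> L2_norm (\<lambda>x. f x + g x - (\<Sum>g\<in>F. c g * g x)) < \<epsilon>"
      using F G by (intro exI[of _ "F \<union> G"] exI[of _ b]) auto
  qed
next
  fix f and a :: complex assume f: "f \<in> closed_span X"
  then have fL: "f \<in> L2_space" by (auto simp: closed_span_def)
  show "(\<lambda>x. a * f x) \<in> closed_span X"
    unfolding closed_span_def
  proof (intro CollectI conjI allI impI L2_scale fL)
    fix \<epsilon> :: real assume "\<epsilon> > 0"
    then have e: "\<epsilon> / (norm a + 1) > 0" by (simp add: add_nonneg_pos)
    obtain F c where F: "finite F" "F \<subseteq> X" "L2_norm (\<lambda>x. f x - (\<Sum>g\<in>F. c g * g x)) < \<epsilon> / (norm a + 1)"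
      using f e unfolding closed_span_def by blast
    have "(\<lambda>x. a * f x - (\<Sum>g\<in>F. (a * c g) * g x)) = (\<lambda>x. a * (f x - (\<Sum>g\<in>F. c g * g x)))"
      by (auto simp: algebra_simps sum_distrib_left)
    then have "L2_norm (\<lambda>x. a * f x - (\<Sum>g\<in>F. (a * c g) * g x))
        = norm a * L2_norm (\<lambda>x. f x - (\<Sum>g\<in>F. c g * g x))"
      by (simp add: L2_norm_scale)
    also have "\<dots> \<le> (norm a + 1) * L2_norm (\<lambda>x. f x - (\<Sum>g\<in>F. c g * g x))"
      by (rule mult_right_mono) auto
    also have "\<dots> < \<epsilon>" 
      using F(3) by (subst (asm) pos_less_divide_eq) (auto simp: add_nonneg_pos mult.commute)
    finally show "\<exists>F c. finite F \<and> F \<subseteq> X \<and> L2_norm (\<lambda>x. a * f x - (\<Sum>g\<in>F. c g * g x)) < \<epsilon>"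
      using F by (intro exI[of _ F] exI[of _ "\<lambda>g. a * c g"]) auto
  qed
next
  fix f :: "real^'a \<Rightarrow> complex"
  assume fL: "f \<in> L2_space" and ap: "\<forall>\<epsilon>>0. \<exists>g\<in>closed_span X. L2_norm (\<lambda>x. f x - g x) < \<epsilon>"
  show "f \<in> closed_span X"
    unfolding closed_span_def
  proof (intro CollectI conjI allI impI fL)
    fix \<epsilon> :: real assume "\<epsilon> > 0"
    then have e: "\<epsilon> / 2 > 0" by simp
    obtain g where g: "g \<in> closed_span X" "L2_norm (\<lambda>x. f x - g x) < \<epsilon> / 2"
      using ap e by blast
    have gL: "g \<in> L2_space" using g by (auto simp: closed_span_def)
    obtain F c where F: "finite F" "F \<subseteq> X" "L2_norm (\<lambda>x. g x - (\<Sum>g\<in>F. c g * g x)) < \<epsilon> / 2"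
      using g(1) e unfolding closed_span_def by blast
    have "L2_norm (\<lambda>x. f x - (\<Sum>g\<in>F. c g * g x)) < \<epsilon>"
      using L2_norm_triangle_diff[OF fL gL span_sum_L2[OF X F(2), of c]] g(2) F(3) by linarith
    then show "\<exists>F c. finite F \<and> F \<subseteq> X \<and> L2_norm (\<lambda>x. f x - (\<Sum>g\<in>F. c g * g x)) < \<epsilon>"
      using F by blast
  qed
qed

lemma closed_span_minimal:
  assumes W: "closed_subspace W" and X: "X \<subseteq> W" shows "closed_span X \<subseteq> W"
proof
  fix f assume f: "f \<in> closed_span X"
  show "f \<in> W"
  proof (rule closed_subspace_closed[OF W])
    show "f \<in> L2_space" using f by (simp add: closed_span_def)
    fix \<epsilon> :: real assume "\<epsilon> > 0"
    then obtain F c where F: "finite F" "F \<subseteq> X" "L2_norm (\<lambda>x. f x - (\<Sum>g\<in>F. c g * g x)) < \<epsilon>"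
      using f unfolding closed_span_def by blast
    have "(\<lambda>x. \<Sum>g\<in>F. c g * g x) \<in> W"
      using F(2) X by (intro closed_subspace_sum[OF W] closed_subspace_scale[OF W]) auto
    then show "\<exists>g\<in>W. L2_norm (\<lambda>x. f x - g x) < \<epsilon>" by (rule bexI[rotated]) (rule F(3))
  qed
qed

text \<open>
  Compact sets exhaust measurable sets up to null sets, so the hypothesis extends from compact to
  measurable sets; then to simple functions times \<open>w\<close>, and the quotient \<open>g / w\<close> is a limit of
  simple functions. A weight is allowed because the subspaces of interest contain no unweighted
  indicators at first sight: the weight will be a Gaussian, or the indicator of a tile.
\<close>

lemma weighted_density:
  fixes w :: "real^'d \<Rightarrow> complex"
  assumes W: "closed_subspace W" and w: "w \<in> L2_space"
    and K: "\<And>K. compact K \<Longrightarrow> (\<forall>x\<in>K. w x \<noteq> 0) \<Longrightarrow> (\<lambda>x. indicator K x * w x) \<in> W"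
    and g: "g \<in> L2_space" and supp: "AE x in lebesgue. w x = 0 \<longrightarrow> g x = 0"
  shows "g \<in> W"
proof -
  note [measurable] = L2_measurable[OF w] L2_measurable[OF g]
  have ind: "(\<lambda>x. indicator A x * w x) \<in> W" if A[measurable]: "A \<in> sets lebesgue" for A
  proof -
    have "{x \<in> space lebesgue. w x \<noteq> 0} \<in> sets lebesgue" by measurable
    then have S: "A \<inter> {x. w x \<noteq> 0} \<in> sets lebesgue" by (intro sets.Int) auto
    obtain C T where CT: "fsigma C" "T \<in> null_sets lebesgue" "C \<union> T = A \<inter> {x. w x \<noteq> 0}" "disjnt C T"
      using lebesgue_set_almost_fsigma[OF S] by metis
    obtain F :: "nat \<Rightarrow> (real^'d) set" where F: "range F \<subseteq> Collect compact" "C = \<Union>(range F)"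
      using CT(1) fsigma_Union_compact by metis
    define G where "G n = (\<Union>i\<le>n. F i)" for n
    have G: "compact (G n)" "G n \<subseteq> C" for n
      unfolding G_def using F by (auto intro!: compact_UN)
    have Gw: "\<forall>x\<in>G n. w x \<noteq> 0" for n using G(2)[of n] CT(3) by auto
    have "AE x in lebesgue. x \<notin> T" using CT(2) by (rule AE_not_in)
    then have lim: "AE x in lebesgue. (\<lambda>n. indicator (G n) x * w x) \<longlonglongrightarrow> indicator A x * w x"
    proof eventually_elim
      case (elim x)
      show ?case
      proof (cases "x \<in> C")
        case True
        then obtain m where "x \<in> F m" using F(2) by auto
        then have "x \<in> G n" if "n \<ge> m" for n using that by (auto simp: G_def)
        moreover have "x \<in> A" using True CT(3) by auto
        ultimately have "\<forall>\<^sub>F n in sequentially. indicator (G n) x * w x = indicator A x * w x"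
          unfolding eventually_sequentially by (intro exI[of _ m]) (auto simp: indicator_def)
        then show ?thesis by (rule tendsto_eventually)
      next
        case False
        then have "indicator A x * w x = 0"
          using elim CT(3) by (auto simp: indicator_def)
        moreover have "indicator (G n) x * w x = 0" for n
          using False G(2)[of n] by (auto simp: indicator_def)
        ultimately show ?thesis by (simp only:) simp
      qed
    qed
    show ?thesis
    proof (rule closed_subspace_dominated_limit[OF W w K[OF G(1) Gw] _ _ lim, where c=1])
      show "(\<lambda>x. indicator A x * w x) \<in> borel_measurable lebesgue" by measurable
    qed (auto simp: indicator_def)
  qed
  \<comment> \<open>Where \<open>w\<close> vanishes \<open>q\<close> is 0, and so is \<open>g\<close> almost everywhere.\<close>
  define q where "q x = g x / w x" for x
  have [measurable]: "q \<in> borel_measurable lebesgue" unfolding q_def by measurable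
  obtain s where s: "\<And>i. simple_function lebesgue (s i)" "\<And>x. (\<lambda>i. s i x) \<longlonglongrightarrow> q x"
    "\<And>i x. norm (s i x) \<le> 2 * norm (q x)"
    using borel_measurable_implies_sequence_metric[of q lebesgue 0] by auto
  have sW: "(\<lambda>x. s i x * w x) \<in> W" for i
  proof -
    have fin: "finite (range (s i))" using s(1)[of i] by (simp add: simple_function_def)
    have A: "s i -` {y} \<in> sets lebesgue" for y
      using simple_functionD(2)[OF s(1)[of i], of "{y}"] by simp
    have eq: "s i x * w x = (\<Sum>y\<in>range (s i). y * (indicator (s i -` {y}) x * w x))" for x
    proof -
      have "(\<Sum>y\<in>range (s i). y * (indicator (s i -` {y}) x * w x))
          = (\<Sum>y\<in>range (s i). if y = s i x then y * w x else 0)"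
        by (intro sum.cong) (auto simp: indicator_def)
      also have "\<dots> = s i x * w x" using fin by simp
      finally show ?thesis by simp
    qed
    show ?thesis
      unfolding eq by (intro closed_subspace_sum[OF W] closed_subspace_scale[OF W] ind A)
  qed
  show ?thesis
  proof (rule closed_subspace_dominated_limit[OF W g sW, where c=2])
    show "AE x in lebesgue. norm (s n x * w x) \<le> 2 * norm (g x)" for n
    proof (rule AE_I2)
      fix x
      have "norm (s n x * w x) \<le> 2 * norm (q x) * norm (w x)"
        unfolding norm_mult by (rule mult_right_mono[OF s(3)]) simp
      also have "\<dots> \<le> 2 * norm (g x)" by (cases "w x = 0") (auto simp: q_def norm_divide)
      finally show "norm (s n x * w x) \<le> 2 * norm (g x)" .
    qed
    show "AE x in lebesgue. (\<lambda>n. s n x * w x) \<longlonglongrightarrow> g x"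
      using supp
    proof eventually_elim
      case (elim x)
      have "(\<lambda>n. s n x * w x) \<longlonglongrightarrow> q x * w x" by (intro tendsto_intros s(2))
      also have "q x * w x = g x" using elim by (cases "w x = 0") (auto simp: q_def)
      finally show ?case .
    qed
  qed measurable
qed

text \<open>
  The character of the additive group \<open>real^'d\<close> with frequency \<open>a\<close>.
\<close>

definition wave :: "real^'d \<Rightarrow> real^'d \<Rightarrow> complex" where
  "wave a x = exp (2 * pi * \<i> * of_real (a \<bullet> x))"

lemma wave_cis: "wave a x = cis (2 * pi * (a \<bullet> x))"
  by (simp add: wave_def cis_conv_exp mult_ac)

lemma norm_wave [simp]: "norm (wave a x) = 1"
  by (simp add: wave_cis)

lemma wave_add_left: "wave (a + b) x = wave a x * wave b x"
  by (simp add: wave_cis cis_mult inner_add_left algebra_simps)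

lemma wave_add_right: "wave a (x + y) = wave a x * wave a y"
  by (simp add: wave_cis cis_mult inner_add_right algebra_simps)

lemma wave_minus_left: "wave (- a) x = cnj (wave a x)"
  by (simp add: wave_cis cis_cnj)

lemma wave_minus_right: "wave a (- x) = cnj (wave a x)"
  by (simp add: wave_cis cis_cnj)

lemma wave_commute: "wave a x = wave x a"
  by (simp add: wave_def inner_commute)

lemma wave_zero_left [simp]: "wave 0 x = 1"
  by (simp add: wave_def)

lemma wave_times_cnj [simp]: "wave a x * cnj (wave a x) = 1"
  using complex_norm_square[of "wave a x"] by simp

lemma wave_diff_left: "wave (a - b) x = wave a x * cnj (wave b x)"
  using wave_add_left[of a "-b" x] by (simp add: wave_minus_left)

lemma wave_diff_right: "wave a (x - y) = wave a x * cnj (wave a y)"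
  using wave_add_right[of a x "-y"] by (simp add: wave_minus_right)

lemma continuous_on_wave [continuous_intros]: "continuous_on S (wave a)"
  unfolding wave_def by (intro continuous_intros)

lemma borel_measurable_wave [measurable]: "wave a \<in> borel_measurable borel"
  by (intro borel_measurable_continuous_onI continuous_on_wave)

lemma measurable_lebesgue_borel [intro]: "f \<in> borel_measurable borel \<Longrightarrow> f \<in> borel_measurable lebesgue"
  by (rule measurable_completion) (simp add: measurable_lborel1)

lemma borel_measurable_wave_lebesgue [measurable]: "wave a \<in> borel_measurable lebesgue"
  by (rule measurable_lebesgue_borel) measurable

lemma int_lattice_zero [simp]: "0 \<in> int_lattice"
  by (simp add: int_lattice_def)

lemma int_lattice_add: "k \<in> int_lattice \<Longrightarrow> j \<in> int_lattice \<Longrightarrow> k + j \<in> int_lattice"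
  by (simp add: int_lattice_def)

lemma int_lattice_uminus: "k \<in> int_lattice \<Longrightarrow> - k \<in> int_lattice"
  by (simp add: int_lattice_def)

lemma int_lattice_diff: "k \<in> int_lattice \<Longrightarrow> j \<in> int_lattice \<Longrightarrow> k - j \<in> int_lattice"
  by (simp add: int_lattice_def)

lemma int_lattice_axis: "axis i 1 \<in> int_lattice"
  by (simp add: int_lattice_def axis_def)

text \<open>
  The quotient of \<open>real^'d\<close> by the lattice of period \<open>T\<close>, realised as a product of unit circles
  inside \<open>complex^'d\<close>.
\<close>

definition torus_map :: "real \<Rightarrow> real^'d \<Rightarrow> complex^'d" where
  "torus_map T x = (\<chi> i. wave (axis i 1) ((1/T) *\<^sub>R x))"

lemma torus_map_eq_iff:
  assumes "T > 0"
  shows "torus_map T x = torus_map T y \<longleftrightarrow> (\<exists>k\<in>int_lattice. x = y + T *\<^sub>R k)"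
proof
  assume eq: "torus_map T x = torus_map T y"
  have "\<exists>n::int. x $ i / T - y $ i / T = of_int n" for i
  proof -
    have "wave (axis i 1) ((1/T) *\<^sub>R x) = wave (axis i 1) ((1/T) *\<^sub>R y)"
      using eq by (auto simp: torus_map_def vec_eq_iff)
    then obtain n :: int where "2 * pi * \<i> * of_real (x $ i / T)
        = 2 * pi * \<i> * of_real (y $ i / T) + of_int (2 * n) * pi * \<i>"
      unfolding wave_def exp_eq by (auto simp: inner_axis')
    then have "2 * pi * \<i> * of_real (x $ i / T) = 2 * pi * \<i> * of_real (y $ i / T + of_int n)"
      by (simp add: algebra_simps)
    then have "complex_of_real (x $ i / T) = complex_of_real (y $ i / T + of_int n)"
      by (subst (asm) mult_cancel_left) auto
    then have "x $ i / T = y $ i / T + of_int n" unfolding of_real_eq_iff .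
    then show ?thesis by (intro exI[of _ n]) simp
  qed
  then have "(1/T) *\<^sub>R (x - y) \<in> int_lattice"
    by (auto simp: int_lattice_def Ints_def diff_divide_distrib)
  moreover have "x = y + T *\<^sub>R ((1/T) *\<^sub>R (x - y))" using assms by simp
  ultimately show "\<exists>k\<in>int_lattice. x = y + T *\<^sub>R k" by blast
next
  assume "\<exists>k\<in>int_lattice. x = y + T *\<^sub>R k"
  then obtain k where k: "k \<in> int_lattice" "x = y + T *\<^sub>R k" by blast
  have "wave (axis i 1) k = 1" for i
  proof -
    obtain n :: int where "k $ i = of_int n" using k(1) by (auto simp: int_lattice_def Ints_def)
    then show ?thesis by (simp add: wave_cis inner_axis' cis_multiple_2pi[symmetric])
  qed
  then show "torus_map T x = torus_map T y"
    using assms unfolding torus_map_def k(2) by (simp add: scaleR_add_right wave_add_right)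
qed

lemma continuous_on_torus_map: "continuous_on S (torus_map T)"
  unfolding torus_map_def wave_def by (intro continuous_intros)

lemma norm_torus_map: "norm (torus_map T (x :: real^'d)) \<le> CARD('d)"
proof -
  have "norm (torus_map T x) \<le> (\<Sum>i\<in>UNIV. norm (torus_map T x $ i))"
    unfolding norm_vec_def by (rule L2_set_le_sum) simp
  also have "\<dots> = CARD('d)" by (simp add: torus_map_def)
  finally show ?thesis .
qed

text \<open>
  Real and imaginary parts of the coordinates on the torus are combinations of waves with lattice
  frequencies, so real polynomials in them are trigonometric polynomials. The function \<open>v\<close> is
  arbitrary because in the induction step for a product one factor is absorbed into it.
\<close>

lemma polynomial_on_torus:
  fixes p :: "complex^'d \<Rightarrow> real"
  assumes W: "closed_subspace W" and p: "real_polynomial_function p"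
    and v: "\<And>k. k \<in> int_lattice \<Longrightarrow> (\<lambda>x. wave k ((1/T) *\<^sub>R x) * v x) \<in> W"
    and k: "k \<in> int_lattice"
  shows "(\<lambda>x. wave k ((1/T) *\<^sub>R x) * (of_real (p (torus_map T x)) * v x)) \<in> W"
  using p v k
proof (induction p arbitrary: v k rule: real_polynomial_function.induct)
  case (linear f)
  let ?e = "\<lambda>k x. wave k ((1/T) *\<^sub>R x)"
  have "?e k x * (of_real (f (torus_map T x)) * v x)
     = (\<Sum>i\<in>UNIV. (of_real (f (axis i 1)) / 2 + of_real (f (axis i \<i>)) / (2 * \<i>)) * (?e (k + axis i 1) x * v x)
        + (of_real (f (axis i 1)) / 2 - of_real (f (axis i \<i>)) / (2 * \<i>)) * (?e (k - axis i 1) x * v x))" for x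
  proof -
    have "torus_map T x = (\<Sum>i\<in>UNIV. Re (?e (axis i 1) x) *\<^sub>R axis i 1 + Im (?e (axis i 1) x) *\<^sub>R axis i \<i>)"
      by (auto simp: vec_eq_iff torus_map_def axis_def complex_eq_iff if_distrib cong: if_cong)
    then have "f (torus_map T x) = (\<Sum>i\<in>UNIV. Re (?e (axis i 1) x) * f (axis i 1) + Im (?e (axis i 1) x) * f (axis i \<i>))"
      using linear(1) by (simp add: bounded_linear.linear linear_sum linear_add linear_scale)
    then have "?e k x * (of_real (f (torus_map T x)) * v x)
      = (\<Sum>i\<in>UNIV. (of_real (Re (?e (axis i 1) x)) * of_real (f (axis i 1))
          + of_real (Im (?e (axis i 1) x)) * of_real (f (axis i \<i>))) * (?e k x * v x))"
      by (simp add: of_real_sum sum_distrib_left sum_distrib_right mult_ac)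
    also have "\<dots> = (\<Sum>i\<in>UNIV. (of_real (f (axis i 1)) / 2 + of_real (f (axis i \<i>)) / (2 * \<i>)) * (?e (k + axis i 1) x * v x)
        + (of_real (f (axis i 1)) / 2 - of_real (f (axis i \<i>)) / (2 * \<i>)) * (?e (k - axis i 1) x * v x))"
    proof (rule sum.cong[OF refl])
      fix i
      define z where "z = ?e (axis i 1) x"
      have re: "of_real (Re z) = (z + cnj z) / 2" by (simp add: complex_add_cnj)
      have im: "of_real (Im z) = (z - cnj z) / (2 * \<i>)" by (simp add: complex_eq_iff)
      show "(of_real (Re (?e (axis i 1) x)) * of_real (f (axis i 1))
          + of_real (Im (?e (axis i 1) x)) * of_real (f (axis i \<i>))) * (?e k x * v x)
        = (of_real (f (axis i 1)) / 2 + of_real (f (axis i \<i>)) / (2 * \<i>)) * (?e (k + axis i 1) x * v x)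
        + (of_real (f (axis i 1)) / 2 - of_real (f (axis i \<i>)) / (2 * \<i>)) * (?e (k - axis i 1) x * v x)"
        unfolding wave_add_left wave_diff_left z_def[symmetric] re im by (simp add: field_simps)
    qed
    finally show ?thesis .
  qed
  then show ?case
    by (simp only:) (intro closed_subspace_sum[OF W] closed_subspace_add[OF W] closed_subspace_scale[OF W]
      linear int_lattice_add int_lattice_diff int_lattice_axis)
next
  case (const c)
  have "wave k ((1/T) *\<^sub>R x) * (of_real c * v x) = of_real c * (wave k ((1/T) *\<^sub>R x) * v x)" for x
    by (simp add: mult_ac)
  then show ?case by (simp only:) (intro closed_subspace_scale[OF W] const)
next
  case (add f g)
  have "wave k ((1/T) *\<^sub>R x) * (of_real (f (torus_map T x) + g (torus_map T x)) * v x)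
    = wave k ((1/T) *\<^sub>R x) * (of_real (f (torus_map T x)) * v x)
      + wave k ((1/T) *\<^sub>R x) * (of_real (g (torus_map T x)) * v x)" for x
    by (simp add: algebra_simps)
  then show ?case by (simp only:) (intro closed_subspace_add[OF W] add)
next
  case (mult f g)
  have "wave k ((1/T) *\<^sub>R x) * (of_real (f (torus_map T x) * g (torus_map T x)) * v x)
    = wave k ((1/T) *\<^sub>R x) * (of_real (f (torus_map T x)) * (of_real (g (torus_map T x)) * v x))" for x
    by (simp add: mult_ac)
  then show ?case by (simp only:) (intro mult)
qed

text \<open>
  The set of all translates of \<open>K\<close> by the lattice of period \<open>T\<close> is the preimage of a compact
  subset of the torus. Its indicator is a pointwise limit of continuous functions on the torus, and
  each of these is a uniform limit of trigonometric polynomials by the Stone-Weierstrass theorem.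
  This single fact gives both the completeness of exponentials on a tile and, for growing \<open>T\<close>, the
  density needed for Plancherel's theorem.
\<close>

lemma periodized_compact_indicator:
  fixes w :: "real^'d \<Rightarrow> complex"
  assumes W: "closed_subspace W" and w: "w \<in> L2_space" and T: "T > 0"
    and v: "\<And>k. k \<in> int_lattice \<Longrightarrow> (\<lambda>x. wave k ((1/T) *\<^sub>R x) * w x) \<in> W"
    and K: "compact K"
  shows "(\<lambda>x. indicator {x. \<exists>k\<in>int_lattice. x + T *\<^sub>R k \<in> K} x * w x) \<in> W"
proof (cases "K = {}")
  case True
  then show ?thesis using closed_subspace_zero[OF W] by simp
next
  case False
  note [measurable] = L2_measurable[OF w]
  let ?E = "torus_map T" and ?P = "{x. \<exists>k\<in>int_lattice. x + T *\<^sub>R k \<in> K}"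
  have EK: "compact (?E ` K)" by (intro compact_continuous_image continuous_on_torus_map K)
  have P: "?E x \<in> ?E ` K \<longleftrightarrow> x \<in> ?P" for x
  proof -
    have "?E x \<in> ?E ` K \<longleftrightarrow> (\<exists>y\<in>K. ?E y = ?E x)" by (metis image_iff)
    then show ?thesis by (auto simp: torus_map_eq_iff[OF T])
  qed
  \<comment> \<open>Continuous, equal to 1 on the image of \<open>K\<close>, and eventually 0 at any other point.\<close>
  define F where "F n z = max 0 (1 - real n * infdist z (?E ` K))" for n z
  have "\<exists>p. real_polynomial_function p \<and> (\<forall>z\<in>cball 0 (real CARD('d)). \<bar>F n z - p z\<bar> < 1 / Suc n)" for n
  proof -
    have "continuous_on (cball 0 (real CARD('d))) (F n)"
      unfolding F_def by (intro continuous_intros)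
    from Stone_Weierstrass_real_polynomial_function[OF compact_cball this, of "1 / Suc n"]
    show ?thesis by (metis of_nat_0_less_iff zero_less_Suc zero_less_divide_1_iff)
  qed
  then obtain p where p: "\<And>n. real_polynomial_function (p n)"
    "\<And>n z. z \<in> cball 0 (real CARD('d)) \<Longrightarrow> \<bar>F n z - p n z\<bar> < 1 / Suc n" by metis
  have p2: "\<bar>F n (?E x) - p n (?E x)\<bar> < 1 / Suc n" for n x
    using norm_torus_map[of T x] by (intro p(2)) simp
  have lim: "(\<lambda>n. p n (?E x)) \<longlonglongrightarrow> indicator ?P x" for x
  proof -
    have "(\<lambda>n. F n (?E x)) \<longlonglongrightarrow> indicator ?P x"
    proof (cases "x \<in> ?P")
      case True
      then have "infdist (?E x) (?E ` K) = 0" using P[of x] by simp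
      then show ?thesis using True by (simp add: F_def)
    next
      case False
      then have "infdist (?E x) (?E ` K) > 0"
        using P[of x] \<open>K \<noteq> {}\<close> EK by (simp add: infdist_pos_not_in_closed compact_imp_closed)
      then obtain m where m: "1 < real m * infdist (?E x) (?E ` K)" using reals_Archimedean3 by blast
      have "F n (?E x) = 0" if "n \<ge> m" for n
      proof -
        have "real m * infdist (?E x) (?E ` K) \<le> real n * infdist (?E x) (?E ` K)"
          using that by (intro mult_right_mono) (auto simp: infdist_nonneg)
        then show ?thesis using m by (simp add: F_def)
      qed
      then have "\<forall>\<^sub>F n in sequentially. F n (?E x) = 0" by (auto simp: eventually_sequentially)
      then have "(\<lambda>n. F n (?E x)) \<longlonglongrightarrow> 0" by (rule tendsto_eventually)
      then show ?thesis using False by simp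
    qed
    moreover have "(\<lambda>n. F n (?E x) - p n (?E x)) \<longlonglongrightarrow> 0"
    proof (rule Lim_null_comparison)
      show "(\<lambda>n. 1 / real (Suc n)) \<longlonglongrightarrow> 0" by (rule LIMSEQ_Suc[OF lim_1_over_n])
      show "\<forall>\<^sub>F n in sequentially. norm (F n (?E x) - p n (?E x)) \<le> 1 / real (Suc n)"
        using p2[of _ x] by (auto intro!: always_eventually less_imp_le simp del: of_nat_Suc)
    qed
    ultimately have "(\<lambda>n. F n (?E x) - (F n (?E x) - p n (?E x))) \<longlonglongrightarrow> indicator ?P x - 0"
      by (rule tendsto_diff)
    then show ?thesis by simp
  qed
  have bound: "\<bar>p n (?E x)\<bar> \<le> 2" for n x
  proof -
    have "\<bar>F n (?E x)\<bar> \<le> 1" by (auto simp: F_def infdist_nonneg)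
    moreover have "1 / real (Suc n) \<le> 1" by simp
    ultimately show ?thesis using p2[of n x] by linarith
  qed
  have PW: "(\<lambda>x. of_real (p n (?E x)) * w x) \<in> W" for n
    using polynomial_on_torus[OF W p(1)[of n] v int_lattice_zero] by simp
  have lim': "(\<lambda>n. of_real (p n (?E x)) * w x) \<longlonglongrightarrow> indicator ?P x * w x" for x
  proof -
    have "(\<lambda>n. of_real (p n (?E x)) * w x) \<longlonglongrightarrow> of_real (indicator ?P x) * w x"
      by (intro tendsto_intros lim)
    moreover have "complex_of_real (indicator ?P x) = indicator ?P x" by (simp add: indicator_def)
    ultimately show ?thesis by simp
  qed
  show ?thesis
  proof (rule closed_subspace_dominated_limit[OF W w,
      where h="\<lambda>n x. of_real (p n (?E x)) * w x" and c=2])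
    show "(\<lambda>x. indicator ?P x * w x) \<in> borel_measurable lebesgue"
      using L2_measurable[OF closed_subspace_L2[OF W PW]] lim'
      by (rule borel_measurable_LIMSEQ_metric)
    show "AE x in lebesgue. norm (of_real (p n (?E x)) * w x) \<le> 2 * norm (w x)" for n
      using bound by (auto simp: norm_mult intro!: mult_right_mono)
  qed (use lim' PW in auto)
qed

section \<open>Gaussians and their Fourier transforms\<close>

lemma sigma_finite_lebesgue: "sigma_finite_measure (lebesgue :: 'a::euclidean_space measure)"
proof -
  obtain A :: "'a set set" where A: "countable A" "A \<subseteq> sets lborel" "\<Union>A = space lborel" "\<forall>a\<in>A. emeasure lborel a \<noteq> \<infinity>"
    using lborel.sigma_finite_countable by auto
  show ?thesis
    by (rule sigma_finite_measure.intro, rule exI[of _ A]) (use A in auto)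
qed

interpretation lebesgue_pair: pair_sigma_finite "lebesgue :: 'a::euclidean_space measure" "lebesgue :: 'b::euclidean_space measure"
  by (intro pair_sigma_finite.intro sigma_finite_lebesgue)

lemma lebesgue_distr_plus: "distr lebesgue lebesgue (\<lambda>x. c + x) = (lebesgue :: 'a::euclidean_space measure)"
  and measurable_plus_lebesgue: "(\<lambda>x. c + x) \<in> lebesgue \<rightarrow>\<^sub>M (lebesgue :: 'a measure)"
  using lebesgue_affine_euclidean[of "\<lambda>_. 1" c] lebesgue_affine_measurable[of "\<lambda>_. 1" c]
  by (auto simp: euclidean_representation density_1)

lemma lebesgue_distr_uminus: "distr lebesgue lebesgue uminus = (lebesgue :: 'a::euclidean_space measure)"
  and measurable_uminus_lebesgue: "uminus \<in> lebesgue \<rightarrow>\<^sub>M (lebesgue :: 'a measure)"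
  using lebesgue_affine_euclidean[of "\<lambda>_. -1" "0::'a"] lebesgue_affine_measurable[of "\<lambda>_. -1" "0::'a"]
  by (auto simp: euclidean_representation density_1 sum_negf)

lemma borel_measurable_lebesgue_plus:
  "f \<in> borel_measurable lebesgue \<Longrightarrow> (\<lambda>x. f (x + (c::'a::euclidean_space))) \<in> borel_measurable lebesgue"
  using measurable_compose[OF measurable_plus_lebesgue[of c], of f] by (simp add: add.commute)

lemma borel_measurable_lebesgue_uminus:
  "f \<in> borel_measurable lebesgue \<Longrightarrow> (\<lambda>x. f (- (x::'a::euclidean_space))) \<in> borel_measurable lebesgue"
  using measurable_compose[OF measurable_uminus_lebesgue, of f] by simp

lemma lebesgue_integral_translate:
  fixes f :: "'a::euclidean_space \<Rightarrow> 'b::{banach, second_countable_topology}"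
  assumes "f \<in> borel_measurable lebesgue"
  shows "(LINT x|lebesgue. f (x + c)) = (LINT x|lebesgue. f x)"
  using integral_distr[OF measurable_plus_lebesgue[of c] assms, unfolded lebesgue_distr_plus]
  by (simp add: add.commute)

lemma lebesgue_integrable_translate:
  fixes f :: "'a::euclidean_space \<Rightarrow> 'b::{banach, second_countable_topology}"
  assumes "integrable lebesgue f"
  shows "integrable lebesgue (\<lambda>x. f (x + c))"
  using integrable_distr_eq[OF measurable_plus_lebesgue[of c], of f, unfolded lebesgue_distr_plus] assms
  by (simp add: add.commute borel_measurable_integrable)

lemma lebesgue_integral_reflect:
  fixes f :: "'a::euclidean_space \<Rightarrow> 'b::{banach, second_countable_topology}"
  assumes "f \<in> borel_measurable lebesgue"
  shows "(LINT x|lebesgue. f (- x)) = (LINT x|lebesgue. f x)"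
  using integral_distr[OF measurable_uminus_lebesgue assms]
  by (simp add: lebesgue_distr_uminus)

lemma lebesgue_integrable_reflect:
  fixes f :: "'a::euclidean_space \<Rightarrow> 'b::{banach, second_countable_topology}"
  assumes "integrable lebesgue f"
  shows "integrable lebesgue (\<lambda>x. f (- x))"
  using integrable_distr_eq[OF measurable_uminus_lebesgue, of f] assms
  by (simp add: lebesgue_distr_uminus borel_measurable_integrable)

lemma L2_translate:
  assumes "f \<in> L2_space" shows "translate x f \<in> L2_space"
  unfolding translate_def
  using borel_measurable_lebesgue_plus[OF L2_measurable[OF assms], of "-x"]
    lebesgue_integrable_translate[OF L2_integrable[OF assms], of "-x"]
  by (intro L2I) auto

lemma L2_reflect:
  assumes "f \<in> L2_space" shows "(\<lambda>x. f (- x)) \<in> L2_space"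
  using borel_measurable_lebesgue_uminus[OF L2_measurable[OF assms]]
    lebesgue_integrable_reflect[OF L2_integrable[OF assms]]
  by (intro L2I) auto

text \<open>
  Lebesgue measure is the product of the one-dimensional measures, so integrals of products of
  functions of single coordinates factor.
\<close>

lemma lborel_product_integral:
  fixes f :: "'a::euclidean_space \<Rightarrow> real \<Rightarrow> complex"
  assumes f: "\<And>b. b \<in> Basis \<Longrightarrow> integrable lborel (f b)"
  shows "integrable lborel (\<lambda>x. \<Prod>b\<in>Basis. f b (x \<bullet> b))"
    and "(LINT x|lborel. (\<Prod>b\<in>Basis. f b (x \<bullet> b))) = (\<Prod>b\<in>Basis. (LINT t|lborel. f b t))"
proof -
  interpret product_sigma_finite "\<lambda>_::'a. lborel :: real measure" ..
  have [measurable]: "f b \<in> borel_measurable borel" if "b \<in> Basis" for b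
    using borel_measurable_integrable[OF f[OF that]] by simp
  have m: "(\<lambda>x. \<Prod>b\<in>Basis. f b (x \<bullet> b)) \<in> borel_measurable borel" by measurable
  have T: "(\<lambda>g. \<Sum>b\<in>Basis. g b *\<^sub>R b) \<in> (\<Pi>\<^sub>M b\<in>(Basis::'a set). (lborel :: real measure)) \<rightarrow>\<^sub>M borel"
    by measurable
  have eq: "(\<Prod>b\<in>Basis. f b ((\<Sum>b\<in>Basis. g b *\<^sub>R b) \<bullet> b)) = (\<Prod>b\<in>Basis. f b (g b))" for g
    by (intro prod.cong) auto
  show "integrable lborel (\<lambda>x. \<Prod>b\<in>Basis. f b (x \<bullet> b))"
    using product_integrable_prod[OF finite_Basis f] integrable_distr_eq[OF T m] m
    by (subst lborel_eq) (simp add: eq)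
  have "(LINT x|lborel. (\<Prod>b\<in>Basis. f b (x \<bullet> b)))
      = (LINT g|(\<Pi>\<^sub>M b\<in>(Basis::'a set). (lborel :: real measure)). (\<Prod>b\<in>Basis. f b (g b)))"
    using integral_distr[OF T m] by (subst lborel_eq) (simp add: eq)
  then show "(LINT x|lborel. (\<Prod>b\<in>Basis. f b (x \<bullet> b))) = (\<Prod>b\<in>Basis. (LINT t|lborel. f b t))"
    using product_integral_prod[OF finite_Basis f] by simp
qed

text \<open>
  The characteristic function of the standard normal distribution, after the substitution
  \<open>x \<mapsto> sqrt (2 * pi) * x\<close> that turns the normal density into the Gaussian fixed by the transform.
\<close>

lemma fourier_gaussian_1D:
  fixes t :: real
  shows "integrable lborel (\<lambda>x. cis (- (2 * pi * t * x)) * of_real (exp (- pi * x\<^sup>2)))"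
    and "(LINT x|lborel. cis (- (2 * pi * t * x)) * of_real (exp (- pi * x\<^sup>2))) = of_real (exp (- pi * t\<^sup>2))"
proof -
  let ?c = "sqrt (2 * pi)"
  have c0: "?c \<noteq> 0" by simp
  define s where "s = - ?c * t"
  have int: "integrable lborel (\<lambda>x. std_normal_density x *\<^sub>R iexp (s * x))"
  proof (rule Bochner_Integration.integrable_bound[OF integrable_normal_density[of 1 0]])
    show "(\<lambda>x. std_normal_density x *\<^sub>R iexp (s * x)) \<in> borel_measurable lborel" by measurable
  qed (auto simp: norm_mult)
  have eq: "?c *\<^sub>R (std_normal_density (0 + ?c * x) *\<^sub>R iexp (s * (0 + ?c * x)))
      = cis (- (2 * pi * t * x)) * of_real (exp (- pi * x\<^sup>2))" for x
  proof -
    have "s * (?c * x) = - (?c * ?c) * t * x" unfolding s_def by (simp only: mult_ac mult_minus_left mult_minus_right)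
    then have "s * (?c * x) = - (2 * pi * t * x)" by simp
    moreover have "?c * std_normal_density (?c * x) = exp (- pi * x\<^sup>2)"
      by (simp add: std_normal_density_def power_mult_distrib)
    ultimately show ?thesis
      by (simp add: cis_conv_exp scaleR_conv_of_real mult_ac flip: of_real_mult)
  qed
  have "integrable lborel (\<lambda>x. std_normal_density (0 + ?c * x) *\<^sub>R iexp (s * (0 + ?c * x)))"
    by (rule lborel_integrable_real_affine[OF int c0])
  then have "integrable lborel (\<lambda>x. ?c *\<^sub>R (std_normal_density (0 + ?c * x) *\<^sub>R iexp (s * (0 + ?c * x))))"
    by (rule integrable_scaleR_right)
  then show "integrable lborel (\<lambda>x. cis (- (2 * pi * t * x)) * of_real (exp (- pi * x\<^sup>2)))"
    unfolding eq .
  have "of_real (exp (- pi * t\<^sup>2)) = char std_normal_distribution s"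
    by (simp add: char_std_normal_distribution s_def power_mult_distrib)
  also have "\<dots> = (LINT x|lborel. std_normal_density x *\<^sub>R iexp (s * x))"
    unfolding char_def by (subst integral_density) auto
  also have "\<dots> = \<bar>?c\<bar> *\<^sub>R (LINT x|lborel. std_normal_density (0 + ?c * x) *\<^sub>R iexp (s * (0 + ?c * x)))"
    by (rule lborel_integral_real_affine[OF c0])
  also have "\<dots> = (LINT x|lborel. ?c *\<^sub>R (std_normal_density (0 + ?c * x) *\<^sub>R iexp (s * (0 + ?c * x))))"
    by (subst integral_scaleR_right) simp
  finally show "(LINT x|lborel. cis (- (2 * pi * t * x)) * of_real (exp (- pi * x\<^sup>2))) = of_real (exp (- pi * t\<^sup>2))"
    unfolding eq by simp
qed

text \<open>
  The Gaussian shifted by \<open>b\<close> in time and by \<open>a\<close> in frequency.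
\<close>

definition gabor :: "real^'d \<Rightarrow> real^'d \<Rightarrow> real^'d \<Rightarrow> complex" where
  "gabor a b x = wave a x * of_real (exp (- pi * (norm (x - b))\<^sup>2))"

lemma borel_measurable_gabor [measurable]: "gabor a b \<in> borel_measurable borel"
  unfolding gabor_def[abs_def] by measurable

lemma borel_measurable_gabor_lebesgue [measurable]: "gabor a b \<in> borel_measurable lebesgue"
  by (rule measurable_lebesgue_borel) measurable

lemma fourier_wave: "fourier f \<omega> = (LINT x|lebesgue. wave (- \<omega>) x * f x)"
  unfolding fourier_def wave_def by (simp add: inner_minus_left)

lemma gaussian_integral:
  fixes \<omega> :: "real^'d"
  shows "integrable lebesgue (gabor (- \<omega>) 0)"
    and "(LINT x|lebesgue. gabor (- \<omega>) 0 x) = of_real (exp (- pi * (norm \<omega>)\<^sup>2))"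
proof -
  let ?f = "\<lambda>b t. cis (- (2 * pi * (\<omega> \<bullet> b) * t)) * of_real (exp (- pi * t\<^sup>2))"
  have nsq: "(norm y)\<^sup>2 = (\<Sum>b\<in>Basis. (y \<bullet> b)\<^sup>2)" for y :: "real^'d"
    unfolding power2_norm_eq_inner by (subst euclidean_inner) (simp add: power2_eq_square)
  have eq: "gabor (- \<omega>) 0 x = (\<Prod>b\<in>Basis. ?f b (x \<bullet> b))" for x
  proof -
    have "wave (- \<omega>) x = exp (\<Sum>b\<in>Basis. \<i> * of_real (- (2 * pi * (\<omega> \<bullet> b) * (x \<bullet> b))))"
      unfolding wave_def inner_minus_left
      by (subst euclidean_inner) (simp add: sum_distrib_left sum_negf mult_ac)
    also have "\<dots> = (\<Prod>b\<in>Basis. cis (- (2 * pi * (\<omega> \<bullet> b) * (x \<bullet> b))))"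
      by (simp only: exp_sum[OF finite_Basis] cis_conv_exp)
    finally have 1: "wave (- \<omega>) x = \<dots>" .
    have "exp (- pi * (norm x)\<^sup>2) = (\<Prod>b\<in>Basis. exp (- pi * (x \<bullet> b)\<^sup>2))"
      unfolding nsq sum_distrib_left by (rule exp_sum[OF finite_Basis])
    then show ?thesis unfolding gabor_def 1 by (simp add: prod.distrib)
  qed
  note P = lborel_product_integral[of ?f, OF fourier_gaussian_1D(1)]
  show "integrable lebesgue (gabor (- \<omega>) 0)"
    using P(1) unfolding eq[symmetric] by (simp add: integrable_completion)
  have "(LINT x|lebesgue. gabor (- \<omega>) 0 x) = (LINT x|lborel. gabor (- \<omega>) 0 x)"
    by (rule integral_completion) simp
  also have "\<dots> = (\<Prod>b\<in>Basis. of_real (exp (- pi * (\<omega> \<bullet> b)\<^sup>2)))"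
    unfolding eq P(2) fourier_gaussian_1D(2) ..
  also have "\<dots> = of_real (exp (- pi * (norm \<omega>)\<^sup>2))"
    unfolding nsq sum_distrib_left exp_sum[OF finite_Basis] by simp
  finally show "(LINT x|lebesgue. gabor (- \<omega>) 0 x) = of_real (exp (- pi * (norm \<omega>)\<^sup>2))" .
qed

lemma gabor_translate: "gabor a b (x + y) = wave a y * gabor a (b - y) x"
  by (simp add: gabor_def wave_add_right algebra_simps)

lemma gabor_wave: "wave c x * gabor a b x = gabor (c + a) b x"
  by (simp add: gabor_def wave_add_left)

lemma integrable_gabor: "integrable lebesgue (gabor a b)"
proof -
  have "integrable lebesgue (\<lambda>x. wave a b * gabor a 0 (x + - b))"
    using gaussian_integral(1)[of "-a"] by (intro integrable_mult_right lebesgue_integrable_translate) simp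
  moreover have "wave a b * gabor a 0 (x + - b) = gabor a b x" for x
    unfolding gabor_translate wave_minus_right by (simp add: mult.assoc[symmetric])
  ultimately show ?thesis by simp
qed

lemma L2_gabor: "gabor a b \<in> L2_space"
proof (rule L2I)
  show "integrable lebesgue (\<lambda>x. (norm (gabor a b x))\<^sup>2)"
  proof (rule Bochner_Integration.integrable_bound[OF integrable_gabor[of a b]])
    have "(norm (gabor a b x))\<^sup>2 \<le> norm (gabor a b x)" for x
      by (rule power_le_one_iff[THEN iffD1] | simp add: power2_eq_square gabor_def norm_mult mult_left_le_one_le)+
    then show "AE x in lebesgue. norm ((norm (gabor a b x))\<^sup>2) \<le> norm (gabor a b x)" by simp
  qed measurable
qed measurable

text \<open>
  Up to a constant of modulus 1 the transform rotates the pair (frequency, time) by a right angle,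
  so the family of these Gaussians is mapped to itself.
\<close>

lemma fourier_gabor: "fourier (gabor a b) \<omega> = wave a b * gabor (- b) a \<omega>"
proof -
  have "fourier (gabor a b) \<omega> = (LINT x|lebesgue. gabor (a - \<omega>) b x)"
    unfolding fourier_wave gabor_wave by simp
  also have "\<dots> = (LINT x|lebesgue. gabor (a - \<omega>) b (x + b))"
    by (rule lebesgue_integral_translate[symmetric]) measurable
  also have "\<dots> = wave (a - \<omega>) b * (LINT x|lebesgue. gabor (- (\<omega> - a)) 0 x)"
    unfolding gabor_translate by simp
  also have "\<dots> = wave a b * gabor (- b) a \<omega>"
    unfolding gaussian_integral(2)
    unfolding wave_diff_left gabor_def wave_minus_left
    by (simp add: wave_commute)
  finally show ?thesis .
qed

text \<open>
  Fubini's theorem for the integrand \<open>h x * g y\<close> times a kernel that is symmetric in \<open>x\<close> and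
  \<open>y\<close>.
\<close>

lemma fourier_multiplication_formula:
  fixes h g :: "real^'d \<Rightarrow> complex"
  assumes h: "integrable lebesgue h" and g: "integrable lebesgue g"
  shows "(LINT \<omega>|lebesgue. fourier h \<omega> * g \<omega>) = (LINT x|lebesgue. h x * fourier g x)"
proof -
  note [measurable] = borel_measurable_integrable[OF h] borel_measurable_integrable[OF g]
  have id: "(\<lambda>x. x) \<in> lebesgue \<rightarrow>\<^sub>M (borel :: (real^'d) measure)"
    by (rule measurable_lebesgue_borel) simp
  have ip: "(\<lambda>p. fst p \<bullet> snd p) \<in> borel_measurable (lebesgue \<Otimes>\<^sub>M (lebesgue :: (real^'d) measure))"
    by (intro borel_measurable_inner measurable_compose[OF measurable_fst id] measurable_compose[OF measurable_snd id])
  have w: "(\<lambda>p. wave (fst p) (snd p)) \<in> borel_measurable (lebesgue \<Otimes>\<^sub>M (lebesgue :: (real^'d) measure))"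
    unfolding wave_def using ip by measurable
  have "integrable (lebesgue \<Otimes>\<^sub>M lebesgue) (\<lambda>p. cnj (wave (fst p) (snd p)) * (h (fst p) * g (snd p)))"
  proof (rule lebesgue_pair.Fubini_integrable)
    show "(\<lambda>p. cnj (wave (fst p) (snd p)) * (h (fst p) * g (snd p))) \<in> borel_measurable (lebesgue \<Otimes>\<^sub>M lebesgue)"
      using w by measurable
    show "integrable lebesgue (\<lambda>x. LINT y|lebesgue. norm (cnj (wave (fst (x, y)) (snd (x, y))) * (h (fst (x, y)) * g (snd (x, y)))))"
      using integrable_norm[OF h] by (simp add: norm_mult)
    have "integrable lebesgue (\<lambda>y. cnj (wave x y) * (h x * g y))" for x
    proof (rule Bochner_Integration.integrable_bound[OF integrable_mult_right[OF g, of "h x"]])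
      show "(\<lambda>y. cnj (wave x y) * (h x * g y)) \<in> borel_measurable lebesgue" by measurable
    qed (simp add: norm_mult)
    then show "AE x in lebesgue. integrable lebesgue (\<lambda>y. cnj (wave (fst (x, y)) (snd (x, y))) * (h (fst (x, y)) * g (snd (x, y))))"
      by simp
  qed
  then have "integrable (lebesgue \<Otimes>\<^sub>M lebesgue) (\<lambda>(x, y). cnj (wave x y) * (h x * g y))"
    by (simp add: case_prod_beta')
  from lebesgue_pair.Fubini_integral[OF this]
  have "(LINT y|lebesgue. LINT x|lebesgue. cnj (wave x y) * (h x * g y))
      = (LINT x|lebesgue. LINT y|lebesgue. cnj (wave x y) * (h x * g y))" .
  moreover have "(LINT x|lebesgue. cnj (wave x y) * (h x * g y)) = fourier h y * g y" for y
    unfolding fourier_wave wave_minus_left wave_commute[of y]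
    by (subst integral_mult_left_zero[symmetric]) (simp add: mult_ac)
  moreover have "(LINT y|lebesgue. cnj (wave x y) * (h x * g y)) = h x * fourier g x" for x
    unfolding fourier_wave wave_minus_left
    by (subst integral_mult_right_zero[symmetric]) (simp add: mult_ac)
  ultimately show ?thesis by simp
qed

lemma cnj_gabor: "cnj (gabor a b x) = gabor (- a) b x"
  by (simp add: gabor_def wave_minus_left)

text \<open>
  Parseval's identity for \<open>h\<close> and a Gaussian. The multiplication formula moves the transform from
  \<open>h\<close> to the conjugate of the Gaussian on the left, and the transform of that conjugate is, up to a
  phase, the conjugate of the Gaussian on the right.
\<close>

lemma fourier_gabor_parseval:
  assumes h: "integrable lebesgue h"
  shows "L2_inner (fourier h) (gabor (- b) a) = wave a b * L2_inner h (gabor a b)"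
proof -
  have "L2_inner (fourier h) (gabor (- b) a) = (LINT \<omega>|lebesgue. fourier h \<omega> * gabor b a \<omega>)"
    unfolding L2_inner_def cnj_gabor by simp
  also have "\<dots> = (LINT x|lebesgue. h x * (wave b a * gabor (- a) b x))"
    unfolding fourier_multiplication_formula[OF h integrable_gabor] fourier_gabor ..
  also have "\<dots> = wave a b * (LINT x|lebesgue. h x * gabor (- a) b x)"
    unfolding wave_commute[of b] by (subst integral_mult_right_zero[symmetric]) (simp add: mult_ac)
  finally show ?thesis unfolding L2_inner_def cnj_gabor .
qed

text \<open>
  With a Gaussian weight, the multiples by waves of frequencies \<open>k / T\<close> yield the indicator of
  the translates of a compact set by the lattice of period \<open>T\<close>. As \<open>T\<close> grows all translates except
  the set itself move off to infinity.
\<close>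

lemma gabor_total:
  assumes W: "closed_subspace W" and g: "\<And>a. gabor a 0 \<in> W" and f: "f \<in> L2_space"
  shows "f \<in> W"
proof (rule weighted_density[OF W L2_gabor[of 0 0] _ f])
  show "AE x in lebesgue. gabor 0 0 x = 0 \<longrightarrow> f x = 0" by (simp add: gabor_def)
  fix K :: "(real^'a) set"
  assume K: "compact K"
  then obtain R where R: "\<And>y. y \<in> K \<Longrightarrow> norm y \<le> R"
    using compact_imp_bounded bounded_iff by metis
  let ?P = "\<lambda>n. {x. \<exists>k\<in>int_lattice. x + real (Suc n) *\<^sub>R k \<in> K}"
  have lim: "(\<lambda>n. indicator (?P n) x * gabor 0 0 x) \<longlonglongrightarrow> indicator K x * gabor 0 0 x" for x
  proof -
    obtain m where m: "R + norm x < real m" using reals_Archimedean2 by blast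
    have "x \<in> ?P n \<longleftrightarrow> x \<in> K" if "n \<ge> m" for n
    proof
      assume "x \<in> ?P n"
      then obtain k where k: "k \<in> int_lattice" "x + real (Suc n) *\<^sub>R k \<in> K" by blast
      \<comment> \<open>A nonzero lattice vector has norm at least 1, so it would move \<open>x\<close> out of the ball of
        radius \<open>R\<close>.\<close>
      have "k = 0"
      proof (rule ccontr)
        assume "k \<noteq> 0"
        then obtain i where "k $ i \<noteq> 0" by (auto simp: vec_eq_iff)
        then have "1 \<le> \<bar>k $ i\<bar>" using k(1) Ints_nonzero_abs_ge1 by (auto simp: int_lattice_def)
        also have "\<dots> \<le> norm k" by (rule component_le_norm_cart)
        finally have "1 \<le> norm k" .
        then have "real (Suc n) * 1 \<le> real (Suc n) * norm k" by (rule mult_left_mono) simp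
        also have "\<dots> = norm ((x + real (Suc n) *\<^sub>R k) - x)" by simp
        also have "\<dots> \<le> norm (x + real (Suc n) *\<^sub>R k) + norm x" by (rule norm_triangle_ineq4)
        also have "\<dots> \<le> R + norm x" using R[OF k(2)] by simp
        finally show False using m that by simp
      qed
      then show "x \<in> K" using k by simp
    next
      assume "x \<in> K"
      then show "x \<in> ?P n" by (auto intro!: bexI[of _ 0])
    qed
    then have "\<forall>\<^sub>F n in sequentially. indicator (?P n) x * gabor 0 0 x = indicator K x * gabor 0 0 x"
      unfolding eventually_sequentially by (intro exI[of _ m]) (simp add: indicator_def)
    then show ?thesis by (rule tendsto_eventually)
  qed
  have PW: "(\<lambda>x. indicator (?P n) x * gabor 0 0 x) \<in> W" for n
  proof (rule periodized_compact_indicator[OF W L2_gabor _ _ K])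
    fix k :: "real^'a"
    have "wave k ((1 / real (Suc n)) *\<^sub>R x) * gabor 0 0 x = gabor ((1 / real (Suc n)) *\<^sub>R k) 0 x" for x
      by (simp add: gabor_def wave_def)
    then show "(\<lambda>x. wave k ((1 / real (Suc n)) *\<^sub>R x) * gabor 0 0 x) \<in> W" using g by simp
  qed simp
  show "(\<lambda>x. indicator K x * gabor 0 0 x) \<in> W"
  proof (rule closed_subspace_dominated_limit[OF W L2_gabor[of 0 0],
        where h="\<lambda>n x. indicator (?P n) x * gabor 0 0 x" and c=1])
    have [measurable]: "K \<in> sets borel" using K by (simp add: borel_closed compact_imp_closed)
    show "(\<lambda>x. indicator K x * gabor 0 0 x) \<in> borel_measurable lebesgue"
      by (rule measurable_lebesgue_borel) measurable
    show "\<And>n. (\<lambda>x. indicator (?P n) x * gabor 0 0 x) \<in> W" by (rule PW)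
    show "AE x in lebesgue. (\<lambda>n. indicator (?P n) x * gabor 0 0 x) \<longlonglongrightarrow> indicator K x * gabor 0 0 x"
      using lim by simp
  qed (simp add: norm_mult indicator_def)
qed

section \<open>Plancherel's theorem\<close>

lemma closed_subspace_orthogonal:
  assumes u: "u \<in> L2_space"
  shows "closed_subspace {v \<in> L2_space. L2_inner u v = 0}"
  unfolding closed_subspace_def
proof (intro conjI ballI allI impI)
  fix f :: "real^'a \<Rightarrow> complex"
  assume fL: "f \<in> L2_space"
    and ap: "\<forall>\<epsilon>>0. \<exists>g\<in>{v \<in> L2_space. L2_inner u v = 0}. L2_norm (\<lambda>x. f x - g x) < \<epsilon>"
  have "norm (L2_inner u f) \<le> 0 + e" if "e > 0" for e
  proof -
    have e': "e / (L2_norm u + 1) > 0" using that by (simp add: add_nonneg_pos)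
    obtain g where g: "g \<in> L2_space" "L2_inner u g = 0" "L2_norm (\<lambda>x. f x - g x) < e / (L2_norm u + 1)"
      using ap e' by blast
    have "L2_inner u f = L2_inner u (\<lambda>x. f x - g x)"
      using g by (simp add: L2_inner_diff_right fL u)
    then have "norm (L2_inner u f) \<le> L2_norm u * L2_norm (\<lambda>x. f x - g x)"
      using L2_Cauchy_Schwarz[OF u L2_diff[OF fL g(1)]] by simp
    also have "\<dots> \<le> (L2_norm u + 1) * (e / (L2_norm u + 1))"
      using g(3) e' by (intro mult_mono) auto
    also have "\<dots> = e" using L2_norm_nonneg[of u] by (simp add: add_nonneg_eq_0_iff)
    finally show ?thesis by simp
  qed
  then have "norm (L2_inner u f) \<le> 0" by (rule field_le_epsilon)
  then show "f \<in> {v \<in> L2_space. L2_inner u v = 0}" using fL by simp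
next
  show "(\<lambda>x. 0) \<in> {v \<in> L2_space. L2_inner u v = 0}"
    using L2_inner_scale_right[of u 0 u] by (simp add: L2_zero)
qed (auto simp: L2_inner_add_right L2_inner_scale_right L2_add L2_scale u)

text \<open>
  The orthogonal complement of such a function is a closed subspace that contains the modulated
  Gaussians, hence the function itself.
\<close>

lemma orthogonal_to_gabor_imp_AE_zero:
  assumes u: "u \<in> L2_space" and orth: "\<And>a. L2_inner u (gabor a 0) = 0"
  shows "AE x in lebesgue. u x = 0"
proof -
  have "u \<in> {v \<in> L2_space. L2_inner u v = 0}"
    by (rule gabor_total[OF closed_subspace_orthogonal[OF u] _ u]) (simp add: L2_gabor orth)
  then have "L2_norm u = 0" using L2_inner_self[of u] by simp
  then show ?thesis using L2_norm_eq_0[OF u] by simp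
qed

text \<open>
  Parseval's identity against all Gaussians. The condition is linear in the pair and stable under
  limits, and by density of the Gaussians each of the two functions determines the other; it is shown
  below to characterise the Fourier transform on \<open>L\<^sup>2\<close>.
\<close>

definition fourier_pair :: "(real^'d \<Rightarrow> complex) \<Rightarrow> (real^'d \<Rightarrow> complex) \<Rightarrow> bool" where
  "fourier_pair f g \<longleftrightarrow> f \<in> L2_space \<and> g \<in> L2_space \<and>
    (\<forall>a b. L2_inner g (gabor (- b) a) = wave a b * L2_inner f (gabor a b))"

lemma fourier_pairD:
  assumes "fourier_pair f g"
  shows "f \<in> L2_space" "g \<in> L2_space" "L2_inner g (gabor (- b) a) = wave a b * L2_inner f (gabor a b)"
  using assms by (auto simp: fourier_pair_def)

lemma is_fourier_L2_imp_pair: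
  assumes "is_fourier_L2 f g" shows "fourier_pair f g"
proof -
  from assms obtain h where f: "f \<in> L2_space" and g: "g \<in> L2_space"
    and h: "\<And>n. integrable lebesgue (h n)" "\<And>n. h n \<in> L2_space" "\<And>n. fourier (h n) \<in> L2_space"
    and lim: "(\<lambda>n. L2_norm (\<lambda>x. h n x - f x)) \<longlonglongrightarrow> 0" "(\<lambda>n. L2_norm (\<lambda>\<omega>. fourier (h n) \<omega> - g \<omega>)) \<longlonglongrightarrow> 0"
    unfolding is_fourier_L2_def by blast
  have "L2_inner g (gabor (- b) a) = wave a b * L2_inner f (gabor a b)" for a b
  proof (rule LIMSEQ_unique)
    show "(\<lambda>n. L2_inner (fourier (h n)) (gabor (- b) a)) \<longlonglongrightarrow> L2_inner g (gabor (- b) a)"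
      by (rule L2_inner_tendsto[OF h(3) g lim(2) L2_gabor])
    show "(\<lambda>n. L2_inner (fourier (h n)) (gabor (- b) a)) \<longlonglongrightarrow> wave a b * L2_inner f (gabor a b)"
      unfolding fourier_gabor_parseval[OF h(1)]
      by (intro tendsto_mult_left L2_inner_tendsto[OF h(2) f lim(1) L2_gabor])
  qed
  then show ?thesis using f g by (simp add: fourier_pair_def)
qed

lemma fourier_pair_diff:
  assumes 1: "fourier_pair f g" and 2: "fourier_pair f' g'"
  shows "fourier_pair (\<lambda>x. f x - f' x) (\<lambda>x. g x - g' x)"
  unfolding fourier_pair_def
  using fourier_pairD[OF 1] fourier_pairD[OF 2]
  by (simp add: L2_diff L2_inner_diff_left L2_gabor algebra_simps)

lemma fourier_pair_add:
  assumes 1: "fourier_pair f g" and 2: "fourier_pair f' g'"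
  shows "fourier_pair (\<lambda>x. f x + f' x) (\<lambda>x. g x + g' x)"
  unfolding fourier_pair_def
  using fourier_pairD[OF 1] fourier_pairD[OF 2]
  by (simp add: L2_add L2_inner_add_left L2_gabor algebra_simps)

lemma fourier_pair_scale:
  assumes "fourier_pair f g" shows "fourier_pair (\<lambda>x. c * f x) (\<lambda>x. c * g x)"
  unfolding fourier_pair_def
  using fourier_pairD[OF assms] by (simp add: L2_scale L2_inner_scale_left)

lemma fourier_pair_zero: "fourier_pair (\<lambda>x. 0) (\<lambda>x. 0)"
  by (simp add: fourier_pair_def L2_zero L2_inner_def)

lemma fourier_pair_sum:
  "(\<And>i. i \<in> I \<Longrightarrow> fourier_pair (f i) (g i)) \<Longrightarrow> fourier_pair (\<lambda>x. \<Sum>i\<in>I. f i x) (\<lambda>x. \<Sum>i\<in>I. g i x)"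
  by (induction I rule: infinite_finite_induct) (auto intro: fourier_pair_zero fourier_pair_add)

lemma fourier_pair_zero_right:
  assumes "fourier_pair (\<lambda>x. 0) g" shows "AE x in lebesgue. g x = 0"
proof (rule orthogonal_to_gabor_imp_AE_zero)
  show "g \<in> L2_space" using fourier_pairD[OF assms] by simp
  show "L2_inner g (gabor a 0) = 0" for a
    using fourier_pairD(3)[OF assms, of "-a" 0] L2_inner_scale_left[of 0 g] by (simp add: L2_inner_def)
qed

lemma fourier_pair_unique:
  assumes "fourier_pair f g" "fourier_pair f g'" shows "AE x in lebesgue. g x = g' x"
  using fourier_pair_zero_right[of "\<lambda>x. g x - g' x"] fourier_pair_diff[OF assms] by simp

lemma integrable_wave_mult:
  assumes u: "integrable lebesgue u"
  shows "integrable lebesgue (\<lambda>x. wave a x * u x)"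
proof (rule Bochner_Integration.integrable_bound[OF u])
  show "(\<lambda>x. wave a x * u x) \<in> borel_measurable lebesgue"
    using borel_measurable_integrable[OF u] by measurable
qed (simp add: norm_mult)

text \<open>
  Parseval's identity passes from Gaussians to their linear combinations.
\<close>

lemma gabor_span_transform:
  fixes c :: "(real^'d \<Rightarrow> complex) \<Rightarrow> complex"
  assumes "F \<subseteq> range (\<lambda>(a, b). gabor a b)"
  defines "h \<equiv> (\<lambda>x. \<Sum>u\<in>F. c u * u x)"
  shows "integrable lebesgue h" "h \<in> L2_space" "fourier h \<in> L2_space"
    and "g \<in> L2_space \<Longrightarrow> integrable lebesgue g \<Longrightarrow> fourier g \<in> L2_space \<Longrightarrow>
      L2_inner (fourier g) (fourier h) = L2_inner g h"
proof -
  have u: "integrable lebesgue u \<and> u \<in> L2_space \<and> fourier u \<in> L2_space \<and>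
      (\<forall>g. integrable lebesgue g \<longrightarrow> L2_inner (fourier g) (fourier u) = L2_inner g u)" if uF: "u \<in> F" for u
  proof -
    obtain a b where ab: "u = gabor a b" using subsetD[OF assms(1) uF] by auto
    have fu: "fourier (gabor a b) = (\<lambda>\<omega>. wave a b * gabor (- b) a \<omega>)" by (rule ext) (rule fourier_gabor)
    have "cnj (wave a b) * (wave a b * z) = z" for z
      using wave_times_cnj[of a b] by (simp add: mult.assoc[symmetric] mult.commute[of "cnj _"])
    then show ?thesis
      unfolding ab fu by (simp add: integrable_gabor L2_gabor L2_scale L2_inner_scale_right fourier_gabor_parseval)
  qed
  show hi: "integrable lebesgue h" unfolding h_def using u by (intro Bochner_Integration.integrable_sum integrable_mult_right) auto
  show "h \<in> L2_space" unfolding h_def using u by (intro L2_sum L2_scale) auto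
  have wi: "integrable lebesgue (\<lambda>x. wave (- \<omega>) x * u x)" if "u \<in> F" for u \<omega>
    using u[OF that] by (intro integrable_wave_mult) simp
  have fh: "fourier h = (\<lambda>\<omega>. \<Sum>u\<in>F. c u * fourier u \<omega>)"
  proof
    fix \<omega>
    have "fourier h \<omega> = (LINT x|lebesgue. (\<Sum>u\<in>F. c u * (wave (- \<omega>) x * u x)))"
      unfolding fourier_wave h_def by (simp add: sum_distrib_left mult_ac)
    also have "\<dots> = (\<Sum>u\<in>F. c u * fourier u \<omega>)"
      unfolding fourier_wave using wi by (subst Bochner_Integration.integral_sum) auto
    finally show "fourier h \<omega> = (\<Sum>u\<in>F. c u * fourier u \<omega>)" .
  qed
  show "fourier h \<in> L2_space" unfolding fh using u by (intro L2_sum L2_scale) auto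
  assume g: "g \<in> L2_space" "integrable lebesgue g" "fourier g \<in> L2_space"
  have "L2_inner (fourier g) (fourier h) = (\<Sum>u\<in>F. cnj (c u) * L2_inner (fourier g) (fourier u))"
    unfolding fh by (rule L2_inner_sum_right[OF g(3)]) (use u in auto)
  also have "\<dots> = (\<Sum>u\<in>F. cnj (c u) * L2_inner g u)"
    using u g(2) by (intro sum.cong) auto
  also have "\<dots> = L2_inner g h"
    unfolding h_def using L2_inner_sum_right[OF g(1), of F "\<lambda>u. u"] u by simp
  finally show "L2_inner (fourier g) (fourier h) = L2_inner g h" .
qed

lemma fourier_diff:
  fixes f g :: "real^'d \<Rightarrow> complex"
  assumes f: "integrable lebesgue f" and g: "integrable lebesgue g"
  shows "fourier (\<lambda>x. f x - g x) = (\<lambda>\<omega>. fourier f \<omega> - fourier g \<omega>)"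
proof
  fix \<omega> :: "real^'d"
  show "fourier (\<lambda>x. f x - g x) \<omega> = fourier f \<omega> - fourier g \<omega>"
    unfolding fourier_wave Bochner_Integration.integral_diff[OF integrable_wave_mult[OF f] integrable_wave_mult[OF g], symmetric]
    by (simp add: algebra_simps)
qed

text \<open>
  A function is the limit of combinations of Gaussians; the transform is isometric on these, so their
  transforms form a Cauchy sequence, whose limit has the right norm.
\<close>

lemma fourier_L2_exists:
  assumes f: "f \<in> L2_space"
  shows "\<exists>g. is_fourier_L2 f g \<and> L2_norm g = L2_norm f"
proof -
  let ?X = "range (\<lambda>(a, b). gabor a b) :: (real^'a \<Rightarrow> complex) set"
  have X: "?X \<subseteq> L2_space" using L2_gabor by auto
  have "f \<in> closed_span ?X"
    by (rule gabor_total[OF closed_subspace_closed_span[OF X] closed_span_superset[OF X] f]) auto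
  then have "\<forall>\<epsilon>>0. \<exists>F c. finite F \<and> F \<subseteq> ?X \<and> L2_norm (\<lambda>x. f x - (\<Sum>u\<in>F. c u * u x)) < \<epsilon>"
    unfolding closed_span_def by blast
  moreover have "(1/2) ^ (n + 1) > (0::real)" for n by simp
  ultimately have "\<exists>F c. F \<subseteq> ?X \<and> L2_norm (\<lambda>x. f x - (\<Sum>u\<in>F. c u * u x)) < (1/2) ^ (n + 1)" for n
    by meson
  then have "\<forall>n. \<exists>F c. F \<subseteq> ?X \<and> L2_norm (\<lambda>x. f x - (\<Sum>u\<in>F. c u * u x)) < (1/2) ^ (n + 1)" ..
  from choice[OF this] obtain F
    where "\<forall>n. \<exists>c. F n \<subseteq> ?X \<and> L2_norm (\<lambda>x. f x - (\<Sum>u\<in>F n. c u * u x)) < (1/2) ^ (n + 1)" ..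
  from choice[OF this] obtain c
    where "\<forall>n. F n \<subseteq> ?X \<and> L2_norm (\<lambda>x. f x - (\<Sum>u\<in>F n. c n u * u x)) < (1/2) ^ (n + 1)" ..
  then have F: "\<And>n. F n \<subseteq> ?X"
    and ap: "\<And>n. L2_norm (\<lambda>x. f x - (\<Sum>u\<in>F n. c n u * u x)) < (1/2) ^ (n + 1)" by blast+
  define h where "h n = (\<lambda>x. \<Sum>u\<in>F n. c n u * u x)" for n
  have inn: "L2_inner (fourier g) (fourier (h n)) = L2_inner g (h n)"
    if "g \<in> L2_space" "integrable lebesgue g" "fourier g \<in> L2_space" for g n
    using gabor_span_transform(4)[OF F that, of "c n" n] unfolding h_def .
  have T1: "integrable lebesgue (h n)" "h n \<in> L2_space" "fourier (h n) \<in> L2_space" for n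
    using gabor_span_transform(1-3)[OF F[of n], of "c n"] unfolding h_def by auto
  have iso: "L2_norm (\<lambda>\<omega>. fourier (h n) \<omega> - fourier (h m) \<omega>) = L2_norm (\<lambda>x. h n x - h m x)" for n m
  proof -
    let ?d = "\<lambda>x. h n x - h m x"
    have d: "?d \<in> L2_space" "integrable lebesgue ?d" "fourier ?d \<in> L2_space"
      using T1 by (auto simp: L2_diff fourier_diff)
    have "L2_inner (fourier ?d) (fourier ?d) = L2_inner (fourier ?d) (\<lambda>\<omega>. fourier (h n) \<omega> - fourier (h m) \<omega>)"
      by (simp only: fourier_diff[OF T1(1) T1(1)])
    also have "\<dots> = L2_inner ?d (h n) - L2_inner ?d (h m)"
      using inn[OF d] T1 d by (simp add: L2_inner_diff_right)
    also have "\<dots> = L2_inner ?d ?d" using T1 d by (simp add: L2_inner_diff_right)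
    finally have "complex_of_real ((L2_norm (fourier ?d))\<^sup>2) = of_real ((L2_norm ?d)\<^sup>2)"
      by (simp only: L2_inner_self)
    then have "(L2_norm (fourier ?d))\<^sup>2 = (L2_norm ?d)\<^sup>2" by (simp only: of_real_eq_iff)
    then show ?thesis by (simp add: fourier_diff[OF T1(1) T1(1)])
  qed
  have iso1: "L2_norm (fourier (h n)) = L2_norm (h n)" for n
  proof -
    have "complex_of_real ((L2_norm (fourier (h n)))\<^sup>2) = of_real ((L2_norm (h n))\<^sup>2)"
      using inn[OF T1(2,1,3), of n n] by (simp only: L2_inner_self)
    then have "(L2_norm (fourier (h n)))\<^sup>2 = (L2_norm (h n))\<^sup>2" by (simp only: of_real_eq_iff)
    then show ?thesis by simp
  qed
  have close: "L2_norm (\<lambda>x. h n x - f x) < (1/2) ^ (n + 1)" for n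
    using ap[of n] unfolding h_def by (subst L2_norm_minus_commute)
  have "L2_norm (\<lambda>x. h (Suc n) x - h n x) \<le> (1/2) ^ n" for n
  proof -
    have "L2_norm (\<lambda>x. h (Suc n) x - h n x) \<le> L2_norm (\<lambda>x. h (Suc n) x - f x) + L2_norm (\<lambda>x. f x - h n x)"
      by (rule L2_norm_triangle_diff[OF T1(2) f T1(2)])
    also have "\<dots> \<le> (1/2) ^ (n + 2) + (1/2) ^ (n + 1)"
      using close[of "Suc n"] close[of n] L2_norm_minus_commute[of f "h n"] by simp
    also have "\<dots> \<le> (1/2) ^ n" by (simp add: power_add)
    finally show ?thesis .
  qed
  then have "L2_norm (\<lambda>\<omega>. fourier (h (Suc n)) \<omega> - fourier (h n) \<omega>) \<le> (1/2) ^ n" for n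
    by (simp only: iso)
  from L2_complete_fast[OF T1(3) this] obtain g where g: "g \<in> L2_space"
    and glim: "(\<lambda>n. L2_norm (\<lambda>\<omega>. fourier (h n) \<omega> - g \<omega>)) \<longlonglongrightarrow> 0" by blast
  have flim: "(\<lambda>n. L2_norm (\<lambda>x. h n x - f x)) \<longlonglongrightarrow> 0"
  proof (rule Lim_null_comparison)
    show "\<forall>\<^sub>F n in sequentially. norm (L2_norm (\<lambda>x. h n x - f x)) \<le> (1/2) ^ (n + 1)"
      using close by (auto intro!: always_eventually less_imp_le simp del: power_Suc)
    show "(\<lambda>n. (1/2) ^ (n + 1) :: real) \<longlonglongrightarrow> 0"
      by (rule LIMSEQ_ignore_initial_segment) (rule LIMSEQ_power_zero, simp)
  qed
  have "is_fourier_L2 f g" unfolding is_fourier_L2_def using f g T1 flim glim by blast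
  moreover have "L2_norm g = L2_norm f"
  proof (rule LIMSEQ_unique)
    show "(\<lambda>n. L2_norm (fourier (h n))) \<longlonglongrightarrow> L2_norm g" by (rule L2_norm_tendsto[OF T1(3) g glim])
    show "(\<lambda>n. L2_norm (fourier (h n))) \<longlonglongrightarrow> L2_norm f"
      unfolding iso1 by (rule L2_norm_tendsto[OF T1(2) f flim])
  qed
  ultimately show ?thesis by blast
qed

lemma L2_norm_diff_cong_AE:
  assumes "h \<in> borel_measurable lebesgue" "g \<in> borel_measurable lebesgue" "g' \<in> borel_measurable lebesgue"
    "AE x in lebesgue. g x = g' x"
  shows "L2_norm (\<lambda>x. h x - g x) = L2_norm (\<lambda>x. h x - g' x)"
proof (rule L2_norm_cong_AE)
  show "AE x in lebesgue. norm (h x - g x) = norm (h x - g' x)"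
    using assms(4) by eventually_elim simp
qed (use assms in measurable)

text \<open>
  The transform that exists forms a pair with \<open>f\<close>, and pairs are unique almost everywhere.
\<close>

lemma is_fourier_L2_iff_pair: "is_fourier_L2 f g \<longleftrightarrow> fourier_pair f g"
proof
  assume p: "fourier_pair f g"
  obtain g' where g': "is_fourier_L2 f g'" using fourier_L2_exists fourier_pairD(1)[OF p] by blast
  then have eq: "AE x in lebesgue. g' x = g x"
    by (intro fourier_pair_unique[OF _ p] is_fourier_L2_imp_pair)
  from g' obtain h where h: "\<forall>n. integrable lebesgue (h n) \<and> h n \<in> L2_space \<and> fourier (h n) \<in> L2_space"
    "(\<lambda>n. L2_norm (\<lambda>x. h n x - f x)) \<longlonglongrightarrow> 0" "(\<lambda>n. L2_norm (\<lambda>\<omega>. fourier (h n) \<omega> - g' \<omega>)) \<longlonglongrightarrow> 0"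
    and g'L: "g' \<in> L2_space"
    unfolding is_fourier_L2_def by blast
  have "L2_norm (\<lambda>\<omega>. fourier (h n) \<omega> - g' \<omega>) = L2_norm (\<lambda>\<omega>. fourier (h n) \<omega> - g \<omega>)" for n
    using h(1) g'L fourier_pairD(2)[OF p] by (intro L2_norm_diff_cong_AE[OF _ _ _ eq] L2_measurable) auto
  then show "is_fourier_L2 f g"
    unfolding is_fourier_L2_def using h fourier_pairD[OF p] by auto
qed (rule is_fourier_L2_imp_pair)

lemma fourier_pair_exists: "f \<in> L2_space \<Longrightarrow> \<exists>g. fourier_pair f g"
  using fourier_L2_exists is_fourier_L2_iff_pair by blast

lemma fourier_pair_norm:
  assumes p: "fourier_pair f g" shows "L2_norm g = L2_norm f"
proof -
  obtain g' where g': "fourier_pair f g'" "L2_norm g' = L2_norm f"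
    using fourier_L2_exists fourier_pairD(1)[OF p] is_fourier_L2_iff_pair by blast
  have "L2_norm g = L2_norm g'"
  proof (rule L2_norm_cong_AE)
    show "AE x in lebesgue. norm (g x) = norm (g' x)"
      using fourier_pair_unique[OF p g'(1)] by eventually_elim simp
  qed (use L2_measurable fourier_pairD(2)[OF p] fourier_pairD(2)[OF g'(1)] in auto)
  then show ?thesis using g'(2) by simp
qed

text \<open>
  Polarisation: an isometry preserves the real part of the inner product, and applying this to
  \<open>f'\<close> and \<open>\<i> f'\<close> gives the real and the imaginary part.
\<close>

lemma fourier_pair_inner:
  assumes 1: "fourier_pair f g" and 2: "fourier_pair f' g'"
  shows "L2_inner g g' = L2_inner f f'"
proof -
  have re: "Re (L2_inner g k') = Re (L2_inner f k)" if "fourier_pair k k'" for k k'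
    using L2_norm_add_power2[OF fourier_pairD(1)[OF 1] fourier_pairD(1)[OF that]]
      L2_norm_add_power2[OF fourier_pairD(2)[OF 1] fourier_pairD(2)[OF that]]
      fourier_pair_norm[OF fourier_pair_add[OF 1 that]] fourier_pair_norm[OF 1] fourier_pair_norm[OF that]
    by simp
  have "Re (L2_inner g (\<lambda>x. \<i> * g' x)) = Re (L2_inner f (\<lambda>x. \<i> * f' x))"
    by (rule re[OF fourier_pair_scale[OF 2]])
  then have "Im (L2_inner g g') = Im (L2_inner f f')"
    by (simp add: L2_inner_scale_right)
  then show ?thesis using re[OF 2] by (simp add: complex_eq_iff)
qed

text \<open>
  Fourier inversion. If \<open>f\<close> is the transform of \<open>g\<close>, then the reflection of \<open>f\<close> has transform
  \<open>g\<close>, because two transforms of a Gaussian amount to a reflection.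
\<close>

lemma fourier_pair_onto:
  assumes g: "g \<in> L2_space" shows "\<exists>f. fourier_pair f g"
proof -
  obtain f where p: "fourier_pair g f" using fourier_pair_exists[OF g] by blast
  note f = fourier_pairD[OF p]
  have "L2_inner (\<lambda>x. f (- x)) (gabor a b) = cnj (wave a b) * L2_inner g (gabor (- b) a)" for a b
  proof -
    have refl: "gabor a b x = gabor (- a) (- b) (- x)" for x
      using norm_minus_cancel[of "x - b"]
      by (simp add: gabor_def wave_minus_left wave_minus_right del: norm_minus_cancel)
    have m: "(\<lambda>x. f x * cnj (gabor (- a) (- b) x)) \<in> borel_measurable lebesgue"
      using L2_measurable[OF f(2)] by measurable
    have "L2_inner (\<lambda>x. f (- x)) (gabor a b) = L2_inner f (gabor (- a) (- b))"
      unfolding L2_inner_def refl[abs_def] by (rule lebesgue_integral_reflect[OF m])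
    also have "\<dots> = wave (- b) a * L2_inner g (gabor (- b) a)"
      by (rule f(3))
    finally show ?thesis by (simp add: wave_minus_left wave_commute[of b a])
  qed
  then have "wave a b * L2_inner (\<lambda>x. f (- x)) (gabor a b) = L2_inner g (gabor (- b) a)" for a b
    using wave_times_cnj[of a b] by (simp add: mult.assoc[symmetric])
  then have "fourier_pair (\<lambda>x. f (- x)) g"
    unfolding fourier_pair_def using L2_reflect[OF f(2)] g by simp
  then show ?thesis by blast
qed

text \<open>
  A translate of a Gaussian is again one of the family, with a phase factor, so translations can be
  moved to the Gaussian against which the function is tested.
\<close>

lemma fourier_pair_translate:
  assumes p: "fourier_pair f g"
  shows "fourier_pair (translate x f) (\<lambda>\<omega>. wave (- x) \<omega> * g \<omega>)"
  unfolding fourier_pair_def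
proof (intro conjI allI)
  show "translate x f \<in> L2_space" by (rule L2_translate[OF fourier_pairD(1)[OF p]])
  show "(\<lambda>\<omega>. wave (- x) \<omega> * g \<omega>) \<in> L2_space"
    by (rule L2_mult_bounded[OF fourier_pairD(2)[OF p] borel_measurable_wave_lebesgue, where c=1]) simp
  fix a b
  have "(\<lambda>y. f (y - x) * cnj (gabor a b y)) \<in> borel_measurable lebesgue"
    using L2_measurable[OF L2_translate[OF fourier_pairD(1)[OF p], of x]]
    by (simp add: translate_def)
  from lebesgue_integral_translate[OF this, of x]
  have "L2_inner (translate x f) (gabor a b) = (LINT y|lebesgue. f y * cnj (gabor a b (y + x)))"
    unfolding L2_inner_def translate_def by simp
  also have "\<dots> = cnj (wave a x) * L2_inner f (gabor a (b - x))"
    unfolding gabor_translate L2_inner_def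
    by (subst integral_mult_right_zero[symmetric]) (simp add: mult_ac)
  also have "wave a b * \<dots> = wave a (b - x) * L2_inner f (gabor a (b - x))"
    by (simp add: wave_diff_right mult_ac)
  also have "\<dots> = L2_inner g (gabor (- (b - x)) a)" by (rule fourier_pairD(3)[OF p, symmetric])
  also have "gabor (- (b - x)) a = (\<lambda>\<omega>. wave x \<omega> * gabor (- b) a \<omega>)"
    by (simp add: gabor_wave)
  also have "L2_inner g (\<lambda>\<omega>. wave x \<omega> * gabor (- b) a \<omega>) = L2_inner (\<lambda>\<omega>. wave (- x) \<omega> * g \<omega>) (gabor (- b) a)"
    unfolding L2_inner_def wave_minus_left by (simp add: mult_ac)
  finally show "L2_inner (\<lambda>\<omega>. wave (- x) \<omega> * g \<omega>) (gabor (- b) a)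
      = wave a b * L2_inner (translate x f) (gabor a b)" by simp
qed

lemma fourier_L2_pair: "f \<in> L2_space \<Longrightarrow> fourier_pair f (fourier_L2 f)"
  unfolding fourier_L2_def is_fourier_L2_iff_pair by (rule someI_ex[OF fourier_pair_exists])

lemma fourier_L2_AE_eq: "fourier_pair f g \<Longrightarrow> AE \<omega> in lebesgue. fourier_L2 f \<omega> = g \<omega>"
  by (rule fourier_pair_unique[OF fourier_L2_pair[OF fourier_pairD(1)]])

section \<open>Paley-Wiener spaces and their projections\<close>

lemma paley_wiener_iff:
  assumes "fourier_pair f g"
  shows "f \<in> paley_wiener \<Omega> \<longleftrightarrow> (AE \<omega> in lebesgue. \<omega> \<notin> \<Omega> \<longrightarrow> g \<omega> = 0)"
proof -
  have "(AE \<omega> in lebesgue. \<omega> \<notin> \<Omega> \<longrightarrow> fourier_L2 f \<omega> = 0) \<longleftrightarrow> (AE \<omega> in lebesgue. \<omega> \<notin> \<Omega> \<longrightarrow> g \<omega> = 0)"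
    by (rule eventually_subst, use fourier_L2_AE_eq[OF assms] in eventually_elim) simp
  then show ?thesis
    using fourier_pairD(1)[OF assms] by (simp add: paley_wiener_def)
qed

lemma paley_wienerD:
  assumes "f \<in> paley_wiener \<Omega>"
  shows "\<exists>g. fourier_pair f g \<and> (AE \<omega> in lebesgue. \<omega> \<notin> \<Omega> \<longrightarrow> g \<omega> = 0)"
  using assms fourier_L2_pair by (auto simp: paley_wiener_def)

text \<open>
  The transform of a function that is within \<open>e\<close> of the space has norm at most \<open>e\<close> outside
  \<open>\<Omega>\<close>.
\<close>

lemma closed_subspace_paley_wiener:
  fixes \<Omega> :: "(real^'d) set"
  assumes \<Omega>: "\<Omega> \<in> sets lebesgue"
  shows "closed_subspace (paley_wiener \<Omega>)"
  unfolding closed_subspace_def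
proof (intro conjI ballI allI impI)
  show "paley_wiener \<Omega> \<subseteq> L2_space" by (auto simp: paley_wiener_def)
  show "(\<lambda>x. 0) \<in> paley_wiener \<Omega>" by (simp add: paley_wiener_iff[OF fourier_pair_zero])
next
  fix f g assume "f \<in> paley_wiener \<Omega>" "g \<in> paley_wiener \<Omega>"
  then obtain f' g' where p: "fourier_pair f f'" "fourier_pair g g'"
    and z: "AE \<omega> in lebesgue. \<omega> \<notin> \<Omega> \<longrightarrow> f' \<omega> = 0" "AE \<omega> in lebesgue. \<omega> \<notin> \<Omega> \<longrightarrow> g' \<omega> = 0"
    by (blast dest: paley_wienerD)
  show "(\<lambda>x. f x + g x) \<in> paley_wiener \<Omega>"
    unfolding paley_wiener_iff[OF fourier_pair_add[OF p]] using z by eventually_elim simp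
next
  fix f and c :: complex assume "f \<in> paley_wiener \<Omega>"
  then obtain f' where p: "fourier_pair f f'" and z: "AE \<omega> in lebesgue. \<omega> \<notin> \<Omega> \<longrightarrow> f' \<omega> = 0"
    by (blast dest: paley_wienerD)
  show "(\<lambda>x. c * f x) \<in> paley_wiener \<Omega>"
    unfolding paley_wiener_iff[OF fourier_pair_scale[OF p]] using z by eventually_elim simp
next
  fix f :: "real^'d \<Rightarrow> complex"
  assume f: "f \<in> L2_space" and ap: "\<forall>\<epsilon>>0. \<exists>g\<in>paley_wiener \<Omega>. L2_norm (\<lambda>x. f x - g x) < \<epsilon>"
  obtain f' where p: "fourier_pair f f'" using fourier_pair_exists[OF f] by blast
  let ?r = "\<lambda>\<omega>. indicator (- \<Omega>) \<omega> * f' \<omega>"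
  have r: "?r \<in> L2_space"
    by (rule L2_indicator[OF fourier_pairD(2)[OF p]]) (use \<Omega> in \<open>simp add: Compl_in_sets_lebesgue\<close>)
  have "L2_norm ?r \<le> 0 + e" if e: "e > 0" for e
  proof -
    obtain g where g: "g \<in> paley_wiener \<Omega>" "L2_norm (\<lambda>x. f x - g x) < e" using ap e by blast
    obtain g' where q: "fourier_pair g g'" "AE \<omega> in lebesgue. \<omega> \<notin> \<Omega> \<longrightarrow> g' \<omega> = 0"
      using paley_wienerD[OF g(1)] by blast
    note d = fourier_pair_diff[OF p q(1)]
    have "L2_norm ?r \<le> L2_norm (\<lambda>\<omega>. f' \<omega> - g' \<omega>)"
    proof (rule L2_norm_mono_AE[OF fourier_pairD(2)[OF d] r])
      show "AE \<omega> in lebesgue. norm (?r \<omega>) \<le> norm (f' \<omega> - g' \<omega>)"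
        using q(2) by eventually_elim (auto simp: indicator_def)
    qed
    then show ?thesis using fourier_pair_norm[OF d] g(2) by simp
  qed
  then have "L2_norm ?r \<le> 0" by (rule field_le_epsilon)
  then have "L2_norm ?r = 0" using L2_norm_nonneg[of ?r] by linarith
  then have "AE \<omega> in lebesgue. ?r \<omega> = 0" unfolding L2_norm_eq_0[OF r] .
  then have "AE \<omega> in lebesgue. \<omega> \<notin> \<Omega> \<longrightarrow> f' \<omega> = 0"
    by eventually_elim (auto simp: indicator_def)
  then show "f \<in> paley_wiener \<Omega>" unfolding paley_wiener_iff[OF p] .
qed

lemma translation_invariant_paley_wiener: "translation_invariant (paley_wiener \<Omega>)"
  unfolding translation_invariant_def
proof (intro allI ballI)
  fix x f assume "f \<in> paley_wiener \<Omega>"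
  then obtain g where p: "fourier_pair f g" and z: "AE \<omega> in lebesgue. \<omega> \<notin> \<Omega> \<longrightarrow> g \<omega> = 0"
    by (blast dest: paley_wienerD)
  show "translate x f \<in> paley_wiener \<Omega>"
    unfolding paley_wiener_iff[OF fourier_pair_translate[OF p]] using z by eventually_elim simp
qed

text \<open>
  The orthogonal projection onto the space cuts the transform off outside \<open>\<Omega>\<close>: the transform of the
  remainder is supported off \<open>\<Omega>\<close>, so the remainder is orthogonal to the space. The error is the mass of the transform that is
  cut off.
\<close>

lemma paley_wiener_projection_error:
  assumes \<Omega>: "\<Omega> \<in> sets lebesgue" and f: "f \<in> L2_space"
  shows "(L2_norm (\<lambda>x. f x - orth_proj (paley_wiener \<Omega>) f x))\<^sup>2
    = (L2_norm f)\<^sup>2 - (LINT \<omega>|lebesgue. indicator \<Omega> \<omega> * (norm (fourier_L2 f \<omega>))\<^sup>2)"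
proof -
  let ?V = "paley_wiener \<Omega>" and ?g = "fourier_L2 f"
  have fg: "fourier_pair f ?g" by (rule fourier_L2_pair[OF f])
  have gL: "?g \<in> L2_space" by (rule fourier_pairD(2)[OF fg])
  obtain p0 where p0: "fourier_pair p0 (\<lambda>\<omega>. indicator \<Omega> \<omega> * ?g \<omega>)"
    using fourier_pair_onto[OF L2_indicator[OF gL \<Omega>]] by blast
  note res = fourier_pair_diff[OF fg p0]
  have p0V: "p0 \<in> ?V" unfolding paley_wiener_iff[OF p0] by simp
  have p0_orth: "L2_inner (\<lambda>x. f x - p0 x) q = 0" if q: "q \<in> ?V" for q
  proof -
    obtain q' where q': "fourier_pair q q'" "AE \<omega> in lebesgue. \<omega> \<notin> \<Omega> \<longrightarrow> q' \<omega> = 0"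
      using paley_wienerD[OF q] by blast
    have "L2_inner (\<lambda>x. f x - p0 x) q = L2_inner (\<lambda>\<omega>. ?g \<omega> - indicator \<Omega> \<omega> * ?g \<omega>) q'"
      by (rule fourier_pair_inner[OF res q'(1), symmetric])
    also have "\<dots> = 0"
      unfolding L2_inner_def
    proof (rule integral_eq_zero_AE)
      show "AE \<omega> in lebesgue. (?g \<omega> - indicator \<Omega> \<omega> * ?g \<omega>) * cnj (q' \<omega>) = 0"
        using q'(2) by eventually_elim (auto simp: indicator_def)
    qed
    finally show ?thesis .
  qed
  \<comment> \<open>The function chosen by \<open>orth_proj\<close> has the same defining property as \<open>p0\<close>, so the two agree
    almost everywhere.\<close>
  define p where "p = orth_proj ?V f"
  have "p \<in> ?V \<and> (\<forall>g\<in>?V. L2_inner (\<lambda>x. f x - p x) g = 0)"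
    unfolding p_def orth_proj_def by (rule someI[of _ p0]) (use p0V p0_orth in blast)
  then have pV: "p \<in> ?V" and p_orth: "\<And>g. g \<in> ?V \<Longrightarrow> L2_inner (\<lambda>x. f x - p x) g = 0" by auto
  note C = closed_subspace_paley_wiener[OF \<Omega>]
  have pL: "p \<in> L2_space" and p0L: "p0 \<in> L2_space" using C pV p0V closed_subspace_L2 by auto
  let ?d = "\<lambda>x. p x - p0 x"
  have "(\<lambda>x. p x + (-1) * p0 x) \<in> ?V"
    by (intro closed_subspace_add[OF C] closed_subspace_scale[OF C] pV p0V)
  then have d: "?d \<in> ?V" by simp
  have "?d = (\<lambda>x. (f x - p0 x) - (f x - p x))" by auto
  then have "L2_inner ?d ?d = L2_inner (\<lambda>x. f x - p0 x) ?d - L2_inner (\<lambda>x. f x - p x) ?d"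
    using L2_inner_diff_left[OF L2_diff[OF f p0L] L2_diff[OF f pL] L2_diff[OF pL p0L]] by simp
  then have "L2_inner ?d ?d = 0" using p0_orth[OF d] p_orth[OF d] by simp
  then have "L2_norm ?d = 0" by (simp add: L2_inner_self)
  moreover have "\<bar>L2_norm (\<lambda>x. f x - p0 x) - L2_norm (\<lambda>x. f x - p x)\<bar> \<le> L2_norm ?d"
    using L2_norm_diff_abs[OF L2_diff[OF f p0L] L2_diff[OF f pL]] by simp
  ultimately have "L2_norm (\<lambda>x. f x - p x) = L2_norm (\<lambda>x. f x - p0 x)" by simp
  also have "\<dots> = L2_norm (\<lambda>\<omega>. ?g \<omega> - indicator \<Omega> \<omega> * ?g \<omega>)"
    by (rule fourier_pair_norm[OF res, symmetric])
  finally have "(L2_norm (\<lambda>x. f x - p x))\<^sup>2 = (LINT \<omega>|lebesgue. (norm (?g \<omega> - indicator \<Omega> \<omega> * ?g \<omega>))\<^sup>2)"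
    by (simp add: L2_norm_power2)
  also have "\<dots> = (LINT \<omega>|lebesgue. (norm (?g \<omega>))\<^sup>2 - indicator \<Omega> \<omega> * (norm (?g \<omega>))\<^sup>2)"
    by (rule Bochner_Integration.integral_cong) (auto simp: indicator_def)
  also have "\<dots> = (LINT \<omega>|lebesgue. (norm (?g \<omega>))\<^sup>2) - (LINT \<omega>|lebesgue. indicator \<Omega> \<omega> * (norm (?g \<omega>))\<^sup>2)"
    using integrable_real_mult_indicator[OF \<Omega> L2_integrable[OF gL]]
    by (intro Bochner_Integration.integral_diff L2_integrable gL) (simp add: mult.commute)
  also have "(LINT \<omega>|lebesgue. (norm (?g \<omega>))\<^sup>2) = (L2_norm f)\<^sup>2"
    using fourier_pair_norm[OF fg] by (simp add: L2_norm_power2[symmetric])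
  finally show ?thesis unfolding p_def .
qed

text \<open>
  Since the transform is a surjective isometry, it maps closed subspaces to closed subspaces. This
  allows density to be proved on the frequency side.
\<close>

lemma closed_subspace_fourier_image:
  assumes V: "closed_subspace V"
  shows "closed_subspace {h. \<exists>f\<in>V. fourier_pair f h}"
  unfolding closed_subspace_def
proof (intro conjI ballI allI impI)
  show "{h. \<exists>f\<in>V. fourier_pair f h} \<subseteq> L2_space" by (auto dest: fourier_pairD)
  show "(\<lambda>x. 0) \<in> {h. \<exists>f\<in>V. fourier_pair f h}"
    using closed_subspace_zero[OF V] fourier_pair_zero by blast
next
  fix f g assume "f \<in> {h. \<exists>f\<in>V. fourier_pair f h}" "g \<in> {h. \<exists>f\<in>V. fourier_pair f h}"
  then show "(\<lambda>x. f x + g x) \<in> {h. \<exists>f\<in>V. fourier_pair f h}"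
    using closed_subspace_add[OF V] fourier_pair_add by blast
next
  fix f and c :: complex assume "f \<in> {h. \<exists>f\<in>V. fourier_pair f h}"
  then show "(\<lambda>x. c * f x) \<in> {h. \<exists>f\<in>V. fourier_pair f h}"
    using closed_subspace_scale[OF V] fourier_pair_scale by blast
next
  fix h :: "real^'a \<Rightarrow> complex"
  assume h: "h \<in> L2_space" and ap: "\<forall>\<epsilon>>0. \<exists>g\<in>{h. \<exists>f\<in>V. fourier_pair f h}. L2_norm (\<lambda>x. h x - g x) < \<epsilon>"
  obtain f where f: "fourier_pair f h" using fourier_pair_onto[OF h] by blast
  have "f \<in> V"
  proof (rule closed_subspace_closed[OF V fourier_pairD(1)[OF f]])
    fix \<epsilon> :: real assume "\<epsilon> > 0"
    then obtain g' g where g: "g \<in> V" "fourier_pair g g'" "L2_norm (\<lambda>x. h x - g' x) < \<epsilon>"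
      using ap by blast
    then have "L2_norm (\<lambda>x. f x - g x) < \<epsilon>"
      using fourier_pair_norm[OF fourier_pair_diff[OF f g(2)]] by simp
    then show "\<exists>g\<in>V. L2_norm (\<lambda>x. f x - g x) < \<epsilon>" by (rule bexI[OF _ g(1)])
  qed
  then show "h \<in> {h. \<exists>f\<in>V. fourier_pair f h}" using f by blast
qed

lemma mem_closed_subspace_of_fourier_pair:
  assumes V: "closed_subspace V" and f: "fourier_pair f h" and h: "\<exists>f\<in>V. fourier_pair f h"
  shows "f \<in> V"
proof -
  obtain g where g: "g \<in> V" "fourier_pair g h" using h by blast
  note d = fourier_pair_diff[OF f g(2)]
  have "L2_norm (\<lambda>x. f x - g x) = 0" using fourier_pair_norm[OF d] by simp
  then have "AE x in lebesgue. f x - g x = 0"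
    using L2_norm_eq_0[OF fourier_pairD(1)[OF d]] by simp
  then have "AE x in lebesgue. f x = g x" by eventually_elim simp
  then show ?thesis by (rule closed_subspace_AE[OF V g(1) L2_measurable[OF fourier_pairD(1)[OF f]]])
qed

section \<open>The integer lattice and its cosets\<close>

text \<open>
  Half-open, so that its lattice translates partition the space exactly and not only up to null
  sets.
\<close>

definition unit_cube :: "(real^'d) set" where
  "unit_cube = {x. \<forall>i. - 1/2 \<le> x $ i \<and> x $ i < 1/2}"

definition nearest_lattice :: "real^'d \<Rightarrow> real^'d" where
  "nearest_lattice x = (\<chi> i. of_int \<lfloor>x $ i + 1/2\<rfloor>)"

lemma nearest_lattice_in [simp]: "nearest_lattice x \<in> int_lattice"
  by (simp add: nearest_lattice_def int_lattice_def)

text \<open>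
  The value is the index of the translated cube that contains the point.
\<close>

lemma nearest_lattice_iff:
  assumes "k \<in> int_lattice"
  shows "nearest_lattice x = k \<longleftrightarrow> x - k \<in> unit_cube"
proof -
  have "(of_int \<lfloor>x $ i + 1/2\<rfloor> = k $ i) \<longleftrightarrow> - 1/2 \<le> (x - k) $ i \<and> (x - k) $ i < 1/2" for i
  proof -
    obtain n :: int where "k $ i = of_int n" using assms by (auto simp: int_lattice_def Ints_def)
    then show ?thesis by (simp add: floor_eq_iff) linarith
  qed
  then show ?thesis by (simp add: nearest_lattice_def unit_cube_def vec_eq_iff)
qed

lemma nearest_lattice_add: "k \<in> int_lattice \<Longrightarrow> nearest_lattice (x + k) = nearest_lattice x + k"
  using nearest_lattice_iff[of "nearest_lattice x" x] nearest_lattice_iff[of "nearest_lattice x + k" "x + k"]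
  by (simp add: int_lattice_add)

lemma nearest_lattice_unit_cube: "x \<in> unit_cube \<Longrightarrow> nearest_lattice x = 0"
  by (subst nearest_lattice_iff) auto

lemma unit_cube_borel [measurable]: "(unit_cube :: (real^'d) set) \<in> sets borel"
proof -
  have [measurable]: "(\<lambda>x::real^'d. x $ i) \<in> borel_measurable borel" for i
    by (intro borel_measurable_continuous_onI continuous_intros)
  have "{x \<in> space (borel :: (real^'d) measure). \<forall>i. - 1/2 \<le> x $ i \<and> x $ i < 1/2} \<in> sets borel" by measurable
  then show ?thesis by (simp add: unit_cube_def)
qed

lemma borel_in_lebesgue: "A \<in> sets borel \<Longrightarrow> A \<in> sets lebesgue"
  by auto

lemma unit_cube_lebesgue [measurable]: "unit_cube \<in> sets lebesgue"
  by (rule borel_in_lebesgue) (rule unit_cube_borel)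

lemma finite_int_lattice_cball: "finite (int_lattice \<inter> cball (0 :: real^'d) R)"
proof -
  let ?S = "PiE (UNIV :: 'd set) (\<lambda>_. {- \<lceil>R\<rceil>..\<lceil>R\<rceil>})"
  have "finite ?S" by (intro finite_PiE) auto
  moreover have "int_lattice \<inter> cball 0 R \<subseteq> (\<lambda>f. \<chi> i. real_of_int (f i)) ` ?S"
  proof
    fix k :: "real^'d" assume k: "k \<in> int_lattice \<inter> cball 0 R"
    have "k = (\<chi> i. real_of_int \<lfloor>k $ i\<rfloor>)"
      using k by (auto simp: int_lattice_def vec_eq_iff)
    moreover have "(\<lambda>i. \<lfloor>k $ i\<rfloor>) \<in> ?S"
    proof -
      have "\<lfloor>k $ i\<rfloor> \<le> \<lceil>R\<rceil> \<and> - \<lceil>R\<rceil> \<le> \<lfloor>k $ i\<rfloor>" for i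
      proof -
        have "\<bar>k $ i\<bar> \<le> norm k" by (rule component_le_norm_cart)
        also have "\<dots> \<le> R" using k by simp
        also have "R \<le> of_int \<lceil>R\<rceil>" by (rule le_of_int_ceiling)
        finally have "k $ i \<le> of_int \<lceil>R\<rceil>" "of_int (- \<lceil>R\<rceil>) \<le> k $ i" by auto
        then show ?thesis by (meson le_floor_iff floor_le_iff le_less_trans less_add_one)
      qed
      then show ?thesis by auto
    qed
    ultimately show "k \<in> (\<lambda>f. \<chi> i. real_of_int (f i)) ` ?S" by (rule image_eqI)
  qed
  ultimately show ?thesis by (rule finite_surj)
qed

lemma finite_lattice_of_bounded: "bounded B \<Longrightarrow> finite (int_lattice \<inter> (B :: (real^'d) set))"
proof -
  assume "bounded B"
  then obtain R where "\<forall>x\<in>B. norm x \<le> R" by (auto simp: bounded_iff)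
  then have "int_lattice \<inter> B \<subseteq> int_lattice \<inter> cball 0 R" by auto
  then show ?thesis by (rule finite_subset) (rule finite_int_lattice_cball)
qed

lemma finite_nearest_lattice_image:
  fixes B :: "(real^'d) set"
  assumes "bounded B" shows "finite (nearest_lattice ` B)"
proof -
  obtain R where R: "\<And>x. x \<in> B \<Longrightarrow> norm x \<le> R" using assms bounded_iff by metis
  have "nearest_lattice ` B \<subseteq> int_lattice \<inter> cball 0 (R + CARD('d))"
  proof (rule image_subsetI)
    fix x assume x: "x \<in> B"
    let ?r = "x - nearest_lattice x"
    have "norm ?r \<le> (\<Sum>i\<in>UNIV. \<bar>?r $ i\<bar>)" by (rule norm_le_l1_cart)
    also have "\<dots> \<le> (\<Sum>i\<in>(UNIV :: 'd set). 1)"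
    proof (rule sum_mono)
      fix i show "\<bar>?r $ i\<bar> \<le> 1"
        using nearest_lattice_iff[of "nearest_lattice x" x]
        by (auto simp: unit_cube_def abs_le_iff dest!: spec[of _ i])
    qed
    finally have "norm ?r \<le> CARD('d)" by simp
    moreover have "norm (nearest_lattice x) \<le> norm x + norm ?r"
      using norm_triangle_ineq4[of x ?r] by simp
    ultimately have "norm (nearest_lattice x) \<le> R + CARD('d)" using R[OF x] by linarith
    then show "nearest_lattice x \<in> int_lattice \<inter> cball 0 (R + CARD('d))" by simp
  qed
  then show ?thesis by (rule finite_subset) (rule finite_int_lattice_cball)
qed

text \<open>
  Cut the integral along the translates of the unit cube and move each piece back to the cube. Only
  the finitely many translates indexed by \<open>K\<close> meet the support.
\<close>

lemma fold_integral:
  fixes h :: "real^'d \<Rightarrow> 'b::{banach, second_countable_topology}"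
  assumes h: "integrable lebesgue h" and K: "finite K" "K \<subseteq> int_lattice"
    and supp: "\<And>x. h x \<noteq> 0 \<Longrightarrow> nearest_lattice x \<in> K"
  shows "(LINT x|lebesgue. h x) = (LINT x|lebesgue. indicator unit_cube x *\<^sub>R (\<Sum>k\<in>K. h (x + k)))"
    and "integrable lebesgue (\<lambda>x. indicator unit_cube x *\<^sub>R (\<Sum>k\<in>K. h (x + k)))"
proof -
  have eq: "h x = (\<Sum>k\<in>K. indicator unit_cube (x - k) *\<^sub>R h x)" for x
  proof (cases "h x = 0")
    case False
    have "(\<Sum>k\<in>K. indicator unit_cube (x - k) *\<^sub>R h x) = (\<Sum>k\<in>K. if k = nearest_lattice x then h x else 0)"
      using K(2) by (intro sum.cong refl) (auto simp: indicator_def nearest_lattice_iff[symmetric] subset_iff)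
    also have "\<dots> = h x" using supp[OF False] K(1) by simp
    finally show ?thesis by simp
  qed simp
  have qm: "indicator unit_cube \<in> borel_measurable (lebesgue :: (real^'d) measure)" by measurable
  have i0: "integrable lebesgue (\<lambda>x. indicator unit_cube (x - k) *\<^sub>R h x)" for k
  proof (rule Bochner_Integration.integrable_bound[OF h])
    have [measurable]: "(\<lambda>x. indicator unit_cube (x - k) :: real) \<in> borel_measurable lebesgue"
      using borel_measurable_lebesgue_plus[OF qm, of "- k"] by simp
    show "(\<lambda>x. indicator unit_cube (x - k) *\<^sub>R h x) \<in> borel_measurable lebesgue"
      by (intro borel_measurable_scaleR borel_measurable_integrable[OF h]) measurable
  qed (auto simp: indicator_def)
  have i1: "integrable lebesgue (\<lambda>x. indicator unit_cube x *\<^sub>R h (x + k))" for k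
    using lebesgue_integrable_translate[OF i0[of k], of k] by simp
  show "integrable lebesgue (\<lambda>x. indicator unit_cube x *\<^sub>R (\<Sum>k\<in>K. h (x + k)))"
    unfolding scaleR_sum_right by (intro Bochner_Integration.integrable_sum i1)
  have "(LINT x|lebesgue. h x) = (LINT x|lebesgue. (\<Sum>k\<in>K. indicator unit_cube (x - k) *\<^sub>R h x))"
    by (subst eq) simp
  also have "\<dots> = (\<Sum>k\<in>K. LINT x|lebesgue. indicator unit_cube (x - k) *\<^sub>R h x)"
    by (rule Bochner_Integration.integral_sum) (rule i0)
  also have "\<dots> = (\<Sum>k\<in>K. LINT x|lebesgue. indicator unit_cube x *\<^sub>R h (x + k))"
  proof (rule sum.cong[OF refl])
    fix k
    show "(LINT x|lebesgue. indicator unit_cube (x - k) *\<^sub>R h x) = (LINT x|lebesgue. indicator unit_cube x *\<^sub>R h (x + k))"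
      using lebesgue_integral_translate[OF borel_measurable_integrable[OF i0[of k]], of k] by simp
  qed
  also have "\<dots> = (LINT x|lebesgue. (\<Sum>k\<in>K. indicator unit_cube x *\<^sub>R h (x + k)))"
    by (rule Bochner_Integration.integral_sum[symmetric]) (rule i1)
  finally show "(LINT x|lebesgue. h x) = (LINT x|lebesgue. indicator unit_cube x *\<^sub>R (\<Sum>k\<in>K. h (x + k)))"
    unfolding scaleR_sum_right .
qed

text \<open>
  The points of \<open>\<Omega>\<close> in the coset of \<open>x\<close>, given by their lattice displacements from \<open>x\<close>.
\<close>

definition fibre :: "(real^'d) set \<Rightarrow> real^'d \<Rightarrow> (real^'d) set" where
  "fibre \<Omega> x = {k \<in> int_lattice. x + k \<in> \<Omega>}"

lemma finite_fibre: "bounded \<Omega> \<Longrightarrow> finite (fibre \<Omega> (x :: real^'d))"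
proof -
  assume "bounded \<Omega>"
  then have "bounded ((+) (- x) ` \<Omega>)" by (rule bounded_translation)
  then have "finite (int_lattice \<inter> (+) (- x) ` \<Omega>)" by (rule finite_lattice_of_bounded)
  moreover have "fibre \<Omega> x \<subseteq> int_lattice \<inter> (+) (- x) ` \<Omega>"
  proof
    fix k assume "k \<in> fibre \<Omega> x"
    then show "k \<in> int_lattice \<inter> (+) (- x) ` \<Omega>"
      by (auto simp: fibre_def intro!: image_eqI[of _ _ "x + k"])
  qed
  ultimately show ?thesis by (rule rev_finite_subset)
qed

text \<open>
  For bounded sets the defining series has finitely many nonzero terms, all equal to 1, and just
  counts the points of a coset.
\<close>

lemma multi_tiles_iff_card_fibre:
  fixes \<Omega> :: "(real^'d) set"
  assumes b: "bounded \<Omega>"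
  shows "multi_tiles l \<Omega> \<longleftrightarrow> (AE x in lebesgue. card (fibre \<Omega> x) = l)"
proof -
  have "((\<lambda>k. indicator \<Omega> (x - k) :: real) has_sum real l) int_lattice \<longleftrightarrow> card (fibre \<Omega> x) = l" for x :: "real^'d"
  proof -
    let ?F = "uminus ` fibre \<Omega> x"
    have sub: "?F \<subseteq> int_lattice" by (auto simp: fibre_def int_lattice_uminus)
    have mem: "k \<in> ?F \<longleftrightarrow> x - k \<in> \<Omega>" if "k \<in> int_lattice" for k
    proof
      assume "x - k \<in> \<Omega>"
      then have "- k \<in> fibre \<Omega> x" using that by (simp add: fibre_def int_lattice_uminus)
      then show "k \<in> ?F" by (intro image_eqI[of _ _ "- k"]) auto
    qed (auto simp: fibre_def)
    have "((\<lambda>k. indicator \<Omega> (x - k) :: real) has_sum (\<Sum>k\<in>?F. indicator \<Omega> (x - k))) ?F"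
      by (rule has_sum_finite) (simp add: finite_fibre[OF b])
    then have "((\<lambda>k. indicator \<Omega> (x - k) :: real) has_sum (\<Sum>k\<in>?F. indicator \<Omega> (x - k))) int_lattice"
      by (rule has_sum_cong_neutral[THEN iffD1, rotated -1]) (use sub mem in \<open>auto simp: indicator_def\<close>)
    moreover have "(\<Sum>k\<in>?F. indicator \<Omega> (x - k) :: real) = card (fibre \<Omega> x)"
    proof -
      have "(\<Sum>k\<in>?F. indicator \<Omega> (x - k) :: real) = (\<Sum>k\<in>?F. 1)"
        using sub mem by (intro sum.cong) (auto simp: indicator_def subset_iff)
      also have "\<dots> = card ?F" by simp
      also have "card ?F = card (fibre \<Omega> x)" by (rule card_image) (simp add: inj_on_def)
      finally show ?thesis .
    qed
    ultimately have hs: "((\<lambda>k. indicator \<Omega> (x - k) :: real) has_sum real (card (fibre \<Omega> x))) int_lattice"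
      by simp
    show ?thesis using hs has_sum_unique[OF hs] by (metis of_nat_eq_iff)
  qed
  then show ?thesis unfolding multi_tiles_def by simp
qed

text \<open>
  Counting predecessors numbers a finite totally ordered set consecutively from 0.
\<close>

lemma strict_total_order_rank_bij:
  assumes P: "finite P" and irr: "\<And>x. x \<in> P \<Longrightarrow> \<not> lt x x"
    and tr: "\<And>x y z. x \<in> P \<Longrightarrow> y \<in> P \<Longrightarrow> z \<in> P \<Longrightarrow> lt x y \<Longrightarrow> lt y z \<Longrightarrow> lt x z"
    and tot: "\<And>x y. x \<in> P \<Longrightarrow> y \<in> P \<Longrightarrow> x \<noteq> y \<Longrightarrow> lt x y \<or> lt y x"
  shows "bij_betw (\<lambda>x. card {y \<in> P. lt y x}) P {..<card P}"
    and "\<And>x y. x \<in> P \<Longrightarrow> y \<in> P \<Longrightarrow> lt x y \<Longrightarrow> card {z \<in> P. lt z x} < card {z \<in> P. lt z y}"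
proof -
  let ?r = "\<lambda>x. card {y \<in> P. lt y x}"
  show mono: "?r x < ?r y" if "x \<in> P" "y \<in> P" "lt x y" for x y
  proof (rule psubset_card_mono)
    show "finite {z \<in> P. lt z y}" using P by simp
    show "{z \<in> P. lt z x} \<subset> {z \<in> P. lt z y}" using that irr tr by blast
  qed
  have inj: "inj_on ?r P"
  proof (rule inj_onI)
    fix x y assume "x \<in> P" "y \<in> P" "?r x = ?r y"
    then show "x = y" using mono[of x y] mono[of y x] tot[of x y] by force
  qed
  have "?r ` P \<subseteq> {..<card P}"
  proof clarsimp
    fix x assume "x \<in> P"
    then have "{y \<in> P. lt y x} \<subset> P" using irr by blast
    then show "?r x < card P" using P by (simp add: psubset_card_mono)
  qed
  moreover have "card (?r ` P) = card {..<card P}" using card_image[OF inj] by simp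
  ultimately have "?r ` P = {..<card P}" by (simp add: card_subset_eq)
  then show "bij_betw ?r P {..<card P}" using inj by (simp add: bij_betw_def)
qed

text \<open>
  An integer that tells apart the points of a coset; it is constant on translates of the unit cube,
  hence measurable.
\<close>

definition lattice_index :: "real^'d \<Rightarrow> nat" where
  "lattice_index x = to_nat_on int_lattice (nearest_lattice x)"

text \<open>
  Larger values of \<open>H\<close> come first. The index breaks ties, which makes the order total on each coset
  while keeping every set defined from it measurable.
\<close>

definition precedes :: "(real^'d \<Rightarrow> real) \<Rightarrow> real^'d \<Rightarrow> real^'d \<Rightarrow> bool" where
  "precedes H x y \<longleftrightarrow> H y < H x \<or> (H x = H y \<and> lattice_index x < lattice_index y)"

definition fibre_rank :: "(real^'d \<Rightarrow> real) \<Rightarrow> (real^'d) set \<Rightarrow> real^'d \<Rightarrow> nat" where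
  "fibre_rank H A x = card {k \<in> fibre A x. precedes H (x + k) x}"

lemma countable_int_lattice: "countable (int_lattice :: (real^'d) set)"
proof -
  have "int_lattice = (\<Union>n::nat. int_lattice \<inter> cball (0 :: real^'d) (real n))"
  proof (intro equalityI subsetI)
    fix k :: "real^'d" assume "k \<in> int_lattice"
    moreover obtain n where "norm k \<le> real n" using real_arch_simple by blast
    ultimately show "k \<in> (\<Union>n::nat. int_lattice \<inter> cball (0 :: real^'d) (real n))"
      by (intro UN_I[of n]) auto
  qed auto
  moreover have "countable (\<Union>n::nat. int_lattice \<inter> cball (0 :: real^'d) (real n))"
    by (rule countable_UN, rule countableI_type, rule countable_finite, rule finite_int_lattice_cball)
  ultimately show ?thesis by simp
qed

lemma lattice_index_eq_iff:
  "k \<in> int_lattice \<Longrightarrow> j \<in> int_lattice \<Longrightarrow> lattice_index (x + k) = lattice_index (x + j) \<longleftrightarrow> k = j"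
  unfolding lattice_index_def nearest_lattice_add
  by (subst inj_on_eq_iff[OF inj_on_to_nat_on[OF countable_int_lattice]]) (auto simp: int_lattice_add)

lemma fibre_shift: "k \<in> int_lattice \<Longrightarrow> fibre A (x + k) = (\<lambda>j. j - k) ` fibre A x"
proof (intro equalityI subsetI)
  fix j assume k: "k \<in> int_lattice" and "j \<in> fibre A (x + k)"
  then have "j + k \<in> fibre A x" by (simp add: fibre_def int_lattice_add add_ac)
  then show "j \<in> (\<lambda>j. j - k) ` fibre A x" by (intro image_eqI[of _ _ "j + k"]) auto
qed (auto simp: fibre_def int_lattice_diff)

lemma fibre_rank_shift:
  assumes k: "k \<in> int_lattice"
  shows "fibre_rank H A (x + k) = card {j \<in> fibre A x. precedes H (x + j) (x + k)}"
proof -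
  have "{j \<in> fibre A (x + k). precedes H (x + k + j) (x + k)}
      = (\<lambda>j. j - k) ` {j \<in> fibre A x. precedes H (x + j) (x + k)}"
    unfolding fibre_shift[OF k] by auto
  then show ?thesis
    unfolding fibre_rank_def by (simp add: card_image inj_on_def)
qed

lemma fibre_rank_bij:
  assumes A: "bounded A"
  shows "bij_betw (\<lambda>k. fibre_rank H A (x + k)) (fibre A x) {..<card (fibre A x)}"
    and "\<And>j k. j \<in> fibre A x \<Longrightarrow> k \<in> fibre A x \<Longrightarrow> precedes H (x + j) (x + k) \<Longrightarrow>
      fibre_rank H A (x + j) < fibre_rank H A (x + k)"
proof -
  let ?lt = "\<lambda>j k. precedes H (x + j) (x + k)"
  have L: "k \<in> int_lattice" if "k \<in> fibre A x" for k using that by (simp add: fibre_def)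
  have 1: "\<not> ?lt k k" for k by (simp add: precedes_def)
  have 2: "?lt i k" if "?lt i j" "?lt j k" for i j k using that by (auto simp: precedes_def)
  have 3: "?lt j k \<or> ?lt k j" if "j \<in> fibre A x" "k \<in> fibre A x" "j \<noteq> k" for j k
    using lattice_index_eq_iff[OF L[OF that(1)] L[OF that(2)], of x] that(3) by (auto simp: precedes_def)
  have R1: "bij_betw (\<lambda>k. card {j \<in> fibre A x. ?lt j k}) (fibre A x) {..<card (fibre A x)}"
    using strict_total_order_rank_bij(1)[of "fibre A x" ?lt] finite_fibre[OF A] 1 2 3 by blast
  have eq: "fibre_rank H A (x + k) = card {j \<in> fibre A x. ?lt j k}" if "k \<in> fibre A x" for k
    by (rule fibre_rank_shift[OF L[OF that]])
  show "bij_betw (\<lambda>k. fibre_rank H A (x + k)) (fibre A x) {..<card (fibre A x)}"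
    using R1 bij_betw_cong[of "fibre A x" "\<lambda>k. fibre_rank H A (x + k)"
        "\<lambda>k. card {j \<in> fibre A x. ?lt j k}" "{..<card (fibre A x)}", OF eq] by blast
  show "fibre_rank H A (x + j) < fibre_rank H A (x + k)"
    if "j \<in> fibre A x" "k \<in> fibre A x" "?lt j k" for j k
    unfolding eq[OF that(1)] eq[OF that(2)]
    using strict_total_order_rank_bij(2)[of "fibre A x" ?lt j k] finite_fibre[OF A] 1 2 3 that by blast
qed

text \<open>
  Ranks number the points of \<open>A\<close> in a coset consecutively, so selecting by rank selects a known number
  of points: one for a single rank, \<open>l\<close> for the ranks below \<open>l\<close>. Both uses matter, the first for
  cutting a multi-tile into tiles and the second for building the optimal one.
\<close>

lemma card_fibre_rank_set:
  assumes A: "bounded A"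
  shows "card (fibre {y \<in> A. fibre_rank H A y \<in> J} x) = card (J \<inter> {..<card (fibre A x)})"
proof -
  let ?r = "\<lambda>k. fibre_rank H A (x + k)"
  have bij: "bij_betw ?r (fibre A x) {..<card (fibre A x)}" by (rule fibre_rank_bij(1)[OF A])
  have sub: "fibre {y \<in> A. fibre_rank H A y \<in> J} x = {k \<in> fibre A x. ?r k \<in> J}"
    by (auto simp: fibre_def)
  have "?r ` {k \<in> fibre A x. ?r k \<in> J} = J \<inter> ?r ` fibre A x" by auto
  also have "\<dots> = J \<inter> {..<card (fibre A x)}" using bij by (simp add: bij_betw_def)
  finally have "card (J \<inter> {..<card (fibre A x)}) = card (?r ` {k \<in> fibre A x. ?r k \<in> J})" by simp
  also have "\<dots> = card {k \<in> fibre A x. ?r k \<in> J}"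
    by (rule card_image, rule inj_on_subset[OF bij_betw_imp_inj_on[OF bij]]) blast
  finally show ?thesis unfolding sub ..
qed

lemma lattice_index_measurable: "lattice_index \<in> lebesgue \<rightarrow>\<^sub>M count_space UNIV"
proof (subst measurable_count_space_eq2_countable, safe)
  fix n :: nat
  let ?P = "{p \<in> int_lattice. to_nat_on int_lattice p = n}"
  have eq: "lattice_index -` {n} \<inter> space lebesgue = (\<Union>p\<in>?P. {x. x - p \<in> unit_cube})"
    by (auto simp: lattice_index_def nearest_lattice_iff[symmetric])
  have "{x. x - p \<in> unit_cube} \<in> sets (lebesgue :: (real^'a) measure)" for p
  proof -
    have "{x. x - p \<in> unit_cube} = (\<lambda>x. p + x) ` unit_cube"
      by (auto intro!: image_eqI[of _ _ "_ - p"])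
    then show ?thesis using lebesgue_sets_translation[OF unit_cube_lebesgue] by simp
  qed
  moreover have "countable ?P" by (rule countable_subset[OF _ countable_int_lattice]) auto
  ultimately show "lattice_index -` {n} \<inter> space (lebesgue :: (real^'a) measure) \<in> sets lebesgue"
    unfolding eq by (intro sets.countable_UN') blast+
qed auto

text \<open>
  For points of the bounded set \<open>A\<close> only finitely many displacements, the same for all points, can
  contribute to the rank, so the rank is a finite sum of measurable indicators.
\<close>

lemma measurable_fibre_rank_set:
  assumes A: "bounded A" "A \<in> sets lebesgue" and H: "H \<in> borel_measurable lebesgue"
  shows "{x \<in> A. fibre_rank H A x \<in> J} \<in> sets lebesgue"
proof -
  obtain R where R: "\<And>x. x \<in> A \<Longrightarrow> norm x \<le> R" using A(1) bounded_iff by metis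
  let ?K = "int_lattice \<inter> cball 0 (R + R)"
  define r where "r x = (\<Sum>k\<in>?K. if x + k \<in> A \<and> precedes H (x + k) x then 1 else (0::nat))" for x
  have "fibre_rank H A x = r x" if x: "x \<in> A" for x
  proof -
    have "norm k \<le> R + R" if "x + k \<in> A" for k
      using norm_triangle_ineq4[of "x + k" x] R[OF x] R[OF that] by simp
    then have "{k \<in> fibre A x. precedes H (x + k) x} = {k \<in> ?K. x + k \<in> A \<and> precedes H (x + k) x}"
      by (auto simp: fibre_def)
    then have "fibre_rank H A x = (\<Sum>k | k \<in> ?K \<and> x + k \<in> A \<and> precedes H (x + k) x. 1)"
      unfolding fibre_rank_def by simp
    also have "\<dots> = r x"
      unfolding r_def by (rule sum.inter_filter) (rule finite_int_lattice_cball)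
    finally show ?thesis .
  qed
  then have "{x \<in> A. fibre_rank H A x \<in> J} = A \<inter> {x \<in> space lebesgue. r x \<in> J}" by auto
  moreover have "{x \<in> space lebesgue. r x \<in> J} \<in> sets lebesgue"
  proof -
    note [measurable] = H lattice_index_measurable A(2)
    have [measurable]: "(\<lambda>x. H (x + k)) \<in> borel_measurable lebesgue" for k
      by (rule borel_measurable_lebesgue_plus[OF H])
    have [measurable]: "(\<lambda>x. x + k) \<in> lebesgue \<rightarrow>\<^sub>M lebesgue" for k
      using measurable_plus_lebesgue[of k] by (simp add: add.commute)
    have real_index: "(\<lambda>x. real (lattice_index x)) \<in> borel_measurable lebesgue"
      by (rule measurable_compose[OF lattice_index_measurable]) simp
    have [measurable]: "Measurable.pred lebesgue (\<lambda>x. lattice_index (x + k) < lattice_index x)" for k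
      using borel_measurable_less[OF borel_measurable_lebesgue_plus[OF real_index, of k] real_index]
      by (simp add: pred_def)
    have [measurable]: "r \<in> lebesgue \<rightarrow>\<^sub>M count_space UNIV"
      unfolding r_def precedes_def by measurable
    show ?thesis by measurable
  qed
  ultimately show ?thesis using A(2) by simp
qed

section \<open>Riesz bases of Paley-Wiener spaces\<close>

text \<open>
  Orthogonal vectors of equal norm satisfy the Riesz bounds with equality.
\<close>

lemma L2_norm_orthogonal_sum:
  assumes F: "finite F" and e: "\<And>i. i \<in> F \<Longrightarrow> e i \<in> L2_space"
    and orth: "\<And>i j. i \<in> F \<Longrightarrow> j \<in> F \<Longrightarrow> L2_inner (e i) (e j) = (if i = j then of_real C else 0)"
  shows "(L2_norm (\<lambda>x. \<Sum>i\<in>F. c i * e i x))\<^sup>2 = C * (\<Sum>i\<in>F. (norm (c i))\<^sup>2)"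
proof -
  let ?s = "\<lambda>x. \<Sum>i\<in>F. c i * e i x"
  have s: "?s \<in> L2_space" using e by (intro L2_sum L2_scale)
  have inner: "L2_inner ?s (e j) = c j * of_real C" if j: "j \<in> F" for j
  proof -
    have "L2_inner (e j) ?s = (\<Sum>i\<in>F. cnj (c i) * L2_inner (e j) (e i))"
      by (rule L2_inner_sum_right[OF e[OF j] e])
    also have "\<dots> = (\<Sum>i\<in>F. if i = j then cnj (c j) * of_real C else 0)"
      using orth j by (intro sum.cong) auto
    also have "\<dots> = cnj (c j) * of_real C" using F j by simp
    finally have "L2_inner ?s (e j) = cnj (cnj (c j) * of_real C)"
      by (subst L2_inner_cnj[symmetric]) simp
    then show ?thesis by simp
  qed
  have "complex_of_real ((L2_norm ?s)\<^sup>2) = (\<Sum>j\<in>F. cnj (c j) * L2_inner ?s (e j))"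
    unfolding L2_inner_self[symmetric] by (rule L2_inner_sum_right[OF s e])
  also have "\<dots> = (\<Sum>j\<in>F. of_real (C * (norm (c j))\<^sup>2))"
  proof (rule sum.cong[OF refl])
    fix j assume j: "j \<in> F"
    show "cnj (c j) * L2_inner ?s (e j) = of_real (C * (norm (c j))\<^sup>2)"
      unfolding inner[OF j] of_real_mult complex_norm_square by (simp add: mult_ac)
  qed
  also have "\<dots> = of_real (C * (\<Sum>i\<in>F. (norm (c i))\<^sup>2))"
    by (simp add: sum_distrib_left)
  finally show ?thesis unfolding of_real_eq_iff .
qed

lemma wave_int_lattice:
  assumes "k \<in> int_lattice" "j \<in> int_lattice" shows "wave k j = 1"
proof -
  have "k \<bullet> j \<in> \<int>"
    unfolding inner_vec_def using assms by (auto simp: int_lattice_def intro!: Ints_sum Ints_mult)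
  then obtain n :: int where "k \<bullet> j = of_int n" by (auto simp: Ints_def)
  then show ?thesis by (simp add: wave_cis cis_multiple_2pi)
qed

lemma integrable_indicator_bounded:
  assumes S: "bounded S" "S \<in> sets lebesgue" and g: "g \<in> borel_measurable lebesgue"
    and le: "\<And>x. norm (g x :: complex) \<le> 1"
  shows "integrable lebesgue (\<lambda>x. indicator S x * g x)"
proof (rule Bochner_Integration.integrable_bound)
  have "S \<in> lmeasurable" by (rule bounded_set_imp_lmeasurable[OF S])
  then show "integrable lebesgue (indicator S :: _ \<Rightarrow> real)"
    by (simp only: fmeasurable_def mem_Collect_eq)
      (intro integrable_real_indicator, auto simp: infinity_ennreal_def)
  show "(\<lambda>x. indicator S x * g x) \<in> borel_measurable lebesgue" using S(2) g by measurable
qed (use le in \<open>auto simp: indicator_def\<close>)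

lemma L2_indicator_bounded:
  assumes S: "bounded S" "S \<in> sets lebesgue" shows "indicator S \<in> L2_space"
proof (rule L2I)
  show "indicator S \<in> borel_measurable lebesgue" using S(2) by measurable
  have "integrable lebesgue (\<lambda>x. norm (indicator S x * 1 :: complex))"
    by (intro integrable_norm integrable_indicator_bounded S) auto
  moreover have "norm (indicator S x * 1 :: complex) = (norm (indicator S x :: complex))\<^sup>2" for x
    by (simp add: indicator_def)
  ultimately show "integrable lebesgue (\<lambda>x. (norm (indicator S x :: complex))\<^sup>2)" by simp
qed

lemma fibre_subset_nearest_lattice:
  "x \<in> unit_cube \<Longrightarrow> S \<subseteq> B \<Longrightarrow> fibre S x = {k \<in> nearest_lattice ` B. x + k \<in> S}"
  using nearest_lattice_add[of _ x] nearest_lattice_unit_cube[of x]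
  by (auto simp: fibre_def image_iff) (metis add_0 subsetD)

text \<open>
  A wave with lattice frequency is constant on cosets, and a tile meets each coset once; folding
  the integral therefore gives the same value for all tiles.
\<close>

lemma integral_wave_tile:
  assumes S: "bounded S" "S \<in> sets lebesgue" and tile: "AE x in lebesgue. card (fibre S x) = 1"
    and k: "k \<in> int_lattice"
  shows "(LINT x|lebesgue. indicator S x * wave k x) = (LINT x|lebesgue. indicator unit_cube x * wave k x)"
proof -
  let ?K = "nearest_lattice ` S" and ?h = "\<lambda>x. indicator S x * wave k x"
  have hi: "integrable lebesgue ?h" by (rule integrable_indicator_bounded[OF S]) auto
  have K: "finite ?K" "?K \<subseteq> int_lattice" using finite_nearest_lattice_image[OF S(1)] by auto
  have supp: "nearest_lattice x \<in> ?K" if "?h x \<noteq> 0" for x using that by (auto simp: indicator_def split: if_splits)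
  note fold = fold_integral[OF hi K supp]
  have "(LINT x|lebesgue. ?h x) = (LINT x|lebesgue. indicator unit_cube x *\<^sub>R (\<Sum>j\<in>?K. ?h (x + j)))"
    by (rule fold(1))
  also have "\<dots> = (LINT x|lebesgue. indicator unit_cube x * wave k x)"
  proof (rule integral_cong_AE)
    show "AE x in lebesgue. indicator unit_cube x *\<^sub>R (\<Sum>j\<in>?K. ?h (x + j)) = indicator unit_cube x * wave k x"
      using tile
    proof eventually_elim
      case (elim x)
      show ?case
      proof (cases "x \<in> unit_cube")
        case True
        have "(\<Sum>j\<in>?K. ?h (x + j)) = (\<Sum>j\<in>?K. if x + j \<in> S then wave k x else 0)"
          using K(2) by (intro sum.cong) (auto simp: indicator_def wave_add_right wave_int_lattice[OF k])
        also have "\<dots> = (\<Sum>j\<in>fibre S x. wave k x)"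
          unfolding fibre_subset_nearest_lattice[OF True order_refl] by (rule sum.inter_filter[OF K(1), symmetric])
        also have "\<dots> = wave k x" using elim by simp
        finally show ?thesis using True by simp
      qed simp
    qed
  qed (use borel_measurable_integrable[OF fold(2)] in \<open>simp, measurable\<close>)
  finally show ?thesis .
qed

lemma unit_cube_translate_tile: "card (fibre ((+) s ` unit_cube) x) = 1"
proof -
  have "fibre ((+) s ` unit_cube) x = {- nearest_lattice (x - s)}"
  proof (intro equalityI subsetI)
    fix k assume "k \<in> fibre ((+) s ` unit_cube) x"
    then have k: "k \<in> int_lattice" and q: "x - s + k \<in> unit_cube"
      by (auto simp: fibre_def) (metis add_diff_cancel_left' diff_add_eq)
    have "nearest_lattice (x - s) + k = 0"
      using nearest_lattice_unit_cube[OF q] nearest_lattice_add[OF k] by simp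
    then show "k \<in> {- nearest_lattice (x - s)}" by (simp add: eq_neg_iff_add_eq_0 add.commute)
  next
    fix k assume k: "k \<in> {- nearest_lattice (x - s)}"
    have "x - s - nearest_lattice (x - s) \<in> unit_cube"
      using nearest_lattice_iff[of "nearest_lattice (x - s)" "x - s"] by simp
    then show "k \<in> fibre ((+) s ` unit_cube) x"
      using k by (auto simp: fibre_def int_lattice_uminus intro!: image_eqI[of _ _ "x - s - nearest_lattice (x - s)"])
  qed
  then show ?thesis by simp
qed

lemma bounded_unit_cube: "bounded (unit_cube :: (real^'d) set)"
proof (rule bounded_subset[OF bounded_cbox])
  show "unit_cube \<subseteq> cbox (\<chi> i. - (1/2)) (\<chi> i. 1/2)"
    by (auto simp: unit_cube_def mem_box_cart less_imp_le)
qed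

text \<open>
  A translate of the cube is again a tile and thus gives the same integral; a translation by half
  a period of the wave in one coordinate also changes its sign.
\<close>

lemma integral_wave_unit_cube:
  assumes k: "k \<in> int_lattice" "k \<noteq> 0"
  shows "(LINT x|lebesgue. indicator unit_cube x * wave k x) = 0"
proof -
  obtain i where i: "k $ i \<noteq> 0" using k(2) by (auto simp: vec_eq_iff)
  define s where "s = axis i (1 / (2 * k $ i))"
  have ks: "wave k s = -1" using i by (simp add: wave_cis s_def inner_axis)
  let ?Q = "(+) s ` unit_cube"
  have "(LINT x|lebesgue. indicator unit_cube x * wave k x) = (LINT x|lebesgue. indicator ?Q x * wave k x)"
    by (rule integral_wave_tile[symmetric])
      (simp_all add: k bounded_translation bounded_unit_cube lebesgue_sets_translation unit_cube_translate_tile del: One_nat_def)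
  also have "\<dots> = (LINT x|lebesgue. indicator ?Q (x + s) * wave k (x + s))"
    by (rule lebesgue_integral_translate[symmetric])
      (use lebesgue_sets_translation[OF unit_cube_lebesgue, of s] in measurable)
  also have "\<dots> = (LINT x|lebesgue. - (indicator unit_cube x * wave k x))"
    by (rule Bochner_Integration.integral_cong)
      (auto simp: wave_add_right ks indicator_def image_iff add.commute[of _ s])
  also have "\<dots> = - (LINT x|lebesgue. indicator unit_cube x * wave k x)" by simp
  finally show ?thesis by simp
qed

lemma measure_unit_cube_pos: "measure lebesgue (unit_cube :: (real^'d) set) > 0"
proof (rule ccontr)
  assume "\<not> measure lebesgue (unit_cube :: (real^'d) set) > 0"
  then have "measure lebesgue (unit_cube :: (real^'d) set) = 0"
    using measure_nonneg[of lebesgue "unit_cube :: (real^'d) set"] by linarith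
  then have "negligible (unit_cube :: (real^'d) set)"
    using bounded_set_imp_lmeasurable[OF bounded_unit_cube] by (simp add: negligible_iff_measure)
  moreover have "box (\<chi> i. - (1/2)) (\<chi> i. 1/2) \<subseteq> (unit_cube :: (real^'d) set)"
    by (auto simp: unit_cube_def mem_box_cart less_imp_le)
  ultimately have "negligible (box (\<chi> i. - (1/2)) (\<chi> i. 1/2) :: (real^'d) set)"
    by (rule negligible_subset)
  moreover have "(0 :: real^'d) \<in> box (\<chi> i. - (1/2)) (\<chi> i. 1/2)" by (simp add: mem_box_cart)
  ultimately show False using open_not_negligible[OF open_box] by blast
qed

lemma inner_wave_tile:
  fixes S :: "(real^'d) set"
  assumes S: "bounded S" "S \<in> sets lebesgue" and tile: "AE x in lebesgue. card (fibre S x) = 1"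
    and k: "k \<in> int_lattice" and j: "j \<in> int_lattice"
  shows "L2_inner (\<lambda>x. wave (- k) x * indicator S x) (\<lambda>x. wave (- j) x * indicator S x)
    = (if k = j then of_real (measure lebesgue (unit_cube :: (real^'d) set)) else 0)"
proof -
  have "L2_inner (\<lambda>x. wave (- k) x * indicator S x) (\<lambda>x. wave (- j) x * indicator S x)
      = (LINT x|lebesgue. indicator S x * wave (j - k) x)"
    unfolding L2_inner_def
    by (rule Bochner_Integration.integral_cong)
      (auto simp: wave_minus_left wave_diff_left indicator_def mult.commute)
  also have "\<dots> = (LINT x|lebesgue. indicator unit_cube x * wave (j - k) x)"
    by (rule integral_wave_tile[OF S tile int_lattice_diff[OF j k]])
  also have "\<dots> = (if k = j then of_real (measure lebesgue (unit_cube :: (real^'d) set)) else 0)"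
  proof (cases "k = j")
    case True
    have "(LINT x|lebesgue. indicator unit_cube x * wave (j - k) x)
        = (LINT x|lebesgue. complex_of_real (indicator (unit_cube :: (real^'d) set) x))"
      using True by (intro Bochner_Integration.integral_cong refl) (auto simp: indicator_def)
    also have "\<dots> = of_real (LINT x|lebesgue. indicator (unit_cube :: (real^'d) set) x)"
      by (rule integral_complex_of_real)
    finally show ?thesis using True by simp
  qed (use integral_wave_unit_cube[OF int_lattice_diff[OF j k]] in auto)
  finally show ?thesis .
qed

lemma bounded_cube: "bounded (cube N)"
  by (simp add: cube_def)

lemma cube_lebesgue: "cube N \<in> sets lebesgue"
  by (simp add: cube_def)

lemma multi_tile_setsD:
  assumes "\<Omega> \<in> multi_tile_sets l N"
  shows "\<Omega> \<subseteq> cube N" "bounded \<Omega>" "\<Omega> \<in> sets lebesgue" "AE x in lebesgue. card (fibre \<Omega> x) = l"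
proof -
  show 1: "\<Omega> \<subseteq> cube N" "\<Omega> \<in> sets lebesgue" using assms by (auto simp: multi_tile_sets_def)
  show "bounded \<Omega>" by (rule bounded_subset[OF bounded_cube 1(1)])
  then show "AE x in lebesgue. card (fibre \<Omega> x) = l"
    using assms by (simp add: multi_tile_sets_def multi_tiles_iff_card_fibre)
qed

text \<open>
  Rank the points of \<open>\<Omega>\<close> in each coset by the lattice index alone. The points of a given rank form
  a tile, and \<open>\<Omega>\<close> is almost everywhere the disjoint union of \<open>l\<close> such tiles. On each tile the
  waves with lattice frequencies are orthogonal, and they are complete because the periodization of a
  compact subset of a tile meets the tile only in that subset. The generators are the functions whose
  transforms are the indicators of the tiles: their integer translates correspond to these waves.
\<close>

lemma paley_wiener_in_TI_spaces:
  fixes \<Omega> :: "(real^'d) set"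
  assumes b: "bounded \<Omega>" and m: "\<Omega> \<in> sets lebesgue" and card: "AE x in lebesgue. card (fibre \<Omega> x) = l"
  shows "paley_wiener \<Omega> \<in> TI_spaces l"
proof -
  let ?V = "paley_wiener \<Omega>" and ?C = "measure lebesgue (unit_cube :: (real^'d) set)"
  note V = closed_subspace_paley_wiener[OF m]
  \<comment> \<open>Generators are numbered from 1 and ranks from 0.\<close>
  define S where "S j = {x \<in> \<Omega>. fibre_rank (\<lambda>_. 0) \<Omega> x \<in> {j - 1}}" for j :: nat
  have S: "bounded (S j)" "S j \<in> sets lebesgue" "S j \<subseteq> \<Omega>" for j
    unfolding S_def by (rule bounded_subset[OF b], blast, rule measurable_fibre_rank_set[OF b m], simp, blast)
  have S_tile: "AE x in lebesgue. card (fibre (S j) x) = 1" if "j \<in> {1..l}" for j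
    using card
  proof eventually_elim
    case (elim x)
    have "card (fibre (S j) x) = card ({j - 1} \<inter> {..<l})"
      unfolding S_def using card_fibre_rank_set[OF b, of "\<lambda>_. 0" "{j - 1}" x] elim by simp
    also have "{j - 1} \<inter> {..<l} = {j - 1}" using that by auto
    finally show ?case by simp
  qed
  have cover: "AE x in lebesgue. x \<in> \<Omega> \<longrightarrow> (\<exists>j\<in>{1..l}. x \<in> S j)"
    using card
  proof eventually_elim
    case (elim x)
    show ?case
    proof
      assume x: "x \<in> \<Omega>"
      then have "0 \<in> fibre \<Omega> x" by (simp add: fibre_def)
      then have "fibre_rank (\<lambda>_. 0) \<Omega> (x + 0) < l"
        using bij_betwE[OF fibre_rank_bij(1)[OF b, of "\<lambda>_. 0" x]] elim by blast
      then show "\<exists>j\<in>{1..l}. x \<in> S j"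
        using x by (intro bexI[of _ "Suc (fibre_rank (\<lambda>_. 0) \<Omega> x)"]) (auto simp: S_def)
    qed
  qed
  have disj: "i = j" if "x \<in> S i" "x \<in> S j" "i \<in> {1..l}" "j \<in> {1..l}" for x i j
    using that by (auto simp: S_def)
  have "\<forall>j. \<exists>\<phi>. fourier_pair \<phi> (indicator (S j))"
    using fourier_pair_onto[OF L2_indicator_bounded[OF S(1,2)]] by blast
  then obtain \<phi> where \<phi>: "\<And>j. fourier_pair (\<phi> j) (indicator (S j))" by metis
  let ?I = "int_lattice \<times> {1..l} :: ((real^'d) \<times> nat) set"
  define u where "u = (\<lambda>(k, j). translate k (\<phi> j))"
  define e where "e = (\<lambda>(k, j) \<omega>. wave (- k) \<omega> * (indicator (S j) \<omega> :: complex))"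
  have ue: "fourier_pair (u i) (e i)" for i
    unfolding u_def e_def using fourier_pair_translate[OF \<phi>] by (cases i) simp
  have uL: "u i \<in> L2_space" for i by (rule fourier_pairD(1)[OF ue])
  have eL: "e i \<in> L2_space" for i by (rule fourier_pairD(2)[OF ue])
  have orth: "L2_inner (e i) (e i') = (if i = i' then of_real ?C else 0)" if "i \<in> ?I" "i' \<in> ?I" for i i'
  proof -
    obtain k j k' j' where i: "i = (k, j)" "i' = (k', j')" by (cases i, cases i') auto
    show ?thesis
    proof (cases "j = j'")
      case True
      then show ?thesis
        using inner_wave_tile[OF S(1,2) S_tile, of j k k'] that unfolding i e_def by auto
    next
      case False
      have "L2_inner (e i) (e i') = (LINT x|(lebesgue :: (real^'d) measure). 0)"
        unfolding L2_inner_def i e_def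
        by (rule Bochner_Integration.integral_cong) (use that disj False i in \<open>auto simp: indicator_def\<close>)
      then show ?thesis using False i by simp
    qed
  qed
  have riesz_eq: "(L2_norm (\<lambda>x. \<Sum>i\<in>F. c i * u i x))\<^sup>2 = ?C * (\<Sum>i\<in>F. (norm (c i))\<^sup>2)"
    if F: "finite F" "F \<subseteq> ?I" for F c
  proof -
    have "fourier_pair (\<lambda>x. \<Sum>i\<in>F. c i * u i x) (\<lambda>x. \<Sum>i\<in>F. c i * e i x)"
      by (intro fourier_pair_sum fourier_pair_scale ue)
    from fourier_pair_norm[OF this]
    have "(L2_norm (\<lambda>x. \<Sum>i\<in>F. c i * u i x))\<^sup>2 = (L2_norm (\<lambda>x. \<Sum>i\<in>F. c i * e i x))\<^sup>2"
      by (simp only:)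
    also have "\<dots> = ?C * (\<Sum>i\<in>F. (norm (c i))\<^sup>2)"
      by (rule L2_norm_orthogonal_sum[OF F(1) eL orth]) (use F(2) in blast)+
    finally show ?thesis .
  qed
  have X: "u ` ?I \<subseteq> L2_space" using uL by auto
  note span = closed_subspace_closed_span[OF X]
  have sub1: "closed_span (u ` ?I) \<subseteq> ?V"
  proof (rule closed_span_minimal[OF V], safe)
    fix k j assume "j \<in> {1..l}"
    show "u (k, j) \<in> ?V"
      unfolding paley_wiener_iff[OF ue] e_def using S(3)[of j] by (auto simp: indicator_def intro!: AE_I2)
  qed
  have sub2: "?V \<subseteq> closed_span (u ` ?I)"
  proof
    let ?W = "{h. \<exists>f\<in>closed_span (u ` ?I). fourier_pair f h}"
    have W: "closed_subspace ?W" by (rule closed_subspace_fourier_image[OF span])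
    have piece: "g \<in> ?W" if j: "j \<in> {1..l}" and g: "g \<in> L2_space"
      and z: "AE x in lebesgue. (indicator (S j) x :: complex) = 0 \<longrightarrow> g x = 0" for g j
    proof (rule weighted_density[OF W L2_indicator_bounded[OF S(1,2), of j] _ g z])
      fix K :: "(real^'d) set"
      assume K: "compact K" and "\<forall>x\<in>K. (indicator (S j) x :: complex) \<noteq> 0"
      then have KS: "K \<subseteq> S j" by (auto simp: indicator_def split: if_splits)
      have basis: "(\<lambda>x. wave k ((1/1) *\<^sub>R x) * indicator (S j) x) \<in> ?W" if "k \<in> int_lattice" for k
      proof -
        have "u (- k, j) \<in> closed_span (u ` ?I)"
          using that j by (intro closed_span_superset[OF X] imageI) (simp add: int_lattice_uminus)
        moreover have "e (- k, j) = (\<lambda>x. wave k ((1/1) *\<^sub>R x) * indicator (S j) x)" by (simp add: e_def)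
        ultimately show ?thesis using ue[of "(- k, j)"] by auto
      qed
      have P: "(\<lambda>x. indicator {x. \<exists>k\<in>int_lattice. x + 1 *\<^sub>R k \<in> K} x * indicator (S j) x) \<in> ?W"
        by (rule periodized_compact_indicator[OF W L2_indicator_bounded[OF S(1,2)] zero_less_one basis K])
      show "(\<lambda>x. indicator K x * indicator (S j) x) \<in> ?W"
      proof (rule closed_subspace_AE[OF W P])
        have [measurable]: "K \<in> sets lebesgue" using K by (intro borel_in_lebesgue borel_compact)
        show "(\<lambda>x. indicator K x * indicator (S j) x :: complex) \<in> borel_measurable lebesgue"
          using S(2)[of j] by measurable
        show "AE x in lebesgue. (indicator K x * indicator (S j) x :: complex)
            = indicator {x. \<exists>k\<in>int_lattice. x + 1 *\<^sub>R k \<in> K} x * indicator (S j) x"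
          using S_tile[OF j]
        proof eventually_elim
          case (elim x)
          have "x \<in> K" if x: "x \<in> S j" and k: "k \<in> int_lattice" "x + k \<in> K" for k
          proof -
            obtain z where z: "fibre (S j) x = {z}" using elim by (auto simp: card_1_singleton_iff)
            have "0 \<in> fibre (S j) x" "k \<in> fibre (S j) x" using x k KS by (auto simp: fibre_def)
            then have "k = 0" using z by auto
            then show "x \<in> K" using k by simp
          qed
          moreover have "\<exists>k\<in>int_lattice. x + k \<in> K" if "x \<in> K"
            using that by (intro bexI[of _ 0]) simp_all
          ultimately show ?case by (auto simp: indicator_def)
        qed
      qed
    qed
    fix f assume "f \<in> ?V"
    then obtain h where h: "fourier_pair f h" "AE \<omega> in lebesgue. \<omega> \<notin> \<Omega> \<longrightarrow> h \<omega> = 0"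
      using paley_wienerD by blast
    note hL = fourier_pairD(2)[OF h(1)]
    have "(\<lambda>x. \<Sum>j\<in>{1..l}. indicator (S j) x * h x) \<in> ?W"
    proof (rule closed_subspace_sum[OF W], rule piece)
      fix j
      show "(\<lambda>x. indicator (S j) x * h x) \<in> L2_space" by (rule L2_indicator[OF hL S(2)])
    qed auto
    moreover have "AE x in lebesgue. h x = (\<Sum>j\<in>{1..l}. indicator (S j) x * h x)"
      using cover h(2)
    proof eventually_elim
      case (elim x)
      show ?case
      proof (cases "x \<in> \<Omega>")
        case True
        then obtain i where i: "i \<in> {1..l}" "x \<in> S i" using elim by blast
        have "(\<Sum>j\<in>{1..l}. indicator (S j) x * h x) = (\<Sum>j\<in>{1..l}. if j = i then h x else 0)"
          using i disj by (intro sum.cong) (auto simp: indicator_def)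
        then show ?thesis using i(1) by simp
      qed (use elim in simp)
    qed
    ultimately have "h \<in> ?W" by (intro closed_subspace_AE[OF W _ L2_measurable[OF hL]])
    then show "f \<in> closed_span (u ` ?I)"
      by (intro mem_closed_subspace_of_fourier_pair[OF span h(1)]) blast
  qed
  have span_eq: "closed_span (u ` ?I) = ?V" using sub1 sub2 by auto
  have range: "u ` ?I = {translate k (\<phi> j) | k j. k \<in> int_lattice \<and> j \<in> {1..l}}"
    unfolding u_def by (auto simp: image_iff) blast+
  have C: "?C > 0" by (rule measure_unit_cube_pos)
  have "riesz_basis ?V ?I u"
    unfolding riesz_basis_def using X span_eq riesz_eq C by (auto intro!: exI[of _ ?C])
  moreover have "?V = shift_space l \<phi>" unfolding shift_space_def range[symmetric] span_eq ..
  ultimately show ?thesis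
    unfolding TI_spaces_def u_def
    using translation_invariant_paley_wiener[of \<Omega>] fourier_pairD(1)[OF \<phi>] by blast
qed

section \<open>The optimal multi-tile\<close>

text \<open>
  The representative of the coset in the unit cube and its translates by \<open>0, \<dots>, N\<close> along one
  coordinate axis all lie in the cube.
\<close>

lemma card_fibre_cube: "Suc N \<le> card (fibre (cube N) (x :: real^'d))"
proof -
  obtain i :: 'd where True by simp
  define k where "k n = real n *\<^sub>R axis i 1 - nearest_lattice x" for n
  have inj: "inj_on k {..N}"
    by (auto simp: inj_on_def k_def axis_def vec_eq_iff)
  have "x + k n \<in> cube N" if "n \<le> N" for n
  proof -
    have "x - nearest_lattice x \<in> unit_cube" using nearest_lattice_iff[of "nearest_lattice x" x] by simp
    then have r: "- 1/2 \<le> (x - nearest_lattice x) $ a \<and> (x - nearest_lattice x) $ a < 1/2" for a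
      unfolding unit_cube_def by blast
    have "(x + k n) $ a = (x - nearest_lattice x) $ a + (if a = i then real n else 0)" for a
      by (simp add: k_def axis_def)
    then have "- (real N + 1/2) \<le> (x + k n) $ a \<and> (x + k n) $ a \<le> real N + 1/2" for a
      using r[of a] that by (auto split: if_splits)
    then show ?thesis unfolding cube_def mem_box_cart by simp
  qed
  moreover have "k n \<in> int_lattice" for n
    unfolding k_def by (intro int_lattice_diff nearest_lattice_in) (simp add: int_lattice_def axis_def)
  ultimately have "k ` {..N} \<subseteq> fibre (cube N) x" by (auto simp: fibre_def)
  then have "card (k ` {..N}) \<le> card (fibre (cube N) x)" by (rule card_mono[OF finite_fibre[OF bounded_cube]])
  then show ?thesis by (simp add: card_image[OF inj])
qed

text \<open>
  The elements not shared by the two sets can be matched one to one.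
\<close>

lemma sum_le_sum_top:
  fixes H :: "'a \<Rightarrow> real"
  assumes fin: "finite S" "finite T" and card: "card S = card T"
    and le: "\<And>s t. s \<in> S - T \<Longrightarrow> t \<in> T - S \<Longrightarrow> H s \<le> H t"
  shows "sum H S \<le> sum H T"
proof -
  have "card (S - T) = card (T - S)"
    using card fin card_Diff_subset_Int[of S T] card_Diff_subset_Int[of T S] by (simp add: Int_commute)
  then obtain p where p: "bij_betw p (S - T) (T - S)"
    using fin by (metis finite_Diff finite_same_card_bij)
  have "sum H (S - T) \<le> (\<Sum>s\<in>S - T. H (p s))"
    by (rule sum_mono, rule le) (use p in \<open>auto simp: bij_betw_def\<close>)
  also have "\<dots> = sum H (T - S)" by (rule sum.reindex_bij_betw[OF p])
  finally have "sum H (S - T) \<le> sum H (T - S)" .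
  moreover have "sum H S = sum H (S - T) + sum H (S \<inter> T)"
    using sum.Int_Diff[OF fin(1), of H T] by simp
  moreover have "sum H T = sum H (T - S) + sum H (S \<inter> T)"
    using sum.Int_Diff[OF fin(2), of H S] by (simp add: Int_commute)
  ultimately show ?thesis by simp
qed

text \<open>
  In each coset, the \<open>l\<close> points of the cube with the largest values of \<open>H\<close>.
\<close>

definition top_tiles :: "nat \<Rightarrow> nat \<Rightarrow> (real^'d \<Rightarrow> real) \<Rightarrow> (real^'d) set" where
  "top_tiles l N H = {x \<in> cube N. fibre_rank H (cube N) x \<in> {..<l}}"

lemma top_tiles_multi_tile:
  assumes H: "H \<in> borel_measurable lebesgue" and N: "l \<le> N"
  shows "top_tiles l N H \<in> multi_tile_sets l N"
proof -
  have sub: "top_tiles l N H \<subseteq> cube N" by (auto simp: top_tiles_def)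
  have "card (fibre (top_tiles l N H) x) = l" for x
  proof -
    have "card (fibre (top_tiles l N H) x) = card ({..<l} \<inter> {..<card (fibre (cube N) x)})"
      unfolding top_tiles_def by (rule card_fibre_rank_set[OF bounded_cube])
    also have "{..<l} \<inter> {..<card (fibre (cube N) x)} = {..<l}"
      using card_fibre_cube[of N x] N by auto
    finally show ?thesis by simp
  qed
  then have "multi_tiles l (top_tiles l N H)"
    by (simp add: multi_tiles_iff_card_fibre[OF bounded_subset[OF bounded_cube sub]])
  then show ?thesis
    using sub measurable_fibre_rank_set[OF bounded_cube cube_lebesgue H, of N "{..<l}", folded top_tiles_def]
    by (simp add: multi_tile_sets_def)
qed

text \<open>
  After folding to the unit cube the two integrals are compared coset by coset. Each side sums \<open>H\<close>
  over \<open>l\<close> points of the coset inside the cube, and the points on the right have the largest values.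
\<close>

lemma top_tiles_optimal:
  assumes H: "integrable lebesgue H" and N: "l \<le> N" and \<Omega>: "\<Omega> \<in> multi_tile_sets l N"
  shows "(LINT x|lebesgue. indicator \<Omega> x * H x) \<le> (LINT x|lebesgue. indicator (top_tiles l N H) x * H x)"
proof -
  note Hm = borel_measurable_integrable[OF H]
  let ?T = "top_tiles l N H" and ?K = "nearest_lattice ` (cube N :: (real^'a) set)"
  have T: "?T \<in> multi_tile_sets l N" by (rule top_tiles_multi_tile[OF Hm N])
  have K: "finite ?K" "?K \<subseteq> int_lattice" using finite_nearest_lattice_image[OF bounded_cube] by auto
  have int: "integrable lebesgue (\<lambda>x. indicator B x * H x)" if "B \<in> multi_tile_sets l N" for B
    using integrable_real_mult_indicator[OF multi_tile_setsD(3)[OF that] H] by (simp add: mult.commute)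
  have supp: "nearest_lattice x \<in> ?K" if "B \<in> multi_tile_sets l N" "indicator B x * H x \<noteq> 0" for B x
    using that multi_tile_setsD(1)[OF that(1)] by (auto simp: indicator_def split: if_splits)
  have fold: "(LINT x|lebesgue. indicator B x * H x)
      = (LINT x|lebesgue. indicator unit_cube x *\<^sub>R (\<Sum>k\<in>?K. indicator B (x + k) * H (x + k)))"
    "integrable lebesgue (\<lambda>x. indicator unit_cube x *\<^sub>R (\<Sum>k\<in>?K. indicator B (x + k) * H (x + k)))"
    if "B \<in> multi_tile_sets l N" for B
    by (rule fold_integral[OF int[OF that] K supp[OF that]], assumption)+
  have fib: "(\<Sum>k\<in>?K. indicator B (x + k) * H (x + k)) = (\<Sum>k\<in>fibre B x. H (x + k))"
    if B: "B \<in> multi_tile_sets l N" and x: "x \<in> unit_cube" for B x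
  proof -
    have "(\<Sum>k\<in>?K. indicator B (x + k) * H (x + k)) = (\<Sum>k\<in>?K. if x + k \<in> B then H (x + k) else 0)"
      by (intro sum.cong) (auto simp: indicator_def)
    then show ?thesis
      unfolding fibre_subset_nearest_lattice[OF x multi_tile_setsD(1)[OF B]]
      by (simp only: sum.inter_filter[OF K(1)])
  qed
  have "(LINT x|lebesgue. indicator unit_cube x *\<^sub>R (\<Sum>k\<in>?K. indicator \<Omega> (x + k) * H (x + k)))
      \<le> (LINT x|lebesgue. indicator unit_cube x *\<^sub>R (\<Sum>k\<in>?K. indicator ?T (x + k) * H (x + k)))"
  proof (rule integral_mono_AE)
    show "AE x in lebesgue. indicator unit_cube x *\<^sub>R (\<Sum>k\<in>?K. indicator \<Omega> (x + k) * H (x + k))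
        \<le> indicator unit_cube x *\<^sub>R (\<Sum>k\<in>?K. indicator ?T (x + k) * H (x + k))"
      using multi_tile_setsD(4)[OF \<Omega>] multi_tile_setsD(4)[OF T]
    proof eventually_elim
      case (elim x)
      show ?case
      proof (cases "x \<in> unit_cube")
        case True
        have "(\<Sum>k\<in>fibre \<Omega> x. H (x + k)) \<le> (\<Sum>k\<in>fibre ?T x. H (x + k))"
        proof (rule sum_le_sum_top)
          show "finite (fibre \<Omega> x)" "finite (fibre ?T x)"
            using finite_fibre multi_tile_setsD(2) \<Omega> T by blast+
          show "card (fibre \<Omega> x) = card (fibre ?T x)" using elim by simp
          fix s t assume s: "s \<in> fibre \<Omega> x - fibre ?T x" and t: "t \<in> fibre ?T x - fibre \<Omega> x"
          have sC: "s \<in> fibre (cube N) x" and tC: "t \<in> fibre (cube N) x"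
            using s t multi_tile_setsD(1)[OF \<Omega>] by (auto simp: fibre_def top_tiles_def)
          have "fibre_rank H (cube N) (x + t) < l" using t by (auto simp: fibre_def top_tiles_def)
          also have "l \<le> fibre_rank H (cube N) (x + s)" using s sC by (auto simp: fibre_def top_tiles_def)
          \<comment> \<open>A point that precedes another has the smaller rank.\<close>
          finally have "\<not> precedes H (x + s) (x + t)"
            using fibre_rank_bij(2)[OF bounded_cube sC tC, of H] by auto
          then show "H (x + s) \<le> H (x + t)" by (auto simp: precedes_def)
        qed
        then show ?thesis using True by (simp add: fib \<Omega> T)
      qed simp
    qed
  qed (rule fold(2)[OF \<Omega>], rule fold(2)[OF T])
  then show ?thesis unfolding fold(1)[OF \<Omega>] fold(1)[OF T] .
qed

theorem theorem4p4:
  fixes f :: "nat \<Rightarrow> real^'d \<Rightarrow> complex" and m l N :: nat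
  assumes "\<And>j. j \<in> {1..m} \<Longrightarrow> f j \<in> L2_space"
    and "N \<ge> l"
  shows "\<exists>V'\<in>TI_PW_spaces l N. \<forall>V\<in>TI_PW_spaces l N.
    (\<Sum>j=1..m. (L2_norm (\<lambda>x. f j x - orth_proj V' (f j) x))\<^sup>2)
      \<le> (\<Sum>j=1..m. (L2_norm (\<lambda>x. f j x - orth_proj V (f j) x))\<^sup>2)"
proof -
  \<comment> \<open>The total spectral energy of the data; the error of a Paley-Wiener space is a constant minus
    the energy that its spectrum captures.\<close>
  define H where "H \<omega> = (\<Sum>j=1..m. (norm (fourier_L2 (f j) \<omega>))\<^sup>2)" for \<omega>
  have FL: "fourier_L2 (f j) \<in> L2_space" if "j \<in> {1..m}" for j
    by (rule fourier_pairD(2)[OF fourier_L2_pair[OF assms(1)[OF that]]])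
  have H: "integrable lebesgue H"
    unfolding H_def by (intro Bochner_Integration.integrable_sum L2_integrable FL)
  have err: "(\<Sum>j=1..m. (L2_norm (\<lambda>x. f j x - orth_proj (paley_wiener \<Omega>) (f j) x))\<^sup>2)
      = (\<Sum>j=1..m. (L2_norm (f j))\<^sup>2) - (LINT \<omega>|lebesgue. indicator \<Omega> \<omega> * H \<omega>)"
    if \<Omega>: "\<Omega> \<in> sets lebesgue" for \<Omega>
  proof -
    have "(LINT \<omega>|lebesgue. indicator \<Omega> \<omega> * H \<omega>)
        = (\<Sum>j=1..m. LINT \<omega>|lebesgue. indicator \<Omega> \<omega> * (norm (fourier_L2 (f j) \<omega>))\<^sup>2)"
      unfolding H_def sum_distrib_left
      using integrable_real_mult_indicator[OF \<Omega> L2_integrable[OF FL]]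
      by (intro Bochner_Integration.integral_sum) (simp add: mult.commute)
    then show ?thesis
      by (simp add: paley_wiener_projection_error[OF \<Omega> assms(1)] sum_subtractf)
  qed
  let ?T = "top_tiles l N H"
  have T: "?T \<in> multi_tile_sets l N"
    by (rule top_tiles_multi_tile[OF borel_measurable_integrable[OF H] assms(2)])
  note TD = multi_tile_setsD[OF T]
  have "paley_wiener ?T \<in> TI_PW_spaces l N"
    unfolding TI_PW_spaces_def using paley_wiener_in_TI_spaces[OF TD(2,3,4)] T by blast
  moreover have "(\<Sum>j=1..m. (L2_norm (\<lambda>x. f j x - orth_proj (paley_wiener ?T) (f j) x))\<^sup>2)
      \<le> (\<Sum>j=1..m. (L2_norm (\<lambda>x. f j x - orth_proj V (f j) x))\<^sup>2)" if V: "V \<in> TI_PW_spaces l N" for V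
  proof -
    obtain \<Omega> where \<Omega>: "\<Omega> \<in> multi_tile_sets l N" "V = paley_wiener \<Omega>"
      using V by (auto simp: TI_PW_spaces_def)
    show ?thesis
      unfolding \<Omega>(2) err[OF TD(3)] err[OF multi_tile_setsD(3)[OF \<Omega>(1)]]
      using top_tiles_optimal[OF H assms(2) \<Omega>(1)] by simp
  qed
  ultimately show ?thesis by blast
qed

end
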